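(* In Bishop-style constructive mathematics (BISH), assume Markov's principle (MP) and the anti-Specker property $\mathbf{AS}_{[0,1]}$. Then a decreasing sequence of nonnegative real numbers converges to $0$ if and only if it is apparently convergent to $0$.
   Context: BISH (Bishop-style constructive mathematics) means mathematics carried out with intuitionistic logic, as presented in the books of Bishop, Bishop and Bridges, and Bridges and Vîţă, within a constructive set- or type-theoretic framework (such as constructive set theory or Martin-Löf type theory). The law of excluded middle is not assumed. A sequence $(x_n)_{n\geqslant1}$ is decreasing if $x_{n+1}\leqslant x_n$ for all $n$. MP: for each binary sequence $(a_n)_{n\geqslant 1}$, if it is impossible that $a_n=0$ for all $n$, then there exists $n$ with $a_n=1$. A sequence $(x_n)_{n\geqslant1}$ in $\mathbb{R}$ is eventually bounded away from a point $y\in\mathbb{R}$ if there exist $\delta>0$ and $N$ such that $|x_n-y|\geqslant\delta$ for all $n\geqslant N$. It is eventually bounded away uniformly from an interval $I$ if there exist $\delta>0$ and $N$ such that $|x_n-y|\geqslant\delta$ for all $n\geqslant N$ and all $y\in I$. $\mathbf{AS}_{[0,1]}$: if $\mathbf{x}$ is a sequence in $\mathbb{R}$ that is eventually bounded away from each point of $[0,1]$, then $\mathbf{x}$ is eventually bounded away uniformly from the interval $[0,1]$. Definition. A decreasing sequence $(x_n)_{n\geqslant1}$ of nonnegative real numbers is apparently convergent to $0$ if it is eventually bounded away from each point of the interval $(0,x_1]$. *)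

theory Defs
  imports Main
begin

text \<open>
  Isabelle/HOL is classical, and there both Markov's principle and the anti-Specker property are
  plain theorems.  A statement about what follows from them in Bishop-style mathematics is
  therefore a statement about derivability in a formal system for such mathematics.  The system
  used here is extensional intuitionistic arithmetic in all finite types (E-HA to the omega, with
  product types), together with the choice principles accepted by Bishop: countable choice and
  (relativised) dependent choice.
\<close>


section \<open>Intuitionistic arithmetic in all finite types\<close>

datatype ty =
    Nat
  | Arr ty ty  (infixr "\<^bold>\<Rightarrow>" 65)
  | Prod ty ty  (infixr "\<^bold>\<times>" 70)

text \<open>
  Variables are de Bruijn indices: \<open>Var 0\<close> is bound by the innermost enclosing binder.
  \<open>Rec a f n\<close> is primitive recursion with values in an arbitrary type.
\<close>

datatype tm =
    Var nat
  | App tm tm  (infixl "\<^bold>\<cdot>" 90)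
  | Lam ty tm
  | Tup tm tm
  | Fst tm
  | Snd tm
  | Zero
  | Succ tm
  | Rec tm tm tm

datatype fm =
    Eq tm tm  (infix "\<^bold>=" 60)
  | Bot
  | And fm fm  (infixr "\<^bold>\<and>" 45)
  | Or fm fm  (infixr "\<^bold>\<or>" 40)
  | Imp fm fm  (infixr "\<^bold>\<longrightarrow>" 35)
  | All ty fm
  | Ex ty fm

abbreviation Neg :: "fm \<Rightarrow> fm" where "Neg A \<equiv> A \<^bold>\<longrightarrow> Bot"

abbreviation Iff :: "fm \<Rightarrow> fm \<Rightarrow> fm" (infix "\<^bold>\<longleftrightarrow>" 34)
  where "A \<^bold>\<longleftrightarrow> B \<equiv> (A \<^bold>\<longrightarrow> B) \<^bold>\<and> (B \<^bold>\<longrightarrow> A)"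

text \<open>A context \<open>\<Delta>\<close> lists the types of the variables \<open>Var 0\<close>, \<open>Var 1\<close>, \dots\<close>

primrec has_type :: "tm \<Rightarrow> ty list \<Rightarrow> ty \<Rightarrow> bool" where
  "has_type (Var i) \<Delta> \<tau> \<longleftrightarrow> i < length \<Delta> \<and> \<Delta> ! i = \<tau>"
| "has_type (t \<^bold>\<cdot> u) \<Delta> \<tau> \<longleftrightarrow> (\<exists>\<sigma>. has_type t \<Delta> (\<sigma> \<^bold>\<Rightarrow> \<tau>) \<and> has_type u \<Delta> \<sigma>)"
| "has_type (Lam \<sigma> t) \<Delta> \<tau> \<longleftrightarrow> (\<exists>\<rho>. \<tau> = \<sigma> \<^bold>\<Rightarrow> \<rho> \<and> has_type t (\<sigma> # \<Delta>) \<rho>)"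
| "has_type (Tup t u) \<Delta> \<tau> \<longleftrightarrow> (\<exists>\<sigma> \<rho>. \<tau> = \<sigma> \<^bold>\<times> \<rho> \<and> has_type t \<Delta> \<sigma> \<and> has_type u \<Delta> \<rho>)"
| "has_type (Fst t) \<Delta> \<tau> \<longleftrightarrow> (\<exists>\<sigma>. has_type t \<Delta> (\<tau> \<^bold>\<times> \<sigma>))"
| "has_type (Snd t) \<Delta> \<tau> \<longleftrightarrow> (\<exists>\<sigma>. has_type t \<Delta> (\<sigma> \<^bold>\<times> \<tau>))"
| "has_type Zero \<Delta> \<tau> \<longleftrightarrow> \<tau> = Nat"
| "has_type (Succ t) \<Delta> \<tau> \<longleftrightarrow> \<tau> = Nat \<and> has_type t \<Delta> Nat"
| "has_type (Rec a f n) \<Delta> \<tau> \<longleftrightarrow>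
     has_type a \<Delta> \<tau> \<and> has_type f \<Delta> (Nat \<^bold>\<Rightarrow> \<tau> \<^bold>\<Rightarrow> \<tau>) \<and> has_type n \<Delta> Nat"

primrec wf_fm :: "fm \<Rightarrow> ty list \<Rightarrow> bool" where
  "wf_fm (t \<^bold>= u) \<Delta> \<longleftrightarrow> (\<exists>\<sigma>. has_type t \<Delta> \<sigma> \<and> has_type u \<Delta> \<sigma>)"
| "wf_fm Bot \<Delta> \<longleftrightarrow> True"
| "wf_fm (A \<^bold>\<and> B) \<Delta> \<longleftrightarrow> wf_fm A \<Delta> \<and> wf_fm B \<Delta>"
| "wf_fm (A \<^bold>\<or> B) \<Delta> \<longleftrightarrow> wf_fm A \<Delta> \<and> wf_fm B \<Delta>"
| "wf_fm (A \<^bold>\<longrightarrow> B) \<Delta> \<longleftrightarrow> wf_fm A \<Delta> \<and> wf_fm B \<Delta>"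
| "wf_fm (All \<sigma> A) \<Delta> \<longleftrightarrow> wf_fm A (\<sigma> # \<Delta>)"
| "wf_fm (Ex \<sigma> A) \<Delta> \<longleftrightarrow> wf_fm A (\<sigma> # \<Delta>)"

definition up_ren :: "(nat \<Rightarrow> nat) \<Rightarrow> nat \<Rightarrow> nat"
  where "up_ren \<rho> = case_nat 0 (\<lambda>i. Suc (\<rho> i))"

primrec ren :: "(nat \<Rightarrow> nat) \<Rightarrow> tm \<Rightarrow> tm" where
  "ren \<rho> (Var i) = Var (\<rho> i)"
| "ren \<rho> (t \<^bold>\<cdot> u) = ren \<rho> t \<^bold>\<cdot> ren \<rho> u"
| "ren \<rho> (Lam \<sigma> t) = Lam \<sigma> (ren (up_ren \<rho>) t)"
| "ren \<rho> (Tup t u) = Tup (ren \<rho> t) (ren \<rho> u)"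
| "ren \<rho> (Fst t) = Fst (ren \<rho> t)"
| "ren \<rho> (Snd t) = Snd (ren \<rho> t)"
| "ren \<rho> Zero = Zero"
| "ren \<rho> (Succ t) = Succ (ren \<rho> t)"
| "ren \<rho> (Rec a f n) = Rec (ren \<rho> a) (ren \<rho> f) (ren \<rho> n)"

text \<open>\<open>wk k t\<close> is the term \<open>t\<close> moved under \<open>k\<close> further binders.\<close>

abbreviation wk :: "nat \<Rightarrow> tm \<Rightarrow> tm" where "wk k \<equiv> ren (\<lambda>i. i + k)"

text \<open>Simultaneous, capture-avoiding substitution.\<close>

definition up_sub :: "(nat \<Rightarrow> tm) \<Rightarrow> nat \<Rightarrow> tm"
  where "up_sub s = case_nat (Var 0) (\<lambda>i. wk 1 (s i))"

primrec sub :: "(nat \<Rightarrow> tm) \<Rightarrow> tm \<Rightarrow> tm" where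
  "sub s (Var i) = s i"
| "sub s (t \<^bold>\<cdot> u) = sub s t \<^bold>\<cdot> sub s u"
| "sub s (Lam \<sigma> t) = Lam \<sigma> (sub (up_sub s) t)"
| "sub s (Tup t u) = Tup (sub s t) (sub s u)"
| "sub s (Fst t) = Fst (sub s t)"
| "sub s (Snd t) = Snd (sub s t)"
| "sub s Zero = Zero"
| "sub s (Succ t) = Succ (sub s t)"
| "sub s (Rec a f n) = Rec (sub s a) (sub s f) (sub s n)"

primrec subf :: "(nat \<Rightarrow> tm) \<Rightarrow> fm \<Rightarrow> fm" where
  "subf s (t \<^bold>= u) = (sub s t \<^bold>= sub s u)"
| "subf s Bot = Bot"
| "subf s (A \<^bold>\<and> B) = (subf s A \<^bold>\<and> subf s B)"
| "subf s (A \<^bold>\<or> B) = (subf s A \<^bold>\<or> subf s B)"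
| "subf s (A \<^bold>\<longrightarrow> B) = (subf s A \<^bold>\<longrightarrow> subf s B)"
| "subf s (All \<sigma> A) = All \<sigma> (subf (up_sub s) A)"
| "subf s (Ex \<sigma> A) = Ex \<sigma> (subf (up_sub s) A)"

abbreviation wkf :: "fm \<Rightarrow> fm" where "wkf \<equiv> subf (\<lambda>i. Var (Suc i))"

text \<open>\<open>inst t\<close> replaces \<open>Var 0\<close> by \<open>t\<close> and lowers the other variables by one.\<close>

abbreviation inst :: "tm \<Rightarrow> nat \<Rightarrow> tm" where "inst t \<equiv> case_nat t Var"

text \<open>
  \<open>\<Gamma> \<turnstile>\<^bsub>\<Delta>\<^esub> A\<close>: the formula \<open>A\<close> is derivable from the assumptions \<open>\<Gamma>\<close>, with free variables
  typed by \<open>\<Delta>\<close>.  The logical rules are those of intuitionistic natural deduction; neither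
  excluded middle nor any equivalent is present.
\<close>

inductive proves :: "fm set \<Rightarrow> ty list \<Rightarrow> fm \<Rightarrow> bool" ("_ \<turnstile>\<^bsub>_\<^esub> _" [31, 0, 31] 30) where
  assm: "A \<in> \<Gamma> \<Longrightarrow> wf_fm A \<Delta> \<Longrightarrow> \<Gamma> \<turnstile>\<^bsub>\<Delta>\<^esub> A"
| botE: "\<Gamma> \<turnstile>\<^bsub>\<Delta>\<^esub> Bot \<Longrightarrow> wf_fm A \<Delta> \<Longrightarrow> \<Gamma> \<turnstile>\<^bsub>\<Delta>\<^esub> A"
| andI: "\<Gamma> \<turnstile>\<^bsub>\<Delta>\<^esub> A \<Longrightarrow> \<Gamma> \<turnstile>\<^bsub>\<Delta>\<^esub> B \<Longrightarrow> \<Gamma> \<turnstile>\<^bsub>\<Delta>\<^esub> A \<^bold>\<and> B"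
| andE1: "\<Gamma> \<turnstile>\<^bsub>\<Delta>\<^esub> A \<^bold>\<and> B \<Longrightarrow> \<Gamma> \<turnstile>\<^bsub>\<Delta>\<^esub> A"
| andE2: "\<Gamma> \<turnstile>\<^bsub>\<Delta>\<^esub> A \<^bold>\<and> B \<Longrightarrow> \<Gamma> \<turnstile>\<^bsub>\<Delta>\<^esub> B"
| orI1: "\<Gamma> \<turnstile>\<^bsub>\<Delta>\<^esub> A \<Longrightarrow> wf_fm B \<Delta> \<Longrightarrow> \<Gamma> \<turnstile>\<^bsub>\<Delta>\<^esub> A \<^bold>\<or> B"
| orI2: "\<Gamma> \<turnstile>\<^bsub>\<Delta>\<^esub> B \<Longrightarrow> wf_fm A \<Delta> \<Longrightarrow> \<Gamma> \<turnstile>\<^bsub>\<Delta>\<^esub> A \<^bold>\<or> B"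
| orE: "\<Gamma> \<turnstile>\<^bsub>\<Delta>\<^esub> A \<^bold>\<or> B \<Longrightarrow> insert A \<Gamma> \<turnstile>\<^bsub>\<Delta>\<^esub> C \<Longrightarrow> insert B \<Gamma> \<turnstile>\<^bsub>\<Delta>\<^esub> C \<Longrightarrow> \<Gamma> \<turnstile>\<^bsub>\<Delta>\<^esub> C"
| impI: "wf_fm A \<Delta> \<Longrightarrow> insert A \<Gamma> \<turnstile>\<^bsub>\<Delta>\<^esub> B \<Longrightarrow> \<Gamma> \<turnstile>\<^bsub>\<Delta>\<^esub> A \<^bold>\<longrightarrow> B"
| impE: "\<Gamma> \<turnstile>\<^bsub>\<Delta>\<^esub> A \<^bold>\<longrightarrow> B \<Longrightarrow> \<Gamma> \<turnstile>\<^bsub>\<Delta>\<^esub> A \<Longrightarrow> \<Gamma> \<turnstile>\<^bsub>\<Delta>\<^esub> B"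
| allI: "wkf ` \<Gamma> \<turnstile>\<^bsub>\<sigma> # \<Delta>\<^esub> A \<Longrightarrow> \<Gamma> \<turnstile>\<^bsub>\<Delta>\<^esub> All \<sigma> A"
| allE: "\<Gamma> \<turnstile>\<^bsub>\<Delta>\<^esub> All \<sigma> A \<Longrightarrow> has_type t \<Delta> \<sigma> \<Longrightarrow> \<Gamma> \<turnstile>\<^bsub>\<Delta>\<^esub> subf (inst t) A"
| exI: "wf_fm A (\<sigma> # \<Delta>) \<Longrightarrow> has_type t \<Delta> \<sigma> \<Longrightarrow> \<Gamma> \<turnstile>\<^bsub>\<Delta>\<^esub> subf (inst t) A \<Longrightarrow> \<Gamma> \<turnstile>\<^bsub>\<Delta>\<^esub> Ex \<sigma> A"
| exE: "\<Gamma> \<turnstile>\<^bsub>\<Delta>\<^esub> Ex \<sigma> A \<Longrightarrow> insert A (wkf ` \<Gamma>) \<turnstile>\<^bsub>\<sigma> # \<Delta>\<^esub> wkf C \<Longrightarrow> wf_fm C \<Delta> \<Longrightarrow> \<Gamma> \<turnstile>\<^bsub>\<Delta>\<^esub> C"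
| eq_refl: "has_type t \<Delta> \<sigma> \<Longrightarrow> \<Gamma> \<turnstile>\<^bsub>\<Delta>\<^esub> t \<^bold>= t"
| eq_subst: "wf_fm A (\<sigma> # \<Delta>) \<Longrightarrow> has_type t \<Delta> \<sigma> \<Longrightarrow> has_type u \<Delta> \<sigma> \<Longrightarrow>
    \<Gamma> \<turnstile>\<^bsub>\<Delta>\<^esub> t \<^bold>= u \<Longrightarrow> \<Gamma> \<turnstile>\<^bsub>\<Delta>\<^esub> subf (inst t) A \<Longrightarrow> \<Gamma> \<turnstile>\<^bsub>\<Delta>\<^esub> subf (inst u) A"
| fun_ext: "has_type t \<Delta> (\<sigma> \<^bold>\<Rightarrow> \<tau>) \<Longrightarrow> has_type u \<Delta> (\<sigma> \<^bold>\<Rightarrow> \<tau>) \<Longrightarrow>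
    \<Gamma> \<turnstile>\<^bsub>\<Delta>\<^esub> All \<sigma> (wk 1 t \<^bold>\<cdot> Var 0 \<^bold>= wk 1 u \<^bold>\<cdot> Var 0) \<Longrightarrow> \<Gamma> \<turnstile>\<^bsub>\<Delta>\<^esub> t \<^bold>= u"
| beta: "has_type t (\<sigma> # \<Delta>) \<tau> \<Longrightarrow> has_type u \<Delta> \<sigma> \<Longrightarrow> \<Gamma> \<turnstile>\<^bsub>\<Delta>\<^esub> Lam \<sigma> t \<^bold>\<cdot> u \<^bold>= sub (inst u) t"
| fst_tup: "has_type t \<Delta> \<sigma> \<Longrightarrow> has_type u \<Delta> \<tau> \<Longrightarrow> \<Gamma> \<turnstile>\<^bsub>\<Delta>\<^esub> Fst (Tup t u) \<^bold>= t"
| snd_tup: "has_type t \<Delta> \<sigma> \<Longrightarrow> has_type u \<Delta> \<tau> \<Longrightarrow> \<Gamma> \<turnstile>\<^bsub>\<Delta>\<^esub> Snd (Tup t u) \<^bold>= u"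
| tup_eta: "has_type t \<Delta> (\<sigma> \<^bold>\<times> \<tau>) \<Longrightarrow> \<Gamma> \<turnstile>\<^bsub>\<Delta>\<^esub> Tup (Fst t) (Snd t) \<^bold>= t"
| rec_Zero: "has_type (Rec a f Zero) \<Delta> \<tau> \<Longrightarrow> \<Gamma> \<turnstile>\<^bsub>\<Delta>\<^esub> Rec a f Zero \<^bold>= a"
| rec_Succ: "has_type (Rec a f (Succ n)) \<Delta> \<tau> \<Longrightarrow>
    \<Gamma> \<turnstile>\<^bsub>\<Delta>\<^esub> Rec a f (Succ n) \<^bold>= f \<^bold>\<cdot> n \<^bold>\<cdot> Rec a f n"
| Succ_inject: "\<Gamma> \<turnstile>\<^bsub>\<Delta>\<^esub> Succ t \<^bold>= Succ u \<Longrightarrow> \<Gamma> \<turnstile>\<^bsub>\<Delta>\<^esub> t \<^bold>= u"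
| Succ_Zero: "\<Gamma> \<turnstile>\<^bsub>\<Delta>\<^esub> Succ t \<^bold>= Zero \<Longrightarrow> \<Gamma> \<turnstile>\<^bsub>\<Delta>\<^esub> Bot"
| nat_induct: "\<Gamma> \<turnstile>\<^bsub>\<Delta>\<^esub> subf (inst Zero) A \<Longrightarrow>
    \<Gamma> \<turnstile>\<^bsub>\<Delta>\<^esub> All Nat (A \<^bold>\<longrightarrow> subf (case_nat (Succ (Var 0)) (\<lambda>i. Var (Suc i))) A) \<Longrightarrow>
    \<Gamma> \<turnstile>\<^bsub>\<Delta>\<^esub> All Nat A"
\<comment> \<open>countable choice: from \<open>\<forall>n \<exists>y. A n y\<close> infer \<open>\<exists>f \<forall>n. A n (f n)\<close>;
    in \<open>A\<close>, \<open>y\<close> is \<open>Var 0\<close> and \<open>n\<close> is \<open>Var 1\<close>\<close>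
| choice: "\<Gamma> \<turnstile>\<^bsub>\<Delta>\<^esub> All Nat (Ex \<sigma> A) \<Longrightarrow>
    \<Gamma> \<turnstile>\<^bsub>\<Delta>\<^esub> Ex (Nat \<^bold>\<Rightarrow> \<sigma>) (All Nat
      (subf (case_nat (Var 1 \<^bold>\<cdot> Var 0) (case_nat (Var 0) (\<lambda>i. Var (i + 2)))) A))"
\<comment> \<open>dependent choice on \<open>{x. D x}\<close>: from \<open>\<forall>x. D x \<longrightarrow> (\<exists>y. D y \<and> A x y)\<close> infer
    \<open>\<forall>x. D x \<longrightarrow> (\<exists>f. f 0 = x \<and> (\<forall>n. D (f n) \<and> A (f n) (f (n + 1))))\<close>;
    in \<open>A\<close>, \<open>y\<close> is \<open>Var 0\<close> and \<open>x\<close> is \<open>Var 1\<close>\<close>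
| dep_choice: "wf_fm D (\<sigma> # \<Delta>) \<Longrightarrow>
    \<Gamma> \<turnstile>\<^bsub>\<Delta>\<^esub> All \<sigma> (D \<^bold>\<longrightarrow> Ex \<sigma> (subf (case_nat (Var 0) (\<lambda>i. Var (i + 2))) D \<^bold>\<and> A)) \<Longrightarrow>
    \<Gamma> \<turnstile>\<^bsub>\<Delta>\<^esub> All \<sigma> (D \<^bold>\<longrightarrow> Ex (Nat \<^bold>\<Rightarrow> \<sigma>) (Var 0 \<^bold>\<cdot> Zero \<^bold>= Var 1 \<^bold>\<and> All Nat
      (subf (case_nat (Var 1 \<^bold>\<cdot> Var 0) (\<lambda>i. Var (i + 3))) D \<^bold>\<and>
       subf (case_nat (Var 1 \<^bold>\<cdot> Succ (Var 0)) (case_nat (Var 1 \<^bold>\<cdot> Var 0) (\<lambda>i. Var (i + 3)))) A)))"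


section \<open>Natural and rational numbers inside the system\<close>

text \<open>
  The operations below build terms and formulas from given ones; each of them weakens its arguments
  when it puts them under a binder, so that they may be used in any context.
\<close>

definition add :: "tm \<Rightarrow> tm \<Rightarrow> tm"
  where "add t u = Rec t (Lam Nat (Lam Nat (Succ (Var 0)))) u"

definition mul :: "tm \<Rightarrow> tm \<Rightarrow> tm"
  where "mul t u = Rec Zero (Lam Nat (Lam Nat (add (Var 0) (wk 2 t)))) u"

definition npred :: "tm \<Rightarrow> tm"
  where "npred t = Rec Zero (Lam Nat (Lam Nat (Var 1))) t"

definition monus :: "tm \<Rightarrow> tm \<Rightarrow> tm"
  where "monus t u = Rec t (Lam Nat (Lam Nat (npred (Var 0)))) u"

definition nle :: "tm \<Rightarrow> tm \<Rightarrow> fm"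
  where "nle t u = Ex Nat (add (wk 1 t) (Var 0) \<^bold>= wk 1 u)"

abbreviation nlt :: "tm \<Rightarrow> tm \<Rightarrow> fm" where "nlt t u \<equiv> nle (Succ t) u"

text \<open>The triple \<open>((a, b), c)\<close> stands for the rational number \<open>(a - b) / (c + 1)\<close>.\<close>

abbreviation Rat :: ty where "Rat \<equiv> (Nat \<^bold>\<times> Nat) \<^bold>\<times> Nat"

abbreviation qpos :: "tm \<Rightarrow> tm" where "qpos q \<equiv> Fst (Fst q)"
abbreviation qneg :: "tm \<Rightarrow> tm" where "qneg q \<equiv> Snd (Fst q)"
abbreviation qden :: "tm \<Rightarrow> tm" where "qden q \<equiv> Succ (Snd q)"

definition qzero :: tm where "qzero = Tup (Tup Zero Zero) Zero"

definition qone :: tm where "qone = Tup (Tup (Succ Zero) Zero) Zero"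

text \<open>\<open>unit_frac n\<close> is \<open>1 / (n + 1)\<close>.\<close>

definition unit_frac :: "tm \<Rightarrow> tm" where "unit_frac n = Tup (Tup (Succ Zero) Zero) n"

definition quminus :: "tm \<Rightarrow> tm"
  where "quminus q = Tup (Tup (qneg q) (qpos q)) (Snd q)"

text \<open>The new third component is \<open>(c + 1) (c' + 1) - 1 = c (c' + 1) + c'\<close>.\<close>

definition qadd :: "tm \<Rightarrow> tm \<Rightarrow> tm"
  where "qadd q r = Tup
    (Tup (add (mul (qpos q) (qden r)) (mul (qpos r) (qden q)))
         (add (mul (qneg q) (qden r)) (mul (qneg r) (qden q))))
    (add (mul (Snd q) (qden r)) (Snd r))"

definition qminus :: "tm \<Rightarrow> tm \<Rightarrow> tm" where "qminus q r = qadd q (quminus r)"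

definition qabs :: "tm \<Rightarrow> tm"
  where "qabs q = Tup (Tup (add (monus (qpos q) (qneg q)) (monus (qneg q) (qpos q))) Zero) (Snd q)"

definition qle :: "tm \<Rightarrow> tm \<Rightarrow> fm"
  where "qle q r = nle (add (mul (qpos q) (qden r)) (mul (qneg r) (qden q)))
                       (add (mul (qpos r) (qden q)) (mul (qneg q) (qden r)))"

definition qlt :: "tm \<Rightarrow> tm \<Rightarrow> fm"
  where "qlt q r = nlt (add (mul (qpos q) (qden r)) (mul (qneg r) (qden q)))
                       (add (mul (qpos r) (qden q)) (mul (qneg q) (qden r)))"


section \<open>Bishop's real numbers\<close>

text \<open>
  A real number is a regular sequence of rationals, \<open>\<bar>x\<^sub>m - x\<^sub>n\<bar> \<le> 1/m + 1/n\<close> for \<open>m, n \<ge> 1\<close>.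
  All sequences are indexed from 0 here, so that index \<open>n\<close> of a term stands for index
  \<open>n + 1\<close> of Bishop and Bridges; in particular their \<open>x\<^sub>2\<^sub>n\<close> becomes the value at
  \<open>2 (n + 1) - 1 = 2 n + 1\<close>.
\<close>

abbreviation Real :: ty where "Real \<equiv> Nat \<^bold>\<Rightarrow> Rat"

definition is_real :: "tm \<Rightarrow> fm"
  where "is_real x = All Nat (All Nat
    (qle (qabs (qminus (wk 2 x \<^bold>\<cdot> Var 1) (wk 2 x \<^bold>\<cdot> Var 0)))
         (qadd (unit_frac (Var 1)) (unit_frac (Var 0)))))"

definition AllR :: "fm \<Rightarrow> fm" where "AllR A = All Real (is_real (Var 0) \<^bold>\<longrightarrow> A)"

definition ExR :: "fm \<Rightarrow> fm" where "ExR A = Ex Real (is_real (Var 0) \<^bold>\<and> A)"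

definition real_of :: "tm \<Rightarrow> tm" where "real_of q = Lam Nat (wk 1 q)"

definition rminus :: "tm \<Rightarrow> tm \<Rightarrow> tm"
  where "rminus x y = Lam Nat
    (qminus (wk 1 x \<^bold>\<cdot> Succ (add (Var 0) (Var 0))) (wk 1 y \<^bold>\<cdot> Succ (add (Var 0) (Var 0))))"

definition rabs :: "tm \<Rightarrow> tm" where "rabs x = Lam Nat (qabs (wk 1 x \<^bold>\<cdot> Var 0))"

text \<open>Positive: \<open>x\<^sub>n > 1/n\<close> for some \<open>n\<close>.  Nonnegative: \<open>x\<^sub>n \<ge> -1/n\<close> for all \<open>n\<close>.\<close>

definition rpositive :: "tm \<Rightarrow> fm"
  where "rpositive x = Ex Nat (qlt (unit_frac (Var 0)) (wk 1 x \<^bold>\<cdot> Var 0))"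

definition rnonneg :: "tm \<Rightarrow> fm"
  where "rnonneg x = All Nat (qle (quminus (unit_frac (Var 0))) (wk 1 x \<^bold>\<cdot> Var 0))"

definition rlt :: "tm \<Rightarrow> tm \<Rightarrow> fm" where "rlt x y = rpositive (rminus y x)"

definition rle :: "tm \<Rightarrow> tm \<Rightarrow> fm" where "rle x y = rnonneg (rminus y x)"

abbreviation rzero :: tm where "rzero \<equiv> real_of qzero"
abbreviation rone :: tm where "rone \<equiv> real_of qone"


section \<open>Sequences of real numbers\<close>

definition is_real_seq :: "tm \<Rightarrow> fm"
  where "is_real_seq x = All Nat (is_real (wk 1 x \<^bold>\<cdot> Var 0))"

definition decreasing :: "tm \<Rightarrow> fm"
  where "decreasing x = All Nat (rle (wk 1 x \<^bold>\<cdot> Succ (Var 0)) (wk 1 x \<^bold>\<cdot> Var 0))"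

definition nonneg_seq :: "tm \<Rightarrow> fm"
  where "nonneg_seq x = All Nat (rle rzero (wk 1 x \<^bold>\<cdot> Var 0))"

text \<open>\<open>\<forall>k \<exists>N \<forall>n \<ge> N. \<bar>x\<^sub>n - y\<bar> \<le> 1/(k + 1)\<close>\<close>

definition converges :: "tm \<Rightarrow> tm \<Rightarrow> fm"
  where "converges x y = All Nat (Ex Nat (All Nat (nle (Var 1) (Var 0) \<^bold>\<longrightarrow>
    rle (rabs (rminus (wk 3 x \<^bold>\<cdot> Var 0) (wk 3 y))) (real_of (unit_frac (Var 2))))))"

text \<open>\<open>\<exists>\<delta> > 0. \<exists>N. \<forall>n \<ge> N. \<bar>x\<^sub>n - y\<bar> \<ge> \<delta>\<close>\<close>

definition bounded_away :: "tm \<Rightarrow> tm \<Rightarrow> fm"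
  where "bounded_away x y = ExR (rlt rzero (Var 0) \<^bold>\<and> Ex Nat (All Nat (nle (Var 1) (Var 0) \<^bold>\<longrightarrow>
    rle (Var 2) (rabs (rminus (wk 3 x \<^bold>\<cdot> Var 0) (wk 3 y))))))"

definition in_unit_interval :: "tm \<Rightarrow> fm"
  where "in_unit_interval y = (rle rzero y \<^bold>\<and> rle y rone)"

text \<open>\<open>\<exists>\<delta> > 0. \<exists>N. \<forall>n \<ge> N. \<forall>y \<in> [0, 1]. \<bar>x\<^sub>n - y\<bar> \<ge> \<delta>\<close>\<close>

definition unif_bounded_away_unit :: "tm \<Rightarrow> fm"
  where "unif_bounded_away_unit x =
    ExR (rlt rzero (Var 0) \<^bold>\<and> Ex Nat (All Nat (nle (Var 1) (Var 0) \<^bold>\<longrightarrow>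
      AllR (in_unit_interval (Var 0) \<^bold>\<longrightarrow>
        rle (Var 3) (rabs (rminus (wk 4 x \<^bold>\<cdot> Var 1) (Var 0)))))))"

text \<open>\<open>\<forall>y \<in> (0, x\<^sub>1]. x\<close> is eventually bounded away from \<open>y\<close>\<close>

definition apparently_convergent :: "tm \<Rightarrow> fm"
  where "apparently_convergent x =
    AllR (rlt rzero (Var 0) \<^bold>\<and> rle (Var 0) (wk 1 x \<^bold>\<cdot> Zero) \<^bold>\<longrightarrow> bounded_away (wk 1 x) (Var 0))"


section \<open>The two principles\<close>

definition MP :: fm
  where "MP = All (Nat \<^bold>\<Rightarrow> Nat)
    (All Nat (Var 1 \<^bold>\<cdot> Var 0 \<^bold>= Zero \<^bold>\<or> Var 1 \<^bold>\<cdot> Var 0 \<^bold>= Succ Zero) \<^bold>\<longrightarrow>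
     Neg (All Nat (Var 1 \<^bold>\<cdot> Var 0 \<^bold>= Zero)) \<^bold>\<longrightarrow>
     Ex Nat (Var 1 \<^bold>\<cdot> Var 0 \<^bold>= Succ Zero))"

definition AS_unit :: fm
  where "AS_unit = All (Nat \<^bold>\<Rightarrow> Real) (is_real_seq (Var 0) \<^bold>\<longrightarrow>
    AllR (in_unit_interval (Var 0) \<^bold>\<longrightarrow> bounded_away (Var 1) (Var 0)) \<^bold>\<longrightarrow>
    unif_bounded_away_unit (Var 0))"

end

theory Submission
  imports Defs "HOL.Rat"
begin

text \<open>
  The mathematical argument is short.  Let \<open>x\<close> be a decreasing sequence of nonnegative real numbers.
  If \<open>x\<close> converges to \<open>0\<close> and \<open>y > 0\<close>, then eventually \<open>x\<^sub>n\<close> is at most half of \<open>y\<close>, so \<open>x\<close> is eventually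
  bounded away from \<open>y\<close> (lemma \<open>converges_bounded_away\<close>).

  Conversely let \<open>x\<close> be apparently convergent to \<open>0\<close> and \<open>\<epsilon> > 0\<close>.  As \<open>x\<close> is decreasing it suffices to find one
  \<open>x\<^sub>n \<le> \<epsilon>\<close>.  Rational approximations decide, for each \<open>n\<close>, between \<open>x\<^sub>n \<le> \<epsilon>\<close> and \<open>x\<^sub>n \<ge> \<epsilon>/2\<close>, and Markov's
  principle reduces the search to refuting that the second alternative holds for all \<open>n\<close>
  (\<open>markov_search\<close>).  So assume \<open>x\<^sub>n \<ge> 2 u\<close> for all \<open>n\<close>, where \<open>u = \<epsilon>/4\<close>.  The range of \<open>x\<close> lies between
  \<open>2 u\<close> and \<open>x\<^sub>0\<close>, and \<open>x\<close> is eventually bounded away from each point there; by the anti-Specker property, used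
  for the translates \<open>x\<^sub>n - (u + j)\<close> with natural \<open>j\<close>, it is eventually bounded away uniformly
  from each interval \<open>[u + j, u + j + 1]\<close>.  Being decreasing it thus falls
  from below \<open>u + j + 1\<close> to below \<open>u + j\<close>, for every \<open>j\<close>, and in the end to below \<open>u\<close>, which is absurd
  (\<open>shift_bounded_away\<close>, \<open>anti_specker_step\<close>, \<open>not_bounded_below\<close>).

  The work lies in carrying this out as a derivation in a formal system.  Three devices keep it close to
  the informal argument.

  First, derivability is treated as forcing (\<open>w \<Turnstile> A\<close>) over worlds, that is, pairs of a set of assumptions
  and a context.  The rules for the connectives then read like those of a Kripke model, and free variables
  of a derivation are handled as arbitrary terms at arbitrary larger worlds.

  Second, algebra inside the system is reduced to algebra outside.  Polynomial expressions modulo derivable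
  equality form a commutative semiring, and linear expressions in rational terms modulo derivable
  equality form an abelian group, so that an identity valid in all such structures is derivable.  Together with
  Farkas' lemma this shows that every linear inequality with a proof over \<open>\<rat>\<close> from derivable linear hypotheses
  is derivable (theorem \<open>lin\<close>); disjunctive hypotheses are allowed, since a case distinction is a
  passage to a larger world.

  Third, every inequality between real numbers is replaced by inequalities between their rational
  approximations at a common index \<open>k\<close>, with an error that is a fixed multiple of \<open>1/(k + 1)\<close>
  (\<open>rleD\<close>, \<open>rleI\<close>); these are instances of linear arithmetic.
\<close>

section \<open>Renaming, substitution and typing\<close>

lemma up_ren_simps [simp]: "up_ren \<rho> 0 = 0" "up_ren \<rho> (Suc i) = Suc (\<rho> i)"
  by (simp_all add: up_ren_def)

lemma up_sub_simps [simp]: "up_sub s 0 = Var 0" "up_sub s (Suc i) = wk 1 (s i)"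
  by (simp_all add: up_sub_def)

lemma up_ren_comp: "up_ren \<rho> \<circ> up_ren \<rho>' = up_ren (\<rho> \<circ> \<rho>')"
  by (rule ext) (simp add: up_ren_def split: nat.split)

lemma ren_ren: "ren \<rho> (ren \<rho>' t) = ren (\<rho> \<circ> \<rho>') t"
  by (induction t arbitrary: \<rho> \<rho>') (simp_all add: up_ren_comp)

lemma sub_ren: "sub s (ren \<rho> t) = sub (s \<circ> \<rho>) t"
proof (induction t arbitrary: s \<rho>)
  case (Lam \<sigma> t)
  have "up_sub s \<circ> up_ren \<rho> = up_sub (s \<circ> \<rho>)"
    by (rule ext) (simp add: up_ren_def up_sub_def split: nat.split)
  then show ?case by (simp only: sub.simps ren.simps Lam.IH)
qed simp_all

lemma ren_sub: "ren \<rho> (sub s t) = sub (ren \<rho> \<circ> s) t"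
proof (induction t arbitrary: s \<rho>)
  case (Lam \<sigma> t)
  have "ren (up_ren \<rho>) \<circ> up_sub s = up_sub (ren \<rho> \<circ> s)"
    by (rule ext) (simp add: up_sub_def ren_ren o_def split: nat.split)
  then show ?case by (simp only: sub.simps ren.simps Lam.IH)
qed simp_all

lemma up_sub_comp: "sub (up_sub s) \<circ> up_sub r = up_sub (sub s \<circ> r)"
  by (rule ext) (simp add: up_sub_def sub_ren ren_sub o_def split: nat.split)

lemma sub_sub: "sub s (sub r t) = sub (sub s \<circ> r) t"
  by (induction t arbitrary: s r) (simp_all add: up_sub_comp)

lemma up_sub_Var [simp]: "up_sub Var = Var"
  by (rule ext) (simp add: up_sub_def split: nat.split)

lemma sub_Var [simp]: "sub Var t = t"
  by (induction t) simp_all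

lemma subf_subf: "subf s (subf r A) = subf (sub s \<circ> r) A"
  by (induction A arbitrary: s r) (simp_all add: sub_sub up_sub_comp)

lemma subf_Var [simp]: "subf Var A = A"
  by (induction A) simp_all

lemma ren_sub_Var: "ren \<rho> t = sub (\<lambda>i. Var (\<rho> i)) t"
  using ren_sub[of \<rho> Var t] by (simp add: o_def)

text \<open>Weakening is stated for the shapes to which \<open>wk 1, \<dots>, wk 4\<close> simplify; at most four binders separate
  a parameter from its occurrence in the formulas of analysis.\<close>

lemma sub_wk [simp]:
  "sub (up_sub s) (ren Suc t) = ren Suc (sub s t)"
  "sub (up_sub (up_sub s)) (ren (\<lambda>i. Suc (Suc i)) t) = ren (\<lambda>i. Suc (Suc i)) (sub s t)"
  "sub (up_sub (up_sub (up_sub s))) (wk 3 t) = wk 3 (sub s t)"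
  "sub (up_sub (up_sub (up_sub (up_sub s)))) (wk 4 t) = wk 4 (sub s t)"
  by (simp_all add: sub_ren ren_sub o_def ren_ren eval_nat_numeral)

lemma sub_inst_wk [simp]:
  "sub (inst u) (ren Suc t) = t"
  "sub (up_sub (inst u)) (ren (\<lambda>i. Suc (Suc i)) t) = ren Suc t"
  "sub (up_sub (up_sub (inst u))) (wk 3 t) = ren (\<lambda>i. Suc (Suc i)) t"
  "sub (up_sub (up_sub (up_sub (inst u)))) (wk 4 t) = wk 3 t"
  "sub (case_nat u (case_nat v Var)) (ren (\<lambda>i. Suc (Suc i)) t) = t"
  by (simp_all add: ren_sub_Var sub_sub o_def eval_nat_numeral)

lemma wk_eq_iff [simp]:
  "ren Suc t = ren Suc u \<longleftrightarrow> t = u"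
  "ren (\<lambda>i. Suc (Suc i)) t = ren (\<lambda>i. Suc (Suc i)) u \<longleftrightarrow> t = u"
  by (metis sub_inst_wk(1), metis sub_inst_wk(5))

lemma wk_wk [simp]:
  "ren Suc (ren Suc t) = ren (\<lambda>i. Suc (Suc i)) t"
  "ren Suc (ren (\<lambda>i. Suc (Suc i)) t) = wk 3 t" "ren Suc (wk 3 t) = wk 4 t"
  by (simp_all add: ren_ren o_def eval_nat_numeral)

lemma up_sub_numeral [simp]:
  "up_sub s 2 = wk 1 (s (Suc 0))" "up_sub s 3 = wk 1 (s 2)"
  by (simp_all add: eval_nat_numeral)

lemma has_type_ren:
  assumes "\<And>i. i < length \<Delta> \<longleftrightarrow> \<rho> i < length \<Delta>'"
    and "\<And>i. i < length \<Delta> \<Longrightarrow> \<Delta>' ! \<rho> i = \<Delta> ! i"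
  shows "has_type (ren \<rho> t) \<Delta>' \<tau> \<longleftrightarrow> has_type t \<Delta> \<tau>"
  using assms
proof (induction t arbitrary: \<rho> \<Delta> \<Delta>' \<tau>)
  case (Lam \<sigma> t)
  have "has_type (ren (up_ren \<rho>) t) (\<sigma> # \<Delta>') \<rho>' \<longleftrightarrow> has_type t (\<sigma> # \<Delta>) \<rho>'" for \<rho>'
    by (rule Lam.IH) (use Lam.prems in \<open>auto simp: up_ren_def split: nat.splits\<close>)
  then show ?case by simp
next
  case (Var i) then show ?case by auto
next
  case (App t1 t2)
  show ?case by (simp add: App.IH(1)[OF App.prems] App.IH(2)[OF App.prems])
next
  case (Tup t1 t2)
  show ?case by (simp add: Tup.IH(1)[OF Tup.prems] Tup.IH(2)[OF Tup.prems])
next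
  case (Fst t)
  show ?case by (simp add: Fst.IH[OF Fst.prems])
next
  case (Snd t)
  show ?case by (simp add: Snd.IH[OF Snd.prems])
next
  case (Succ t)
  show ?case by (simp add: Succ.IH[OF Succ.prems])
next
  case (Rec t1 t2 t3)
  show ?case by (simp add: Rec.IH(1)[OF Rec.prems] Rec.IH(2)[OF Rec.prems] Rec.IH(3)[OF Rec.prems])
qed simp_all

lemma has_type_wk [simp]:
  "has_type (ren Suc t) (\<sigma>\<^sub>1 # \<Delta>) \<tau> \<longleftrightarrow> has_type t \<Delta> \<tau>"
  "has_type (ren (\<lambda>i. Suc (Suc i)) t) (\<sigma>\<^sub>1 # \<sigma>\<^sub>2 # \<Delta>) \<tau> \<longleftrightarrow> has_type t \<Delta> \<tau>"
  "has_type (wk 3 t) (\<sigma>\<^sub>1 # \<sigma>\<^sub>2 # \<sigma>\<^sub>3 # \<Delta>) \<tau> \<longleftrightarrow> has_type t \<Delta> \<tau>"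
  "has_type (wk 4 t) (\<sigma>\<^sub>1 # \<sigma>\<^sub>2 # \<sigma>\<^sub>3 # \<sigma>\<^sub>4 # \<Delta>) \<tau> \<longleftrightarrow> has_type t \<Delta> \<tau>"
  by (rule has_type_ren; simp add: eval_nat_numeral)+

lemma has_type_unique: "has_type t \<Delta> \<tau> \<Longrightarrow> has_type t \<Delta> \<tau>' \<Longrightarrow> \<tau> = \<tau>'"
proof (induction t arbitrary: \<Delta> \<tau> \<tau>')
  case (App t1 t2)
  then obtain \<sigma> \<sigma>' where "has_type t1 \<Delta> (\<sigma> \<^bold>\<Rightarrow> \<tau>)" "has_type t1 \<Delta> (\<sigma>' \<^bold>\<Rightarrow> \<tau>')" by auto
  from App.IH(1)[OF this] show ?case by simp
next
  case (Lam \<sigma> t)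
  then obtain \<rho> \<rho>' where "\<tau> = \<sigma> \<^bold>\<Rightarrow> \<rho>" "has_type t (\<sigma> # \<Delta>) \<rho>" "\<tau>' = \<sigma> \<^bold>\<Rightarrow> \<rho>'" "has_type t (\<sigma> # \<Delta>) \<rho>'"
    by auto
  with Lam.IH show ?case by blast
next
  case (Tup t1 t2)
  then obtain \<sigma> \<rho> \<sigma>' \<rho>' where "\<tau> = \<sigma> \<^bold>\<times> \<rho>" "\<tau>' = \<sigma>' \<^bold>\<times> \<rho>'" "has_type t1 \<Delta> \<sigma>" "has_type t2 \<Delta> \<rho>"
    "has_type t1 \<Delta> \<sigma>'" "has_type t2 \<Delta> \<rho>'" by auto
  with Tup.IH show ?case by blast
next
  case (Fst t)
  then obtain \<sigma> \<sigma>' where "has_type t \<Delta> (\<tau> \<^bold>\<times> \<sigma>)" "has_type t \<Delta> (\<tau>' \<^bold>\<times> \<sigma>')" by auto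
  from Fst.IH[OF this] show ?case by simp
next
  case (Snd t)
  then obtain \<sigma> \<sigma>' where "has_type t \<Delta> (\<sigma> \<^bold>\<times> \<tau>)" "has_type t \<Delta> (\<sigma>' \<^bold>\<times> \<tau>')" by auto
  from Snd.IH[OF this] show ?case by simp
next
  case (Rec a f n)
  from Rec.IH(1) Rec.prems show ?case by auto
qed simp_all

definition sub_typed :: "(nat \<Rightarrow> tm) \<Rightarrow> ty list \<Rightarrow> ty list \<Rightarrow> bool" where
  "sub_typed s \<Delta> \<Delta>' \<longleftrightarrow> (\<forall>i < length \<Delta>. has_type (s i) \<Delta>' (\<Delta> ! i))"

lemma sub_typed_up: "sub_typed s \<Delta> \<Delta>' \<Longrightarrow> sub_typed (up_sub s) (\<sigma> # \<Delta>) (\<sigma> # \<Delta>')"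
  by (auto simp: sub_typed_def up_sub_def nth_Cons split: nat.split)

lemma sub_typed_inst: "has_type t \<Delta> \<sigma> \<Longrightarrow> sub_typed (inst t) (\<sigma> # \<Delta>) \<Delta>"
  by (auto simp: sub_typed_def nth_Cons split: nat.split)

lemma has_type_sub: "has_type t \<Delta> \<tau> \<Longrightarrow> sub_typed s \<Delta> \<Delta>' \<Longrightarrow> has_type (sub s t) \<Delta>' \<tau>"
proof (induction t arbitrary: s \<Delta> \<Delta>' \<tau>)
  case (Var i) then show ?case by (auto simp: sub_typed_def)
next
  case (Lam \<sigma> t) then show ?case using sub_typed_up by auto
next
  case (App t1 t2) then show ?case by auto blast
next
  case (Tup t1 t2) then show ?case by auto
next
  case (Fst t) then show ?case by auto blast
next
  case (Snd t) then show ?case by auto blast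
qed auto

lemma wf_fm_sub: "wf_fm A \<Delta> \<Longrightarrow> sub_typed s \<Delta> \<Delta>' \<Longrightarrow> wf_fm (subf s A) \<Delta>'"
proof (induction A arbitrary: s \<Delta> \<Delta>')
  case (Eq t u) then show ?case using has_type_sub by simp blast
qed (auto simp: sub_typed_up)

lemma sub_cong: "has_type t \<Delta> \<tau> \<Longrightarrow> (\<And>i. i < length \<Delta> \<Longrightarrow> s i = r i) \<Longrightarrow> sub s t = sub r t"
proof (induction t arbitrary: s r \<Delta> \<tau>)
  case (Lam \<sigma> t)
  obtain \<rho> where "has_type t (\<sigma> # \<Delta>) \<rho>" using Lam.prems by auto
  from Lam.IH[OF this, of "up_sub s" "up_sub r"] Lam.prems(2) show ?case
    by (auto simp: up_sub_def split: nat.split)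
next
  case (App t1 t2)
  obtain \<sigma> where "has_type t1 \<Delta> (\<sigma> \<^bold>\<Rightarrow> \<tau>)" "has_type t2 \<Delta> \<sigma>" using App.prems by auto
  with App show ?case by (metis sub.simps(2))
next
  case (Tup t1 t2)
  then show ?case by (metis has_type.simps(4) sub.simps(4))
next
  case (Fst t)
  then show ?case by (metis has_type.simps(5) sub.simps(5))
next
  case (Snd t)
  then show ?case by (metis has_type.simps(6) sub.simps(6))
next
  case (Succ t)
  then show ?case by (metis has_type.simps(8) sub.simps(8))
next
  case (Rec t1 t2 t3)
  then show ?case by (metis has_type.simps(9) sub.simps(9))
qed simp_all

text \<open>A formula sees a substitution only on the variables of its context; this is what allows
  free variables to be renamed freely outside it.\<close>

lemma subf_cong: "wf_fm A \<Delta> \<Longrightarrow> (\<And>i. i < length \<Delta> \<Longrightarrow> s i = r i) \<Longrightarrow> subf s A = subf r A"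
proof (induction A arbitrary: s r \<Delta>)
  case (Eq t u)
  then show ?case using sub_cong by simp blast
next
  case (All \<sigma> A)
  from All.IH[of "\<sigma> # \<Delta>" "up_sub s" "up_sub r"] All.prems show ?case
    by (auto simp: up_sub_def split: nat.split)
next
  case (Ex \<sigma> A)
  from Ex.IH[of "\<sigma> # \<Delta>" "up_sub s" "up_sub r"] Ex.prems show ?case
    by (auto simp: up_sub_def split: nat.split)
next
  case (And A B)
  then show ?case by (metis subf.simps(3) wf_fm.simps(3))
next
  case (Or A B)
  then show ?case by (metis subf.simps(4) wf_fm.simps(4))
next
  case (Imp A B)
  then show ?case by (metis subf.simps(5) wf_fm.simps(5))
qed simp_all


section \<open>Derivations under substitution\<close>

lemma subf_up_wkf: "subf (up_sub s) (wkf A) = wkf (subf s A)"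
  by (simp add: subf_subf o_def ren_sub_Var)

lemma subf_inst: "subf s (subf (inst t) A) = subf (inst (sub s t)) (subf (up_sub s) A)"
proof -
  have "sub s \<circ> inst t = sub (inst (sub s t)) \<circ> up_sub s"
    by (rule ext) (simp add: up_sub_def split: nat.split)
  then show ?thesis by (simp add: subf_subf)
qed

lemma sub_inst: "sub s (sub (inst t) u) = sub (inst (sub s t)) (sub (up_sub s) u)"
proof -
  have "sub s \<circ> inst t = sub (inst (sub s t)) \<circ> up_sub s"
    by (rule ext) (simp add: up_sub_def split: nat.split)
  then show ?thesis by (simp add: sub_sub)
qed

lemma proves_wf: "\<Gamma> \<turnstile>\<^bsub>\<Delta>\<^esub> A \<Longrightarrow> wf_fm A \<Delta>"
proof (induction rule: proves.induct)
  case (allE \<Gamma> \<Delta> \<sigma> A t)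
  then show ?case using wf_fm_sub[OF _ sub_typed_inst] by simp
next
  case (eq_subst A \<sigma> \<Delta> t u \<Gamma>)
  then show ?case using wf_fm_sub[OF _ sub_typed_inst] by simp
next
  case (beta t \<sigma> \<Delta> \<tau> u \<Gamma>)
  then show ?case using has_type_sub[OF _ sub_typed_inst] by auto
next
  case (choice \<Gamma> \<Delta> \<sigma> A)
  have "sub_typed (case_nat (Var 1 \<^bold>\<cdot> Var 0) (case_nat (Var 0) (\<lambda>i. Var (i + 2))))
      (\<sigma> # Nat # \<Delta>) (Nat # (Nat \<^bold>\<Rightarrow> \<sigma>) # \<Delta>)"
    by (auto simp: sub_typed_def nth_Cons split: nat.split)
  with choice show ?case using wf_fm_sub by simp
next
  case (dep_choice D \<sigma> \<Delta> \<Gamma> A)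
  have 1: "sub_typed (case_nat (Var 1 \<^bold>\<cdot> Var 0) (\<lambda>i. Var (i + 3)))
      (\<sigma> # \<Delta>) (Nat # (Nat \<^bold>\<Rightarrow> \<sigma>) # \<sigma> # \<Delta>)"
    by (auto simp: sub_typed_def nth_Cons eval_nat_numeral split: nat.split)
  have 2: "sub_typed (case_nat (Var 1 \<^bold>\<cdot> Succ (Var 0)) (case_nat (Var 1 \<^bold>\<cdot> Var 0) (\<lambda>i. Var (i + 3))))
      (\<sigma> # \<sigma> # \<Delta>) (Nat # (Nat \<^bold>\<Rightarrow> \<sigma>) # \<sigma> # \<Delta>)"
    by (auto simp: sub_typed_def nth_Cons eval_nat_numeral split: nat.split)
  from dep_choice have "wf_fm D (\<sigma> # \<Delta>)" "wf_fm A (\<sigma> # \<sigma> # \<Delta>)" by auto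
  with wf_fm_sub[OF _ 1] wf_fm_sub[OF _ 2] show ?case by auto
next
  case (orE \<Gamma> \<Delta> A B C) then show ?case by simp
qed auto

text \<open>Derivations are stable under well-typed substitution and under enlarging the set of assumptions at once.
  Weakening, the renaming of variables and the passage from a bound variable to a fresh one are
  all instances.\<close>

theorem proves_sub:
  "\<Gamma> \<turnstile>\<^bsub>\<Delta>\<^esub> A \<Longrightarrow> sub_typed s \<Delta> \<Delta>' \<Longrightarrow> subf s ` \<Gamma> \<subseteq> \<Gamma>' \<Longrightarrow> \<Gamma>' \<turnstile>\<^bsub>\<Delta>'\<^esub> subf s A"
proof (induction arbitrary: s \<Gamma>' \<Delta>' rule: proves.induct)
  case (orE \<Gamma> \<Delta> A B C)
  show ?case
  proof (rule proves.orE)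
    show "\<Gamma>' \<turnstile>\<^bsub>\<Delta>'\<^esub> subf s A \<^bold>\<or> subf s B" using orE.IH(1)[OF orE.prems] by simp
    show "insert (subf s A) \<Gamma>' \<turnstile>\<^bsub>\<Delta>'\<^esub> subf s C" by (rule orE.IH(2)) (use orE.prems in auto)
    show "insert (subf s B) \<Gamma>' \<turnstile>\<^bsub>\<Delta>'\<^esub> subf s C" by (rule orE.IH(3)) (use orE.prems in auto)
  qed
next
  case (impI A \<Delta> \<Gamma> B)
  have "insert (subf s A) \<Gamma>' \<turnstile>\<^bsub>\<Delta>'\<^esub> subf s B" by (rule impI.IH) (use impI.prems in auto)
  then show ?case using impI by (auto intro: proves.impI wf_fm_sub)
next
  case (impE \<Gamma> \<Delta> A B)
  from proves.impE[of \<Gamma>' \<Delta>' "subf s A" "subf s B"] impE.IH[OF impE.prems] show ?case by simp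
next
  case (allI \<Gamma> \<sigma> \<Delta> A)
  have "wkf ` \<Gamma>' \<turnstile>\<^bsub>\<sigma> # \<Delta>'\<^esub> subf (up_sub s) A"
    by (rule allI.IH) (use allI.prems in \<open>auto simp: sub_typed_up subf_up_wkf\<close>)
  then show ?case by (auto intro: proves.allI)
next
  case (allE \<Gamma> \<Delta> \<sigma> A t)
  then show ?case by (auto simp: subf_inst intro!: proves.allE has_type_sub)
next
  case (exI A \<sigma> \<Delta> t \<Gamma>)
  show ?case unfolding subf.simps
  proof (rule proves.exI)
    show "wf_fm (subf (up_sub s) A) (\<sigma> # \<Delta>')" using exI by (auto intro: wf_fm_sub sub_typed_up)
    show "has_type (sub s t) \<Delta>' \<sigma>" using exI by (auto intro: has_type_sub)
    show "\<Gamma>' \<turnstile>\<^bsub>\<Delta>'\<^esub> subf (inst (sub s t)) (subf (up_sub s) A)"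
      using exI.IH[OF exI.prems] by (simp add: subf_inst)
  qed
next
  case (exE \<Gamma> \<Delta> \<sigma> A C)
  show ?case
  proof (rule proves.exE)
    show "\<Gamma>' \<turnstile>\<^bsub>\<Delta>'\<^esub> Ex \<sigma> (subf (up_sub s) A)" using exE.IH(1)[OF exE.prems] by simp
    have "insert (subf (up_sub s) A) (wkf ` \<Gamma>') \<turnstile>\<^bsub>\<sigma> # \<Delta>'\<^esub> subf (up_sub s) (wkf C)"
      by (rule exE.IH(2)) (use exE.prems in \<open>auto simp: sub_typed_up subf_up_wkf\<close>)
    then show "insert (subf (up_sub s) A) (wkf ` \<Gamma>') \<turnstile>\<^bsub>\<sigma> # \<Delta>'\<^esub> wkf (subf s C)"
      by (simp add: subf_up_wkf)
    show "wf_fm (subf s C) \<Delta>'" using exE by (auto intro: wf_fm_sub)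
  qed
next
  case (eq_subst A \<sigma> \<Delta> t u \<Gamma>)
  show ?case unfolding subf_inst
  proof (rule proves.eq_subst)
    show "wf_fm (subf (up_sub s) A) (\<sigma> # \<Delta>')" using eq_subst by (auto intro: wf_fm_sub sub_typed_up)
    show "has_type (sub s t) \<Delta>' \<sigma>" "has_type (sub s u) \<Delta>' \<sigma>"
      using eq_subst by (auto intro: has_type_sub)
    show "\<Gamma>' \<turnstile>\<^bsub>\<Delta>'\<^esub> sub s t \<^bold>= sub s u" using eq_subst.IH(1)[OF eq_subst.prems] by simp
    show "\<Gamma>' \<turnstile>\<^bsub>\<Delta>'\<^esub> subf (inst (sub s t)) (subf (up_sub s) A)"
      using eq_subst.IH(2)[OF eq_subst.prems] by (simp add: subf_inst)
  qed
next
  case (fun_ext t \<Delta> \<sigma> \<tau> u \<Gamma>)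
  show ?case unfolding subf.simps
  proof (rule proves.fun_ext)
    show "has_type (sub s t) \<Delta>' (\<sigma> \<^bold>\<Rightarrow> \<tau>)" "has_type (sub s u) \<Delta>' (\<sigma> \<^bold>\<Rightarrow> \<tau>)"
      using fun_ext by (auto intro: has_type_sub)
    show "\<Gamma>' \<turnstile>\<^bsub>\<Delta>'\<^esub> All \<sigma> (wk 1 (sub s t) \<^bold>\<cdot> Var 0 \<^bold>= wk 1 (sub s u) \<^bold>\<cdot> Var 0)"
      using fun_ext.IH[OF fun_ext.prems] by simp
  qed
next
  case (beta t \<sigma> \<Delta> \<tau> u \<Gamma>)
  have "\<Gamma>' \<turnstile>\<^bsub>\<Delta>'\<^esub> Lam \<sigma> (sub (up_sub s) t) \<^bold>\<cdot> sub s u \<^bold>= sub (inst (sub s u)) (sub (up_sub s) t)"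
    using beta by (intro proves.beta) (auto intro: has_type_sub sub_typed_up)
  then show ?case by (simp add: sub_inst)
next
  case (rec_Zero a f \<Delta> \<tau> \<Gamma>)
  from has_type_sub[OF rec_Zero(1,2)] show ?case by (auto intro!: proves.rec_Zero)
next
  case (rec_Succ a f n \<Delta> \<tau> \<Gamma>)
  from has_type_sub[OF rec_Succ(1,2)] show ?case by (auto intro!: proves.rec_Succ)
next
  case (nat_induct \<Gamma> \<Delta> A)
  have eq: "subf (up_sub s) (subf (case_nat (Succ (Var 0)) (\<lambda>i. Var (Suc i))) A) =
      subf (case_nat (Succ (Var 0)) (\<lambda>i. Var (Suc i))) (subf (up_sub s) A)"
  proof -
    have "sub (up_sub s) \<circ> case_nat (Succ (Var 0)) (\<lambda>i. Var (Suc i)) =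
        sub (case_nat (Succ (Var 0)) (\<lambda>i. Var (Suc i))) \<circ> up_sub s"
      by (rule ext) (simp add: up_sub_def o_def ren_sub_Var sub_sub split: nat.split)
    then show ?thesis by (simp add: subf_subf)
  qed
  show ?case unfolding subf.simps
  proof (rule proves.nat_induct)
    show "\<Gamma>' \<turnstile>\<^bsub>\<Delta>'\<^esub> subf (inst Zero) (subf (up_sub s) A)"
      using nat_induct.IH(1)[OF nat_induct.prems] by (simp add: subf_inst)
    show "\<Gamma>' \<turnstile>\<^bsub>\<Delta>'\<^esub> All Nat (subf (up_sub s) A \<^bold>\<longrightarrow>
        subf (case_nat (Succ (Var 0)) (\<lambda>i. Var (Suc i))) (subf (up_sub s) A))"
      using nat_induct.IH(2)[OF nat_induct.prems] by (simp add: eq)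
  qed
next
  case (choice \<Gamma> \<Delta> \<sigma> A)
  let ?c = "case_nat (Var 1 \<^bold>\<cdot> Var 0) (case_nat (Var 0) (\<lambda>i. Var (i + 2)))"
  have "sub (up_sub (up_sub s)) \<circ> ?c = sub ?c \<circ> up_sub (up_sub s)"
    by (rule ext) (simp add: up_sub_def o_def ren_sub_Var sub_sub split: nat.split)
  then have "subf (up_sub (up_sub s)) (subf ?c A) = subf ?c (subf (up_sub (up_sub s)) A)"
    by (simp add: subf_subf)
  with proves.choice[of \<Gamma>' \<Delta>' \<sigma> "subf (up_sub (up_sub s)) A"] choice.IH[OF choice.prems]
  show ?case by simp
next
  case (dep_choice D \<sigma> \<Delta> \<Gamma> A)
  let ?u = "up_sub s" and ?c = "case_nat (Var 0) (\<lambda>i. Var (i + 2))"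
    and ?d = "case_nat (Var 1 \<^bold>\<cdot> Var 0) (\<lambda>i. Var (i + 3))"
    and ?e = "case_nat (Var 1 \<^bold>\<cdot> Succ (Var 0)) (case_nat (Var 1 \<^bold>\<cdot> Var 0) (\<lambda>i. Var (i + 3)))"
  have "sub (up_sub ?u) \<circ> ?c = sub ?c \<circ> ?u"
    by (rule ext) (simp add: up_sub_def o_def ren_sub_Var sub_sub split: nat.split)
  then have 1: "subf (up_sub ?u) (subf ?c D) = subf ?c (subf ?u D)" by (simp add: subf_subf)
  have "sub (up_sub (up_sub ?u)) \<circ> ?d = sub ?d \<circ> ?u"
    by (rule ext) (simp add: up_sub_def o_def ren_sub_Var sub_sub eval_nat_numeral
        split: nat.split)
  then have 2: "subf (up_sub (up_sub ?u)) (subf ?d D) = subf ?d (subf ?u D)"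
    by (simp add: subf_subf)
  have "sub (up_sub (up_sub ?u)) \<circ> ?e = sub ?e \<circ> up_sub ?u"
    by (rule ext) (simp add: up_sub_def o_def ren_sub_Var sub_sub eval_nat_numeral
        split: nat.split)
  then have 3: "subf (up_sub (up_sub ?u)) (subf ?e A) = subf ?e (subf (up_sub ?u) A)"
    by (simp add: subf_subf)
  have "wf_fm (subf ?u D) (\<sigma> # \<Delta>')" using dep_choice by (auto intro: wf_fm_sub sub_typed_up)
  from proves.dep_choice[OF this, of \<Gamma>' "subf (up_sub ?u) A"] dep_choice.IH[OF dep_choice.prems]
  show ?case by (simp add: 1[simplified] 2[simplified] 3[simplified])
qed (auto intro: proves.assm proves.botE proves.andI proves.andE1 proves.andE2 proves.orI1 proves.orI2
    proves.eq_refl proves.fst_tup proves.snd_tup proves.tup_eta proves.Succ_inject proves.Succ_Zero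
    wf_fm_sub has_type_sub)

section \<open>Worlds\<close>

text \<open>A world consists of assumptions and a context in which they are well formed.  Contexts grow at
  their end: the variables of an old world keep their indices in a new one, so that terms and formulas
  need no renaming when a hypothesis is carried along.\<close>

typedef world = "{(\<Gamma> :: fm set, \<Delta> :: ty list). \<forall>A\<in>\<Gamma>. wf_fm A \<Delta>}"
  by (rule HOL.exI[of _ "({}, [])"]) simp

definition hyps :: "world \<Rightarrow> fm set" where "hyps w = fst (Rep_world w)"
definition ctx :: "world \<Rightarrow> ty list" where "ctx w = snd (Rep_world w)"

lemma wf_hyps: "A \<in> hyps w \<Longrightarrow> wf_fm A (ctx w)"
  using Rep_world[of w] by (auto simp: hyps_def ctx_def)

definition mk_world :: "fm set \<Rightarrow> ty list \<Rightarrow> world" where "mk_world \<Gamma> \<Delta> = Abs_world (\<Gamma>, \<Delta>)"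

lemma mk_world:
  assumes "\<And>A. A \<in> \<Gamma> \<Longrightarrow> wf_fm A \<Delta>"
  shows "hyps (mk_world \<Gamma> \<Delta>) = \<Gamma>" "ctx (mk_world \<Gamma> \<Delta>) = \<Delta>"
  using assms by (simp_all add: hyps_def ctx_def mk_world_def Abs_world_inverse)

instantiation world :: preorder
begin

definition less_eq_world :: "world \<Rightarrow> world \<Rightarrow> bool" where
  "w \<le> w' \<longleftrightarrow> hyps w \<subseteq> hyps w' \<and> (\<exists>\<Delta>. ctx w' = ctx w @ \<Delta>)"

definition less_world :: "world \<Rightarrow> world \<Rightarrow> bool" where
  "less_world w w' \<longleftrightarrow> w \<le> w' \<and> \<not> w' \<le> w"

instance by standard (auto simp: less_eq_world_def less_world_def)

end

definition forces :: "world \<Rightarrow> fm \<Rightarrow> bool"  (infix "\<Turnstile>" 30) where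
  "w \<Turnstile> A \<longleftrightarrow> hyps w \<turnstile>\<^bsub>ctx w\<^esub> A"

abbreviation of_type :: "world \<Rightarrow> tm \<Rightarrow> ty \<Rightarrow> bool" where
  "of_type w t \<sigma> \<equiv> has_type t (ctx w) \<sigma>"

lemma has_type_append: "has_type t \<Delta> \<tau> \<Longrightarrow> has_type t (\<Delta> @ \<Delta>') \<tau>"
proof -
  assume t: "has_type t \<Delta> \<tau>"
  have "sub_typed Var \<Delta> (\<Delta> @ \<Delta>')" by (simp add: sub_typed_def nth_append)
  from has_type_sub[OF t this] show ?thesis by simp
qed

lemma of_type_mono: "of_type w t \<sigma> \<Longrightarrow> w \<le> w' \<Longrightarrow> of_type w' t \<sigma>"
  by (auto simp: less_eq_world_def intro: has_type_append)

lemma wf_fm_append: "wf_fm A \<Delta> \<Longrightarrow> wf_fm A (\<Delta> @ \<Delta>')"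
  using wf_fm_sub[of A \<Delta> Var "\<Delta> @ \<Delta>'"] by (simp add: sub_typed_def nth_append)

lemma wf_fm_mono: "wf_fm A (ctx w) \<Longrightarrow> w \<le> w' \<Longrightarrow> wf_fm A (ctx w')"
  by (auto simp: less_eq_world_def intro: wf_fm_append)

lemma forces_wf: "w \<Turnstile> A \<Longrightarrow> wf_fm A (ctx w)"
  unfolding forces_def by (rule proves_wf)

lemma forces_mono: "w \<Turnstile> A \<Longrightarrow> w \<le> w' \<Longrightarrow> w' \<Turnstile> A"
  using proves_sub[of "hyps w" "ctx w" A Var "ctx w'" "hyps w'"]
  by (auto simp: forces_def less_eq_world_def sub_typed_def nth_append)

lemma forces_assm: "A \<in> hyps w \<Longrightarrow> w \<Turnstile> A"
  unfolding forces_def by (rule proves.assm) (auto intro: wf_hyps)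

text \<open>Worlds are extended by an assumption or by a fresh variable, the new variable being the last one
  of the context.\<close>

lemma extend_hyp:
  assumes "wf_fm A (ctx w)"
  obtains w' where "w \<le> w'" "hyps w' = insert A (hyps w)" "ctx w' = ctx w"
proof (rule that[of "mk_world (insert A (hyps w)) (ctx w)"])
  show "hyps (mk_world (insert A (hyps w)) (ctx w)) = insert A (hyps w)"
    and "ctx (mk_world (insert A (hyps w)) (ctx w)) = ctx w"
    using assms wf_hyps by (auto intro!: mk_world)
  then show "w \<le> mk_world (insert A (hyps w)) (ctx w)" by (auto simp: less_eq_world_def)
qed

lemma extend_var:
  obtains w' where "w \<le> w'" "hyps w' = hyps w" "ctx w' = ctx w @ [\<sigma>]"
proof (rule that[of "mk_world (hyps w) (ctx w @ [\<sigma>])"])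
  show "hyps (mk_world (hyps w) (ctx w @ [\<sigma>])) = hyps w"
    and "ctx (mk_world (hyps w) (ctx w @ [\<sigma>])) = ctx w @ [\<sigma>]"
    using wf_hyps by (auto intro!: mk_world wf_fm_append)
  then show "w \<le> mk_world (hyps w) (ctx w @ [\<sigma>])" by (auto simp: less_eq_world_def)
qed


section \<open>Logical rules between worlds\<close>

text \<open>Derivability satisfies the clauses of forcing in a Kripke model for conjunction, implication and
  the universal quantifier.  A disjunction or an existential statement is not decided at the world itself;
  it may be used towards any goal at the price of passing to a larger world.\<close>

lemma f_impI:
  assumes "wf_fm A (ctx w)" "\<And>w'. w \<le> w' \<Longrightarrow> w' \<Turnstile> A \<Longrightarrow> w' \<Turnstile> B"
  shows "w \<Turnstile> A \<^bold>\<longrightarrow> B"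
proof -
  obtain w' where w': "w \<le> w'" "hyps w' = insert A (hyps w)" "ctx w' = ctx w"
    using extend_hyp[OF assms(1)] .
  then have "w' \<Turnstile> B" by (intro assms(2) forces_assm) auto
  with w' assms(1) show ?thesis by (auto simp: forces_def intro: proves.impI)
qed

lemma f_impE: "w \<Turnstile> A \<^bold>\<longrightarrow> B \<Longrightarrow> w \<le> w' \<Longrightarrow> w' \<Turnstile> A \<Longrightarrow> w' \<Turnstile> B"
  using forces_mono[of w "A \<^bold>\<longrightarrow> B" w'] by (auto simp: forces_def intro: proves.impE)

lemma f_conj_iff: "w \<Turnstile> A \<^bold>\<and> B \<longleftrightarrow> (w \<Turnstile> A) \<and> (w \<Turnstile> B)"
  by (auto simp: forces_def intro: proves.andI proves.andE1 proves.andE2)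

lemma f_botE: "w \<Turnstile> Bot \<Longrightarrow> wf_fm A (ctx w) \<Longrightarrow> w \<Turnstile> A"
  by (auto simp: forces_def intro: proves.botE)

lemma f_orI1: "w \<Turnstile> A \<Longrightarrow> wf_fm B (ctx w) \<Longrightarrow> w \<Turnstile> A \<^bold>\<or> B"
  and f_orI2: "w \<Turnstile> B \<Longrightarrow> wf_fm A (ctx w) \<Longrightarrow> w \<Turnstile> A \<^bold>\<or> B"
  by (auto simp: forces_def intro: proves.orI1 proves.orI2)

lemma f_orE:
  assumes "w \<Turnstile> A \<^bold>\<or> B" "\<And>w'. w \<le> w' \<Longrightarrow> w' \<Turnstile> A \<Longrightarrow> w' \<Turnstile> C" "\<And>w'. w \<le> w' \<Longrightarrow> w' \<Turnstile> B \<Longrightarrow> w' \<Turnstile> C"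
  shows "w \<Turnstile> C"
proof -
  have wf: "wf_fm A (ctx w)" "wf_fm B (ctx w)" using forces_wf[OF assms(1)] by auto
  obtain w1 where w1: "w \<le> w1" "hyps w1 = insert A (hyps w)" "ctx w1 = ctx w"
    using extend_hyp[OF wf(1)] .
  obtain w2 where w2: "w \<le> w2" "hyps w2 = insert B (hyps w)" "ctx w2 = ctx w"
    using extend_hyp[OF wf(2)] .
  have "w1 \<Turnstile> A" "w2 \<Turnstile> B" using w1 w2 by (auto intro: forces_assm)
  then have "w1 \<Turnstile> C" "w2 \<Turnstile> C" using assms(2,3) w1(1) w2(1) by auto
  with w1 w2 assms(1) show ?thesis by (auto simp: forces_def intro: proves.orE)
qed

text \<open>Turning the last variable of a context into the first one is the renaming that relates
  the eigenvariable of a quantifier rule to a freshly added variable.\<close>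

lemma subf_fresh:
  assumes "wf_fm A (\<sigma> # \<Delta>)"
  shows "subf (\<lambda>i. if i = length \<Delta> then Var 0 else Var (Suc i)) (subf (inst (Var (length \<Delta>))) A) = A"
proof -
  have "subf (sub (\<lambda>i. if i = length \<Delta> then Var 0 else Var (Suc i)) \<circ> inst (Var (length \<Delta>))) A = subf Var A"
    by (rule subf_cong[OF assms]) (auto simp: less_Suc_eq_0_disj)
  then show ?thesis by (simp add: subf_subf)
qed

lemma sub_typed_fresh:
  "sub_typed (\<lambda>i. if i = length \<Delta> then Var 0 else Var (Suc i)) (\<Delta> @ [\<sigma>]) (\<sigma> # \<Delta>)"
  by (auto simp: sub_typed_def nth_append)

lemma subf_wk_old:
  "wf_fm A \<Delta> \<Longrightarrow> subf (\<lambda>i. if i = length \<Delta> then Var 0 else Var (Suc i)) A = wkf A"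
  by (rule subf_cong) auto

lemma f_allI:
  assumes wf: "wf_fm A (\<sigma> # ctx w)"
    and all: "\<And>w' t. w \<le> w' \<Longrightarrow> of_type w' t \<sigma> \<Longrightarrow> w' \<Turnstile> subf (inst t) A"
  shows "w \<Turnstile> All \<sigma> A"
proof -
  let ?s = "\<lambda>i. if i = length (ctx w) then Var 0 else Var (Suc i)"
  obtain w' where w': "w \<le> w'" "hyps w' = hyps w" "ctx w' = ctx w @ [\<sigma>]" by (rule extend_var)
  then have "w' \<Turnstile> subf (inst (Var (length (ctx w)))) A" by (intro all) auto
  then have "subf ?s ` hyps w \<turnstile>\<^bsub>\<sigma> # ctx w\<^esub> subf ?s (subf (inst (Var (length (ctx w)))) A)"
    unfolding forces_def w' by (rule proves_sub[OF _ sub_typed_fresh]) simp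
  moreover have "subf ?s ` hyps w = wkf ` hyps w"
    by (rule image_cong) (auto intro: subf_wk_old wf_hyps)
  ultimately show ?thesis unfolding forces_def subf_fresh[OF wf] by (auto intro: proves.allI)
qed

lemma f_allE: "w \<Turnstile> All \<sigma> A \<Longrightarrow> w \<le> w' \<Longrightarrow> of_type w' t \<sigma> \<Longrightarrow> w' \<Turnstile> subf (inst t) A"
  using forces_mono[of w "All \<sigma> A" w'] by (auto simp: forces_def intro: proves.allE)

lemma f_exI: "wf_fm A (\<sigma> # ctx w) \<Longrightarrow> of_type w t \<sigma> \<Longrightarrow> w \<Turnstile> subf (inst t) A \<Longrightarrow> w \<Turnstile> Ex \<sigma> A"
  by (auto simp: forces_def intro: proves.exI)

lemma f_exE:
  assumes ex: "w \<Turnstile> Ex \<sigma> A" and C: "wf_fm C (ctx w)"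
    and step: "\<And>w' t. w \<le> w' \<Longrightarrow> of_type w' t \<sigma> \<Longrightarrow> w' \<Turnstile> subf (inst t) A \<Longrightarrow> w' \<Turnstile> C"
  shows "w \<Turnstile> C"
proof -
  let ?n = "length (ctx w)" and ?s = "\<lambda>i. if i = length (ctx w) then Var 0 else Var (Suc i)"
  have wf: "wf_fm A (\<sigma> # ctx w)" using forces_wf[OF ex] by simp
  obtain w1 where w1: "w \<le> w1" "hyps w1 = hyps w" "ctx w1 = ctx w @ [\<sigma>]" by (rule extend_var)
  have t: "of_type w1 (Var ?n) \<sigma>" by (simp add: w1)
  have "sub_typed (inst (Var ?n)) (\<sigma> # ctx w) (ctx w1)"
    by (auto simp: sub_typed_def w1 nth_Cons nth_append split: nat.split)
  then have "wf_fm (subf (inst (Var ?n)) A) (ctx w1)" using wf wf_fm_sub by blast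
  then obtain w2 where w2: "w1 \<le> w2" "hyps w2 = insert (subf (inst (Var ?n)) A) (hyps w1)"
      "ctx w2 = ctx w1" by (rule extend_hyp)
  have "w2 \<Turnstile> C"
    using step[of w2 "Var ?n"] w1(1) w2 t order_trans[of w w1 w2] by (auto intro: forces_assm)
  then have "subf ?s ` hyps w2 \<turnstile>\<^bsub>\<sigma> # ctx w\<^esub> subf ?s C"
    unfolding forces_def w2 w1 by (rule proves_sub[OF _ sub_typed_fresh]) simp
  moreover have "subf ?s ` hyps w2 = insert A (wkf ` hyps w)"
    by (simp add: w2 w1 subf_fresh[OF wf]) (rule arg_cong[of _ _ "insert A"],
      rule image_cong, auto intro: subf_wk_old wf_hyps)
  ultimately show ?thesis using ex C
    by (auto simp: forces_def subf_wk_old[OF C] intro: proves.exE)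
qed

text \<open>Induction is applied at the world where the parameters of \<open>A\<close> live, while the term for which the
  result is needed may come from a later one.\<close>

lemma f_nat_induct:
  assumes wf: "wf_fm A (Nat # ctx w)"
    and zero: "w \<Turnstile> subf (inst Zero) A"
    and suc: "\<And>w' n. w \<le> w' \<Longrightarrow> of_type w' n Nat \<Longrightarrow> w' \<Turnstile> subf (inst n) A \<Longrightarrow> w' \<Turnstile> subf (inst (Succ n)) A"
    and t: "w \<le> w'" "of_type w' t Nat"
  shows "w' \<Turnstile> subf (inst t) A"
proof -
  let ?S = "case_nat (Succ (Var 0)) (\<lambda>i. Var (Suc i))"
  have "sub (inst n) \<circ> ?S = inst (Succ n)" for n by (rule ext) (simp split: nat.split)
  then have S: "subf (inst n) (subf ?S A) = subf (inst (Succ n)) A" for n by (simp add: subf_subf)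
  have "sub_typed ?S (Nat # ctx w) (Nat # ctx w)"
    by (auto simp: sub_typed_def nth_Cons split: nat.split)
  then have wfS: "wf_fm (subf ?S A) (Nat # ctx w)" using wf wf_fm_sub by blast
  have "w \<Turnstile> All Nat (A \<^bold>\<longrightarrow> subf ?S A)"
  proof (rule f_allI)
    show "wf_fm (A \<^bold>\<longrightarrow> subf ?S A) (Nat # ctx w)" using wf wfS by simp
  next
    fix w' n assume w': "w \<le> w'" "of_type w' n Nat"
    have "sub_typed (inst n) (Nat # ctx w) (ctx w')"
      using w' by (auto simp: sub_typed_def nth_Cons less_eq_world_def nth_append split: nat.split)
    then have "wf_fm (subf (inst n) A) (ctx w')" using wf wf_fm_sub by blast
    then show "w' \<Turnstile> subf (inst n) (A \<^bold>\<longrightarrow> subf ?S A)"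
      using w' of_type_mono by (auto simp: S intro!: f_impI suc intro: order_trans)
  qed
  with zero have "w \<Turnstile> All Nat A" unfolding forces_def by (rule proves.nat_induct)
  then show ?thesis using t by (rule f_allE)
qed

text \<open>Countable choice in the form in which it is used: the formula \<open>A\<close> has the value as \<open>Var 0\<close>
  and the argument as \<open>Var 1\<close>.\<close>

lemma f_choice:
  assumes wf: "wf_fm A (\<sigma> # Nat # ctx w)" and C: "wf_fm C (ctx w)"
    and ex: "\<And>w' n. w \<le> w' \<Longrightarrow> of_type w' n Nat \<Longrightarrow> w' \<Turnstile> Ex \<sigma> (subf (up_sub (inst n)) A)"
    and step: "\<And>w' f. w \<le> w' \<Longrightarrow> of_type w' f (Nat \<^bold>\<Rightarrow> \<sigma>) \<Longrightarrow>
      (\<And>w'' n. w' \<le> w'' \<Longrightarrow> of_type w'' n Nat \<Longrightarrow> w'' \<Turnstile> subf (case_nat (f \<^bold>\<cdot> n) (case_nat n Var)) A) \<Longrightarrow>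
      w' \<Turnstile> C"
  shows "w \<Turnstile> C"
proof -
  let ?c = "case_nat (Var 1 \<^bold>\<cdot> Var 0) (case_nat (Var 0) (\<lambda>i. Var (i + 2)))"
  have "w \<Turnstile> All Nat (Ex \<sigma> A)" using wf ex by (intro f_allI) auto
  then have "w \<Turnstile> Ex (Nat \<^bold>\<Rightarrow> \<sigma>) (All Nat (subf ?c A))" unfolding forces_def by (rule proves.choice)
  then show ?thesis
  proof (rule f_exE[OF _ C])
    fix w' f assume w': "w \<le> w'" "of_type w' f (Nat \<^bold>\<Rightarrow> \<sigma>)" and f: "w' \<Turnstile> subf (inst f) (All Nat (subf ?c A))"
    show "w' \<Turnstile> C"
    proof (rule step[OF w'])
      fix w'' n assume "w' \<le> w''" "of_type w'' n Nat"
      moreover have "sub (inst n) \<circ> (sub (up_sub (inst f)) \<circ> ?c) = case_nat (f \<^bold>\<cdot> n) (case_nat n Var)"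
        by (rule ext) (simp split: nat.split)
      then have "subf (inst n) (subf (up_sub (inst f)) (subf ?c A)) = subf (case_nat (f \<^bold>\<cdot> n) (case_nat n Var)) A"
        by (simp add: subf_subf)
      ultimately show "w'' \<Turnstile> subf (case_nat (f \<^bold>\<cdot> n) (case_nat n Var)) A"
        using f_allE[of w' Nat "subf (up_sub (inst f)) (subf ?c A)" w'' n] f
        by (simp only: subf.simps)
    qed
  qed
qed


section \<open>Equality\<close>

lemma f_refl: "of_type w t \<sigma> \<Longrightarrow> w \<Turnstile> t \<^bold>= t"
  unfolding forces_def by (rule proves.eq_refl)

lemma f_eq_typed:
  assumes "w \<Turnstile> t \<^bold>= u" shows "of_type w t \<sigma> \<longleftrightarrow> of_type w u \<sigma>"
  using forces_wf[OF assms] has_type_unique by auto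

lemma f_subst:
  assumes "w \<Turnstile> t \<^bold>= u" "of_type w t \<sigma>" "wf_fm A (\<sigma> # ctx w)" "w \<Turnstile> subf (inst t) A"
  shows "w \<Turnstile> subf (inst u) A"
  using assms f_eq_typed[OF assms(1)] unfolding forces_def by (auto intro: proves.eq_subst)

lemma f_sym: assumes "w \<Turnstile> t \<^bold>= u" shows "w \<Turnstile> u \<^bold>= t"
proof -
  obtain \<sigma> where "of_type w t \<sigma>" using forces_wf[OF assms] by auto
  with f_subst[OF assms, of \<sigma> "Var 0 \<^bold>= ren Suc t"] show ?thesis by (auto intro: f_refl)
qed

lemma f_trans [trans]: assumes "w \<Turnstile> t \<^bold>= u" "w \<Turnstile> u \<^bold>= v" shows "w \<Turnstile> t \<^bold>= v"
proof -
  obtain \<sigma> where "of_type w u \<sigma>" "of_type w t \<sigma>" "of_type w v \<sigma>"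
    using forces_wf[OF assms(1)] f_eq_typed[OF assms(2)] by auto
  with f_subst[OF assms(2), of \<sigma> "ren Suc t \<^bold>= Var 0"] assms(1) show ?thesis by auto
qed

lemma f_cong:
  assumes "w \<Turnstile> t \<^bold>= u" "of_type w t \<sigma>" "has_type c (\<sigma> # ctx w) \<tau>"
  shows "w \<Turnstile> sub (inst t) c \<^bold>= sub (inst u) c"
proof -
  have "of_type w (sub (inst t) c) \<tau>" using has_type_sub[OF assms(3) sub_typed_inst[OF assms(2)]] .
  then show ?thesis
    using f_subst[OF assms(1,2), of "ren Suc (sub (inst t) c) \<^bold>= c"] assms(3) by (auto intro: f_refl)
qed

section \<open>The semiring of natural numbers\<close>

lemma add_typed [simp]:
  "has_type (add t u) \<Delta> \<tau> \<longleftrightarrow> \<tau> = Nat \<and> has_type t \<Delta> Nat \<and> has_type u \<Delta> Nat"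
  by (auto simp: add_def)

lemma mul_typed [simp]:
  "has_type (mul t u) \<Delta> \<tau> \<longleftrightarrow> \<tau> = Nat \<and> has_type t \<Delta> Nat \<and> has_type u \<Delta> Nat"
  by (auto simp: mul_def)

lemma sub_add [simp]: "sub s (add t u) = add (sub s t) (sub s u)"
  by (simp add: add_def)

lemma sub_mul [simp]: "sub s (mul t u) = mul (sub s t) (sub s u)"
  by (simp add: mul_def)

lemma f_beta: "has_type t (\<sigma> # ctx w) \<tau> \<Longrightarrow> of_type w u \<sigma> \<Longrightarrow> w \<Turnstile> Lam \<sigma> t \<^bold>\<cdot> u \<^bold>= sub (inst u) t"
  unfolding forces_def by (rule proves.beta)

lemma f_app_cong1: "w \<Turnstile> t \<^bold>= u \<Longrightarrow> of_type w t (\<sigma> \<^bold>\<Rightarrow> \<tau>) \<Longrightarrow> of_type w v \<sigma> \<Longrightarrow> w \<Turnstile> t \<^bold>\<cdot> v \<^bold>= u \<^bold>\<cdot> v"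
  using f_cong[of w t u "\<sigma> \<^bold>\<Rightarrow> \<tau>" "Var 0 \<^bold>\<cdot> ren Suc v" \<tau>] by auto

lemma f_beta2:
  assumes "has_type b (\<tau> # \<sigma> # ctx w) \<rho>" "of_type w n \<sigma>" "of_type w r \<tau>"
  shows "w \<Turnstile> Lam \<sigma> (Lam \<tau> b) \<^bold>\<cdot> n \<^bold>\<cdot> r \<^bold>= sub (case_nat r (case_nat n Var)) b"
proof -
  have typed: "has_type (sub (up_sub (inst n)) b) (\<tau> # ctx w) \<rho>"
    by (rule has_type_sub[OF assms(1)]) (rule sub_typed_up[OF sub_typed_inst[OF assms(2)]])
  have "w \<Turnstile> Lam \<sigma> (Lam \<tau> b) \<^bold>\<cdot> n \<^bold>= Lam \<tau> (sub (up_sub (inst n)) b)"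
    using f_beta[of "Lam \<tau> b" \<sigma> w "\<tau> \<^bold>\<Rightarrow> \<rho>" n] assms by simp
  then have "w \<Turnstile> Lam \<sigma> (Lam \<tau> b) \<^bold>\<cdot> n \<^bold>\<cdot> r \<^bold>= Lam \<tau> (sub (up_sub (inst n)) b) \<^bold>\<cdot> r"
    by (rule f_app_cong1[where \<sigma> = \<tau> and \<tau> = \<rho>]) (use assms in auto)
  moreover have "w \<Turnstile> Lam \<tau> (sub (up_sub (inst n)) b) \<^bold>\<cdot> r \<^bold>= sub (inst r) (sub (up_sub (inst n)) b)"
    by (rule f_beta[OF typed assms(3)])
  moreover have "sub (inst r) \<circ> up_sub (inst n) = case_nat r (case_nat n Var)"
    by (rule ext) (simp add: up_sub_def split: nat.split)
  ultimately show ?thesis using f_trans by (simp add: sub_sub)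
qed

lemma f_rec_Zero: "of_type w (Rec a f Zero) \<tau> \<Longrightarrow> w \<Turnstile> Rec a f Zero \<^bold>= a"
  unfolding forces_def by (rule proves.rec_Zero)

lemma f_rec_Succ:
  assumes "of_type w a \<tau>" "has_type b (\<tau> # Nat # ctx w) \<tau>" "of_type w n Nat"
  shows "w \<Turnstile> Rec a (Lam Nat (Lam \<tau> b)) (Succ n) \<^bold>=
    sub (case_nat (Rec a (Lam Nat (Lam \<tau> b)) n) (case_nat n Var)) b"
proof -
  have "w \<Turnstile> Rec a (Lam Nat (Lam \<tau> b)) (Succ n) \<^bold>= Lam Nat (Lam \<tau> b) \<^bold>\<cdot> n \<^bold>\<cdot> Rec a (Lam Nat (Lam \<tau> b)) n"
    unfolding forces_def by (rule proves.rec_Succ[where \<tau> = \<tau>]) (use assms in auto)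
  with f_beta2[of b \<tau> Nat w \<tau> n "Rec a (Lam Nat (Lam \<tau> b)) n"] assms show ?thesis
    by (auto intro: f_trans)
qed

lemma Succ_cong: "w \<Turnstile> t \<^bold>= u \<Longrightarrow> of_type w t Nat \<Longrightarrow> w \<Turnstile> Succ t \<^bold>= Succ u"
  using f_cong[of w t u Nat "Succ (Var 0)" Nat] by simp

lemma add_cong:
  assumes "w \<Turnstile> t \<^bold>= t'" "w \<Turnstile> u \<^bold>= u'" "of_type w t Nat" "of_type w u Nat"
  shows "w \<Turnstile> add t u \<^bold>= add t' u'"
proof -
  have "of_type w t' Nat" using assms f_eq_typed by blast
  then show ?thesis
    using f_cong[of w t t' Nat "add (Var 0) (ren Suc u)" Nat]
      f_cong[of w u u' Nat "add (ren Suc t') (Var 0)" Nat] assms f_trans by auto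
qed

lemma mul_cong:
  assumes "w \<Turnstile> t \<^bold>= t'" "w \<Turnstile> u \<^bold>= u'" "of_type w t Nat" "of_type w u Nat"
  shows "w \<Turnstile> mul t u \<^bold>= mul t' u'"
proof -
  have "of_type w t' Nat" using assms f_eq_typed by blast
  then show ?thesis
    using f_cong[of w t t' Nat "mul (Var 0) (ren Suc u)" Nat]
      f_cong[of w u u' Nat "mul (ren Suc t') (Var 0)" Nat] assms f_trans by auto
qed

lemma add_Zero: "of_type w t Nat \<Longrightarrow> w \<Turnstile> add t Zero \<^bold>= t"
  unfolding add_def by (rule f_rec_Zero[of _ _ _ Nat]) simp

lemma add_Succ: "of_type w t Nat \<Longrightarrow> of_type w u Nat \<Longrightarrow> w \<Turnstile> add t (Succ u) \<^bold>= Succ (add t u)"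
  using f_rec_Succ[of t w Nat "Succ (Var 0)" u] by (simp add: add_def)

lemma mul_Zero: "of_type w t Nat \<Longrightarrow> w \<Turnstile> mul t Zero \<^bold>= Zero"
  unfolding mul_def by (rule f_rec_Zero[of _ _ _ Nat]) simp

lemma mul_Succ: "of_type w t Nat \<Longrightarrow> of_type w u Nat \<Longrightarrow> w \<Turnstile> mul t (Succ u) \<^bold>= add (mul t u) t"
  using f_rec_Succ[of Zero w Nat "add (Var 0) (wk 2 t)" u] by (simp add: mul_def)


section \<open>Polynomial identities\<close>

datatype px = PX nat | PZ | PS px | PA px px (infixl "\<oplus>" 65) | PM px px (infixl "\<otimes>" 70)

primrec pval :: "(nat \<Rightarrow> tm) \<Rightarrow> px \<Rightarrow> tm" where
  "pval \<rho> (PX i) = \<rho> i"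
| "pval \<rho> PZ = Zero"
| "pval \<rho> (PS p) = Succ (pval \<rho> p)"
| "pval \<rho> (p \<oplus> q) = add (pval \<rho> p) (pval \<rho> q)"
| "pval \<rho> (p \<otimes> q) = mul (pval \<rho> p) (pval \<rho> q)"

primrec psub :: "(nat \<Rightarrow> px) \<Rightarrow> px \<Rightarrow> px" where
  "psub \<sigma> (PX i) = \<sigma> i"
| "psub \<sigma> PZ = PZ"
| "psub \<sigma> (PS p) = PS (psub \<sigma> p)"
| "psub \<sigma> (p \<oplus> q) = psub \<sigma> p \<oplus> psub \<sigma> q"
| "psub \<sigma> (p \<otimes> q) = psub \<sigma> p \<otimes> psub \<sigma> q"

lemma pval_psub: "pval \<rho> (psub \<sigma> p) = pval (\<lambda>i. pval \<rho> (\<sigma> i)) p"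
  by (induction p) simp_all

lemma sub_pval: "sub s (pval \<rho> p) = pval (\<lambda>i. sub s (\<rho> i)) p"
  by (induction p) simp_all

lemma pval_typed: "\<forall>i. has_type (\<rho> i) \<Delta> Nat \<Longrightarrow> has_type (pval \<rho> p) \<Delta> Nat"
  by (induction p) auto

lemma pval_cong:
  "\<forall>i. of_type w (\<rho> i) Nat \<Longrightarrow> \<forall>i. w \<Turnstile> \<rho> i \<^bold>= \<rho>' i \<Longrightarrow> w \<Turnstile> pval \<rho> p \<^bold>= pval \<rho>' p"
  by (induction p) (auto intro: f_refl Succ_cong add_cong mul_cong pval_typed)

text \<open>Two polynomial expressions are identified if their equality is derivable for all terms in place of
  the variables.  The quotient is a commutative semiring, so that a calculation in it is worth a derivation.\<close>

definition px_eq :: "px \<Rightarrow> px \<Rightarrow> bool" where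
  "px_eq p q \<longleftrightarrow> (\<forall>w \<rho>. (\<forall>i. of_type w (\<rho> i) Nat) \<longrightarrow> w \<Turnstile> pval \<rho> p \<^bold>= pval \<rho> q)"

quotient_type npoly = px / px_eq
proof (rule equivpI)
  show "reflp px_eq" by (auto simp: reflp_def px_eq_def intro: f_refl pval_typed)
  show "symp px_eq" by (auto simp: symp_def px_eq_def intro: f_sym)
  show "transp px_eq" unfolding transp_def px_eq_def by (meson f_trans)
qed

lift_definition poly :: "px \<Rightarrow> npoly" is "\<lambda>p. p" .

lemma poly_eq_iff: "poly p = poly q \<longleftrightarrow> px_eq p q"
  by transfer simp

lemma npoly_cases: obtains p where "a = poly p"
  by transfer (auto simp: px_eq_def intro: f_refl pval_typed)

instantiation npoly :: "{zero, one, plus, times}"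
begin

lift_definition zero_npoly :: npoly is PZ .
lift_definition one_npoly :: npoly is "PS PZ" .
lift_definition plus_npoly :: "npoly \<Rightarrow> npoly \<Rightarrow> npoly" is PA
  by (auto simp: px_eq_def intro!: add_cong pval_typed)
lift_definition times_npoly :: "npoly \<Rightarrow> npoly \<Rightarrow> npoly" is PM
  by (auto simp: px_eq_def intro!: mul_cong pval_typed)

instance ..

end

lift_definition psuc :: "npoly \<Rightarrow> npoly" is PS
  by (auto simp: px_eq_def intro!: Succ_cong pval_typed)

lemma poly_simps [simp]:
  "poly PZ = 0" "poly (p \<oplus> q) = poly p + poly q" "poly (p \<otimes> q) = poly p * poly q"
  and poly_psuc: "poly (PS p) = psuc (poly p)"
  by (transfer, simp add: px_eq_def f_refl[OF pval_typed] del: pval.simps)+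

lemma npoly_rec:
  "a + 0 = a" "a + psuc b = psuc (a + b)" "a * 0 = 0" "a * psuc b = a * b + a" for a b :: npoly
  by (transfer, auto simp: px_eq_def intro!: add_Zero add_Succ mul_Zero mul_Succ pval_typed)+

lemma npoly_one: "1 = psuc (0 :: npoly)"
  by transfer (auto simp: px_eq_def intro!: f_refl)

text \<open>Goodstein's rule: two functions that agree at \<open>0\<close> and obey the same recursion are equal.  It
  turns the inductive proofs of the semiring laws into calculations.\<close>

lemma npoly_unique:
  assumes zero: "poly (psub (PX(0 := PZ)) p) = poly (psub (PX(0 := PZ)) q)"
    and p: "poly (psub (PX(0 := PS (PX 0))) p) = poly (psub (PX(0 := p)) h)"
    and q: "poly (psub (PX(0 := PS (PX 0))) q) = poly (psub (PX(0 := q)) h)"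
  shows "poly p = poly q"
  unfolding poly_eq_iff px_eq_def
proof (intro HOL.allI HOL.impI)
  fix w and \<rho> :: "nat \<Rightarrow> tm" assume \<rho>: "\<forall>i. of_type w (\<rho> i) Nat"
  define \<rho>' where "\<rho>' i = (if i = 0 then Var 0 else ren Suc (\<rho> i))" for i
  have inst: "sub (inst n) (pval \<rho>' r) = pval (\<rho>(0 := n)) r" for n r
    unfolding sub_pval by (rule arg_cong[of _ _ "\<lambda>\<rho>. pval \<rho> r"]) (auto simp: \<rho>'_def)
  have upd: "pval \<rho> (psub (PX(0 := r)) s) = pval (\<rho>(0 := pval \<rho> r)) s" for \<rho> r s
    unfolding pval_psub by (rule arg_cong[of _ _ "\<lambda>\<rho>. pval \<rho> s"]) auto
  have "\<forall>i. has_type (\<rho>' i) (Nat # ctx w) Nat" using \<rho> by (simp add: \<rho>'_def)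
  from pval_typed[OF this] have wf: "wf_fm (pval \<rho>' p \<^bold>= pval \<rho>' q) (Nat # ctx w)" by auto
  have "w \<Turnstile> subf (inst (\<rho> 0)) (pval \<rho>' p \<^bold>= pval \<rho>' q)"
  proof (rule f_nat_induct[OF wf _ _ order_refl])
    show "w \<Turnstile> subf (inst Zero) (pval \<rho>' p \<^bold>= pval \<rho>' q)"
      using zero \<rho> unfolding poly_eq_iff px_eq_def upd by (simp add: inst)
    show "of_type w (\<rho> 0) Nat" using \<rho> by blast
  next
    fix w' n assume w': "w \<le> w'" and n: "of_type w' n Nat" and IH: "w' \<Turnstile> subf (inst n) (pval \<rho>' p \<^bold>= pval \<rho>' q)"
    let ?\<rho> = "\<rho>(0 := n)"
    have \<rho>_w': "\<forall>i. of_type w' (\<rho> i) Nat" using \<rho> w' of_type_mono by blast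
    then have t: "\<forall>i. of_type w' (?\<rho> i) Nat" using n by simp
    have step: "w' \<Turnstile> pval (\<rho>(0 := Succ n)) r \<^bold>= pval (\<rho>(0 := pval ?\<rho> r)) h"
      if "poly (psub (PX(0 := PS (PX 0))) r) = poly (psub (PX(0 := r)) h)" for r
      using that t unfolding poly_eq_iff px_eq_def upd by (metis fun_upd_same fun_upd_upd pval.simps(1,3))
    have "w' \<Turnstile> pval ?\<rho> p \<^bold>= pval ?\<rho> q" using IH by (simp add: inst)
    then have "w' \<Turnstile> pval (\<rho>(0 := pval ?\<rho> p)) h \<^bold>= pval (\<rho>(0 := pval ?\<rho> q)) h"
      using \<rho>_w' pval_typed[OF t, of p] by (intro pval_cong) (auto simp: fun_upd_def intro: f_refl)
    then have "w' \<Turnstile> pval (\<rho>(0 := Succ n)) p \<^bold>= pval (\<rho>(0 := Succ n)) q"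
      using step[OF p] step[OF q] by (blast intro: f_trans f_sym)
    then show "w' \<Turnstile> subf (inst (Succ n)) (pval \<rho>' p \<^bold>= pval \<rho>' q)" by (simp add: inst)
  qed
  then show "w \<Turnstile> pval \<rho> p \<^bold>= pval \<rho> q" by (simp add: inst)
qed

lemma npoly_inst:
  assumes "poly p = poly q" shows "poly (psub \<sigma> p) = poly (psub \<sigma> q)"
  using assms by (simp add: poly_eq_iff px_eq_def pval_psub pval_typed)

lemma npoly_law:
  fixes a b c :: npoly
  assumes "poly p = poly q"
  obtains \<sigma> where "poly (psub \<sigma> p) = poly (psub \<sigma> q)" "a = poly (\<sigma> 0)" "b = poly (\<sigma> 1)" "c = poly (\<sigma> 2)"
proof -
  obtain x y z where "a = poly x" "b = poly y" "c = poly z" by (metis npoly_cases)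
  with that[of "PX(0 := x, 1 := y, 2 := z)"] npoly_inst[OF assms] show ?thesis by simp
qed

lemma npoly_add_left: "0 + a = a" "psuc b + a = psuc (b + a)" for a b :: npoly
proof -
  have "poly (PZ \<oplus> PX 0) = poly (PX 0)"
    by (rule npoly_unique[where h = "PS (PX 0)"]) (simp_all add: poly_psuc npoly_rec)
  then show "0 + a = a" by (rule npoly_law[of _ _ a a a]) simp
  have "poly (PS (PX 1) \<oplus> PX 0) = poly (PS (PX 1 \<oplus> PX 0))"
    by (rule npoly_unique[where h = "PS (PX 0)"]) (simp_all add: poly_psuc npoly_rec)
  then show "psuc b + a = psuc (b + a)" by (rule npoly_law[of _ _ a b b]) (simp add: poly_psuc)
qed

instance npoly :: comm_monoid_add
proof
  fix a b c :: npoly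
  have "poly (PX 1 \<oplus> PX 0) = poly (PX 0 \<oplus> PX 1)"
    by (rule npoly_unique[where h = "PS (PX 0)"]) (simp_all add: poly_psuc npoly_rec npoly_add_left)
  then show "a + b = b + a" by (rule npoly_law[of _ _ b a a]) simp
  have "poly (PX 1 \<oplus> PX 2 \<oplus> PX 0) = poly (PX 1 \<oplus> (PX 2 \<oplus> PX 0))"
    by (rule npoly_unique[where h = "PS (PX 0)"]) (simp_all add: poly_psuc npoly_rec)
  then show "a + b + c = a + (b + c)" by (rule npoly_law[of _ _ c a b]) simp
  show "0 + a = a" by (rule npoly_add_left)
qed

lemma npoly_mul_left: "0 * a = 0" "psuc b * a = b * a + a" for a b :: npoly
proof -
  have "poly (PZ \<otimes> PX 0) = poly PZ"
    by (rule npoly_unique[where h = "PX 0"]) (simp_all add: poly_psuc npoly_rec)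
  then show "0 * a = 0" by (rule npoly_law[of _ _ a a a]) simp
  have "poly (PS (PX 1) \<otimes> PX 0) = poly (PX 1 \<otimes> PX 0 \<oplus> PX 0)"
    by (rule npoly_unique[where h = "PS (PX 0 \<oplus> PX 1)"])
      (simp_all add: poly_psuc npoly_rec npoly_add_left ac_simps del: add_0 add_0_right)
  then show "psuc b * a = b * a + a" by (rule npoly_law[of _ _ a b b]) (simp add: poly_psuc)
qed

instance npoly :: "{comm_semiring_0, comm_monoid_mult}"
proof
  fix a b c :: npoly
  have comm: "a * b = b * a" for a b :: npoly
  proof -
    have "poly (PX 1 \<otimes> PX 0) = poly (PX 0 \<otimes> PX 1)"
      by (rule npoly_unique[where h = "PX 0 \<oplus> PX 1"]) (simp_all add: poly_psuc npoly_rec npoly_mul_left)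
    then show ?thesis by (rule npoly_law[of _ _ b a a]) simp
  qed
  have distrib: "(a + b) * c = a * c + b * c" for a b c :: npoly
  proof -
    have "poly ((PX 1 \<oplus> PX 2) \<otimes> PX 0) = poly (PX 1 \<otimes> PX 0 \<oplus> PX 2 \<otimes> PX 0)"
      by (rule npoly_unique[where h = "PX 0 \<oplus> (PX 1 \<oplus> PX 2)"]) (simp_all add: poly_psuc npoly_rec ac_simps)
    then show ?thesis by (rule npoly_law[of _ _ c a b]) simp
  qed
  have distrib': "c * (a + b) = c * a + c * b" for a b c :: npoly by (metis comm distrib)
  have "poly (PX 1 \<otimes> PX 2 \<otimes> PX 0) = poly (PX 1 \<otimes> (PX 2 \<otimes> PX 0))"
    by (rule npoly_unique[where h = "PX 0 \<oplus> PX 1 \<otimes> PX 2"]) (simp_all add: poly_psuc npoly_rec distrib')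
  then show "a * b * c = a * (b * c)" by (rule npoly_law[of _ _ c a b]) simp
  show "a * b = b * a" by (rule comm)
  show "(a + b) * c = a * c + b * c" by (rule distrib)
  show "0 * a = 0" "a * 0 = 0" by (rule npoly_mul_left npoly_rec)+
  show "1 * a = a" by (simp add: npoly_one npoly_mul_left)
qed

lemma poly_PS [simp]: "poly (PS p) = poly p + 1"
  by (simp add: poly_psuc npoly_one npoly_rec)

text \<open>Variables without a term in the list take the value \<open>Zero\<close>, which keeps every value well typed.\<close>

definition val :: "tm list \<Rightarrow> px \<Rightarrow> tm" where
  "val ts = pval (\<lambda>i. if i < length ts then ts ! i else Zero)"

lemma val_simps [simp]:
  "val ts (PX i) = (if i < length ts then ts ! i else Zero)"
  "val ts PZ = Zero"
  "val ts (PS p) = Succ (val ts p)"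
  "val ts (p \<oplus> q) = add (val ts p) (val ts q)"
  "val ts (p \<otimes> q) = mul (val ts p) (val ts q)"
  by (simp_all add: val_def)

lemma val_typed: "\<forall>t\<in>set ts. of_type w t Nat \<Longrightarrow> of_type w (val ts p) Nat"
  unfolding val_def by (rule pval_typed) simp

lemma nat_ring:
  "poly p = poly q \<Longrightarrow> \<forall>t\<in>set ts. of_type w t Nat \<Longrightarrow> w \<Turnstile> val ts p \<^bold>= val ts q"
  unfolding poly_eq_iff px_eq_def val_def by simp

lemma add_Zero_left: "of_type w t Nat \<Longrightarrow> w \<Turnstile> add Zero t \<^bold>= t"
  using nat_ring[of "PZ \<oplus> PX 0" "PX 0" "[t]" w] by simp

lemma add_Succ_left: "of_type w t Nat \<Longrightarrow> of_type w u Nat \<Longrightarrow> w \<Turnstile> add (Succ t) u \<^bold>= Succ (add t u)"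
  using nat_ring[of "PS (PX 0) \<oplus> PX 1" "PS (PX 0 \<oplus> PX 1)" "[t, u]" w] by (simp add: ac_simps)

lemma add_comm: "of_type w t Nat \<Longrightarrow> of_type w u Nat \<Longrightarrow> w \<Turnstile> add t u \<^bold>= add u t"
  using nat_ring[of "PX 0 \<oplus> PX 1" "PX 1 \<oplus> PX 0" "[t, u]" w] by (simp add: ac_simps)

lemma add_assoc:
  "of_type w a Nat \<Longrightarrow> of_type w b Nat \<Longrightarrow> of_type w c Nat \<Longrightarrow> w \<Turnstile> add (add a b) c \<^bold>= add a (add b c)"
  using nat_ring[of "PX 0 \<oplus> PX 1 \<oplus> PX 2" "PX 0 \<oplus> (PX 1 \<oplus> PX 2)" "[a, b, c]" w] by (simp add: ac_simps)

lemma add_swap: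
  "of_type w a Nat \<Longrightarrow> of_type w b Nat \<Longrightarrow> of_type w c Nat \<Longrightarrow> w \<Turnstile> add (add a b) c \<^bold>= add (add a c) b"
  using nat_ring[of "PX 0 \<oplus> PX 1 \<oplus> PX 2" "PX 0 \<oplus> PX 2 \<oplus> PX 1" "[a, b, c]" w] by (simp add: ac_simps)


section \<open>The order of natural numbers\<close>

lemma nle_wf [simp]: "wf_fm (nle t u) \<Delta> \<longleftrightarrow> has_type t \<Delta> Nat \<and> has_type u \<Delta> Nat"
  by (auto simp: nle_def)

lemma subf_nle [simp]: "subf s (nle t u) = nle (sub s t) (sub s u)"
  by (simp add: nle_def)

lemma nleI: "w \<Turnstile> add t c \<^bold>= u \<Longrightarrow> of_type w t Nat \<Longrightarrow> of_type w c Nat \<Longrightarrow> w \<Turnstile> nle t u"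
  unfolding nle_def using f_eq_typed[of w "add t c" u Nat]
  by (intro f_exI[where t = c]) auto

lemma nleE:
  assumes "w \<Turnstile> nle t u" "wf_fm C (ctx w)"
    "\<And>w' c. w \<le> w' \<Longrightarrow> of_type w' c Nat \<Longrightarrow> of_type w' t Nat \<Longrightarrow> of_type w' u Nat \<Longrightarrow>
      w' \<Turnstile> add t c \<^bold>= u \<Longrightarrow> w' \<Turnstile> C"
  shows "w \<Turnstile> C"
  using assms(1) unfolding nle_def
proof (rule f_exE[OF _ assms(2)])
  fix w' c assume "w \<le> w'" "of_type w' c Nat" "w' \<Turnstile> subf (inst c) (add (wk 1 t) (Var 0) \<^bold>= wk 1 u)"
  then show "w' \<Turnstile> C" using forces_wf[OF assms(1)] of_type_mono by (auto intro!: assms(3))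
qed

lemma f_Succ_Zero: "w \<Turnstile> Succ t \<^bold>= Zero \<Longrightarrow> w \<Turnstile> Bot"
  unfolding forces_def by (rule proves.Succ_Zero)

lemma f_Succ_inject: "w \<Turnstile> Succ t \<^bold>= Succ u \<Longrightarrow> w \<Turnstile> t \<^bold>= u"
  unfolding forces_def by (rule proves.Succ_inject)

lemma add_cancel:
  assumes eq: "w \<Turnstile> add a c \<^bold>= add b c" and a: "of_type w a Nat" and b: "of_type w b Nat" and c: "of_type w c Nat"
  shows "w \<Turnstile> a \<^bold>= b"
proof -
  let ?A = "add (ren Suc a) (Var 0) \<^bold>= add (ren Suc b) (Var 0) \<^bold>\<longrightarrow> ren Suc a \<^bold>= ren Suc b"
  have "w \<Turnstile> subf (inst c) ?A"
  proof (rule f_nat_induct[OF _ _ _ order_refl c])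
    show "w \<Turnstile> subf (inst Zero) ?A"
      unfolding subf.simps
    proof (rule f_impI)
      fix w' assume "w \<le> w'" and eq: "w' \<Turnstile> sub (inst Zero) (add (ren Suc a) (Var 0)) \<^bold>= sub (inst Zero) (add (ren Suc b) (Var 0))"
      then have "of_type w' a Nat" "of_type w' b Nat" using a b of_type_mono by auto
      then have "w' \<Turnstile> a \<^bold>= add a Zero" "w' \<Turnstile> add b Zero \<^bold>= b" by (auto intro: f_sym add_Zero)
      with eq show "w' \<Turnstile> sub (inst Zero) (ren Suc a) \<^bold>= sub (inst Zero) (ren Suc b)"
        by simp (blast intro: f_trans)
    qed (use a b in auto)
  next
    fix w' n assume w': "w \<le> w'" and n: "of_type w' n Nat" and IH: "w' \<Turnstile> subf (inst n) ?A"
    show "w' \<Turnstile> subf (inst (Succ n)) ?A"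
      unfolding subf.simps
    proof (rule f_impI)
      fix w'' assume w'': "w' \<le> w''" and eq: "w'' \<Turnstile> sub (inst (Succ n)) (add (ren Suc a) (Var 0)) \<^bold>= sub (inst (Succ n)) (add (ren Suc b) (Var 0))"
      then have t: "of_type w'' a Nat" "of_type w'' b Nat" "of_type w'' n Nat"
        using a b n w' of_type_mono by (auto dest: order_trans)
      have "w'' \<Turnstile> Succ (add a n) \<^bold>= Succ (add b n)"
        using eq by simp (use t in \<open>blast intro: f_trans[OF f_trans] f_sym add_Succ\<close>)
      then have "w'' \<Turnstile> add a n \<^bold>= add b n" by (rule f_Succ_inject)
      then show "w'' \<Turnstile> sub (inst (Succ n)) (ren Suc a) \<^bold>= sub (inst (Succ n)) (ren Suc b)"
        using f_impE[of w' "add a n \<^bold>= add b n" "a \<^bold>= b" w''] IH w'' by simp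
    qed (use a b n w' of_type_mono in auto)
  qed (use a b in auto)
  then show ?thesis using eq f_impE[of w "add a c \<^bold>= add b c" "a \<^bold>= b" w] by simp
qed

lemma nle_cong:
  assumes "w \<Turnstile> nle a b" "w \<Turnstile> a \<^bold>= a'" "w \<Turnstile> b \<^bold>= b'"
  shows "w \<Turnstile> nle a' b'"
proof -
  have t: "of_type w a Nat" "of_type w b Nat" using forces_wf[OF assms(1)] by auto
  then have t': "of_type w a' Nat" using assms f_eq_typed by blast
  have "w \<Turnstile> nle a' b" using f_subst[OF assms(2), of Nat "nle (Var 0) (ren Suc b)"] t assms(1) by simp
  then show ?thesis using f_subst[OF assms(3), of Nat "nle (ren Suc a') (Var 0)"] t t' by simp
qed

lemma nle_refl: "of_type w a Nat \<Longrightarrow> w \<Turnstile> nle a a"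
  by (rule nleI[OF add_Zero]) simp_all

lemma nle_Zero: "of_type w a Nat \<Longrightarrow> w \<Turnstile> nle Zero a"
  by (rule nleI[OF add_Zero_left]) simp_all

lemma nle_add_right:
  "of_type w a Nat \<Longrightarrow> of_type w b Nat \<Longrightarrow> w \<Turnstile> nle a (add a b)"
  by (rule nleI[where c = b]) (auto intro: f_refl[of _ _ Nat])

lemma nle_add_mul:
  assumes ab: "w \<Turnstile> nle a b" and cd: "w \<Turnstile> nle c d" and m: "of_type w m Nat" and k: "of_type w k Nat"
  shows "w \<Turnstile> nle (add (mul m a) (mul k c)) (add (mul m b) (mul k d))"
proof -
  have wf: "of_type w a Nat" "of_type w b Nat" "of_type w c Nat" "of_type w d Nat"
    using forces_wf[OF ab] forces_wf[OF cd] by auto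
  show ?thesis
  proof (rule nleE[OF ab])
    fix w' x assume w': "w \<le> w'" and x: "of_type w' x Nat" "w' \<Turnstile> add a x \<^bold>= b"
    have "w' \<Turnstile> nle c d" using cd w' by (rule forces_mono)
    then show "w' \<Turnstile> nle (add (mul m a) (mul k c)) (add (mul m b) (mul k d))"
    proof (rule nleE)
      fix w'' y assume w'': "w' \<le> w''" and y: "of_type w'' y Nat" "w'' \<Turnstile> add c y \<^bold>= d"
      have le: "w \<le> w''" using w' w'' by (rule order_trans)
      have t: "of_type w'' a Nat" "of_type w'' c Nat" "of_type w'' m Nat" "of_type w'' k Nat" "of_type w'' x Nat"
        using wf m k x w'' le of_type_mono by blast+
      have b: "w'' \<Turnstile> add a x \<^bold>= b" using x w'' by (auto intro: forces_mono)
      have "w'' \<Turnstile> add (add (mul m a) (mul k c)) (add (mul m x) (mul k y)) \<^bold>=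
          add (mul m (add a x)) (mul k (add c y))"
        using nat_ring[of "PX 0 \<otimes> PX 1 \<oplus> PX 2 \<otimes> PX 3 \<oplus> (PX 0 \<otimes> PX 4 \<oplus> PX 2 \<otimes> PX 5)"
            "PX 0 \<otimes> (PX 1 \<oplus> PX 4) \<oplus> PX 2 \<otimes> (PX 3 \<oplus> PX 5)" "[m, a, k, c, x, y]" w''] t y
        by (simp add: algebra_simps)
      also have "w'' \<Turnstile> add (mul m (add a x)) (mul k (add c y)) \<^bold>= add (mul m b) (mul k d)"
        using t y b by (intro add_cong mul_cong f_refl[of _ _ Nat]) simp_all
      finally show "w'' \<Turnstile> nle (add (mul m a) (mul k c)) (add (mul m b) (mul k d))"
        by (rule nleI) (use t y in simp_all)
    qed (use wf m k w' of_type_mono in auto)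
  qed (use wf m k in auto)
qed

lemma nle_add_cancel:
  assumes le: "w \<Turnstile> nle (add a c) (add b c)"
  shows "w \<Turnstile> nle a b"
proof (rule nleE[OF le])
  fix w' x assume w': "w \<le> w'" and x: "of_type w' x Nat" "of_type w' (add a c) Nat" "of_type w' (add b c) Nat"
    and eq: "w' \<Turnstile> add (add a c) x \<^bold>= add b c"
  then have "w' \<Turnstile> add (add a x) c \<^bold>= add b c" by (intro f_trans[OF add_swap eq]) auto
  then have "w' \<Turnstile> add a x \<^bold>= b" by (rule add_cancel) (use x in auto)
  then show "w' \<Turnstile> nle a b" by (rule nleI) (use x in auto)
qed (use forces_wf[OF le] in auto)

lemma nle_trans:
  assumes ab: "w \<Turnstile> nle a b" and bc: "w \<Turnstile> nle b c"
  shows "w \<Turnstile> nle a c"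
proof -
  have t: "of_type w a Nat" "of_type w b Nat" "of_type w c Nat" using forces_wf[OF ab] forces_wf[OF bc] by auto
  then have ts: "\<forall>t\<in>set [a, b, c]. of_type w t Nat" by simp
  have one: "of_type w (Succ Zero) Nat" by simp
  have "w \<Turnstile> nle (add a b) (add c b)"
  proof (rule nle_cong[OF nle_add_mul[OF ab bc one one]])
    show "w \<Turnstile> add (mul (Succ Zero) a) (mul (Succ Zero) b) \<^bold>= add a b"
      using nat_ring[of "PS PZ \<otimes> PX 0 \<oplus> PS PZ \<otimes> PX 1" "PX 0 \<oplus> PX 1", OF _ ts] by simp
    show "w \<Turnstile> add (mul (Succ Zero) b) (mul (Succ Zero) c) \<^bold>= add c b"
      using nat_ring[of "PS PZ \<otimes> PX 1 \<oplus> PS PZ \<otimes> PX 2" "PX 2 \<oplus> PX 1", OF _ ts] by (simp add: ac_simps)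
  qed
  then show ?thesis by (rule nle_add_cancel)
qed

lemma nat_cases:
  assumes t: "of_type w t Nat" and C: "wf_fm C (ctx w)"
    and zero: "\<And>w'. w \<le> w' \<Longrightarrow> w' \<Turnstile> t \<^bold>= Zero \<Longrightarrow> w' \<Turnstile> C"
    and suc: "\<And>w' d. w \<le> w' \<Longrightarrow> of_type w' d Nat \<Longrightarrow> w' \<Turnstile> t \<^bold>= Succ d \<Longrightarrow> w' \<Turnstile> C"
  shows "w \<Turnstile> C"
proof -
  let ?A = "Var 0 \<^bold>= Zero \<^bold>\<or> Ex Nat (Var 1 \<^bold>= Succ (Var 0))"
  have "w \<Turnstile> subf (inst t) ?A"
  proof (rule f_nat_induct[OF _ _ _ order_refl t])
    show "w \<Turnstile> subf (inst Zero) ?A" by (auto intro!: f_orI1 f_refl[of _ _ Nat])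
  next
    fix w' n assume n: "of_type w' n Nat"
    then show "w' \<Turnstile> subf (inst (Succ n)) ?A"
      by (auto intro!: f_orI2 f_exI[where t = n] f_refl[of _ _ Nat])
  qed simp
  then have "w \<Turnstile> t \<^bold>= Zero \<^bold>\<or> Ex Nat (ren Suc t \<^bold>= Succ (Var 0))" by simp
  then show ?thesis
  proof (rule f_orE)
    fix w' assume w': "w \<le> w'" "w' \<Turnstile> Ex Nat (ren Suc t \<^bold>= Succ (Var 0))"
    from w'(2) show "w' \<Turnstile> C"
    proof (rule f_exE)
      fix w'' d assume "w' \<le> w''" "of_type w'' d Nat" "w'' \<Turnstile> subf (inst d) (ren Suc t \<^bold>= Succ (Var 0))"
      then show "w'' \<Turnstile> C" using suc[of w'' d] w'(1) order_trans by auto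
    qed (use C w' wf_fm_mono in auto)
  qed (rule zero)
qed

text \<open>Order is decidable; the case distinction of the induction step is on the difference being \<open>0\<close>.\<close>

lemma nle_total:
  assumes t: "of_type w t Nat" and u: "of_type w u Nat"
  shows "w \<Turnstile> nle t u \<^bold>\<or> nlt u t"
proof -
  let ?A = "nle (Var 0) (ren Suc u) \<^bold>\<or> nle (Succ (ren Suc u)) (Var 0)"
  have "w \<Turnstile> subf (inst t) ?A"
  proof (rule f_nat_induct[OF _ _ _ order_refl t])
    show "w \<Turnstile> subf (inst Zero) ?A" using u by (auto intro: f_orI1 nle_Zero)
  next
    fix w' n assume w': "w \<le> w'" and n: "of_type w' n Nat" and "w' \<Turnstile> subf (inst n) ?A"
    then have "w' \<Turnstile> nle n u \<^bold>\<or> nle (Succ u) n" by simp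
    then have "w' \<Turnstile> nle (Succ n) u \<^bold>\<or> nle (Succ u) (Succ n)"
    proof (rule f_orE)
      fix w1 assume w1: "w' \<le> w1" "w1 \<Turnstile> nle (Succ u) n"
      then have t1: "of_type w1 n Nat" "of_type w1 u Nat" using forces_wf[OF w1(2)] by auto
      have "w1 \<Turnstile> add n (Succ Zero) \<^bold>= Succ n"
        using nat_ring[of "PX 0 \<oplus> PS PZ" "PS (PX 0)" "[n]" w1] t1 by simp
      then have "w1 \<Turnstile> nle n (Succ n)" by (rule nleI) (use t1 in auto)
      then have "w1 \<Turnstile> nle (Succ u) (Succ n)" using w1 nle_trans by blast
      then show "w1 \<Turnstile> nle (Succ n) u \<^bold>\<or> nle (Succ u) (Succ n)" by (rule f_orI2) (use t1 in auto)
    next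
      fix w1 assume w1: "w' \<le> w1" "w1 \<Turnstile> nle n u"
      then have t1: "of_type w1 n Nat" "of_type w1 u Nat" using forces_wf[OF w1(2)] by auto
      show "w1 \<Turnstile> nle (Succ n) u \<^bold>\<or> nle (Succ u) (Succ n)"
      proof (rule nleE[OF w1(2)])
        fix w2 x assume w2: "w1 \<le> w2" and x: "of_type w2 x Nat" and eq: "w2 \<Turnstile> add n x \<^bold>= u"
        have t2: "of_type w2 n Nat" "of_type w2 u Nat" using t1 w2 of_type_mono by auto
        show "w2 \<Turnstile> nle (Succ n) u \<^bold>\<or> nle (Succ u) (Succ n)"
        proof (rule nat_cases[OF x])
          fix w3 assume w3: "w2 \<le> w3" and x0: "w3 \<Turnstile> x \<^bold>= Zero"
          have t3: "of_type w3 n Nat" "of_type w3 u Nat" "of_type w3 x Nat" using t2 x w3 of_type_mono by auto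
          have "w3 \<Turnstile> u \<^bold>= add n x" using f_sym[OF eq] w3 by (rule forces_mono)
          also have "w3 \<Turnstile> add n x \<^bold>= add n Zero" using t3 by (intro add_cong[OF _ x0] f_refl[of _ _ Nat])
          also have "w3 \<Turnstile> add n Zero \<^bold>= n" using t3 by (intro add_Zero)
          finally have "w3 \<Turnstile> Succ u \<^bold>= Succ n" by (rule Succ_cong) (use t3 in simp)
          then have "w3 \<Turnstile> nle (Succ u) (Succ n)" using t3 by (intro nle_cong[OF nle_refl f_refl]) auto
          then show "w3 \<Turnstile> nle (Succ n) u \<^bold>\<or> nle (Succ u) (Succ n)" by (rule f_orI2) (use t3 in auto)
        next
          fix w3 d assume w3: "w2 \<le> w3" and d: "of_type w3 d Nat" "w3 \<Turnstile> x \<^bold>= Succ d"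
          have t3: "of_type w3 n Nat" "of_type w3 u Nat" "of_type w3 x Nat" using t2 x w3 of_type_mono by auto
          have "w3 \<Turnstile> add (Succ n) d \<^bold>= add n (Succ d)"
            using nat_ring[of "PS (PX 0) \<oplus> PX 1" "PX 0 \<oplus> PS (PX 1)" "[n, d]" w3] t3 d
            by (simp add: algebra_simps)
          also have "w3 \<Turnstile> add n (Succ d) \<^bold>= add n x"
            using t3 d by (intro add_cong f_refl[of _ _ Nat] f_sym[OF d(2)]) auto
          also have "w3 \<Turnstile> add n x \<^bold>= u" using eq w3 by (rule forces_mono)
          finally have "w3 \<Turnstile> nle (Succ n) u" by (rule nleI) (use t3 d in auto)
          then show "w3 \<Turnstile> nle (Succ n) u \<^bold>\<or> nle (Succ u) (Succ n)" by (rule f_orI1) (use t3 in auto)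
        qed (use t2 in auto)
      qed (use t1 in auto)
    qed
    then show "w' \<Turnstile> subf (inst (Succ n)) ?A" by simp
  qed (use u in auto)
  then show ?thesis by simp
qed

lemma nlt_irrefl_add:
  assumes "w \<Turnstile> add (add a (Succ x)) y \<^bold>= a" "of_type w a Nat" "of_type w x Nat" "of_type w y Nat"
  shows "w \<Turnstile> Bot"
proof -
  have "w \<Turnstile> add (Succ (add x y)) a \<^bold>= add (add a (Succ x)) y"
    using nat_ring[of "PS (PX 1 \<oplus> PX 2) \<oplus> PX 0" "PX 0 \<oplus> PS (PX 1) \<oplus> PX 2" "[a, x, y]" w] assms
    by (simp add: algebra_simps)
  also note assms(1)
  also have "w \<Turnstile> a \<^bold>= add Zero a" using assms by (intro f_sym[OF add_Zero_left])
  finally have "w \<Turnstile> Succ (add x y) \<^bold>= Zero" by (rule add_cancel) (use assms in auto)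
  then show ?thesis by (rule f_Succ_Zero)
qed

lemma nle_nlt_Bot:
  assumes ab: "w \<Turnstile> nle a b" and ba: "w \<Turnstile> nlt b a"
  shows "w \<Turnstile> Bot"
proof (rule nleE[OF nle_trans[OF ba ab]])
  fix w' x assume w': "w \<le> w'" and x: "of_type w' x Nat" "of_type w' b Nat" "w' \<Turnstile> add (Succ b) x \<^bold>= b"
  have "w' \<Turnstile> add (add b (Succ Zero)) x \<^bold>= add (Succ b) x"
    using nat_ring[of "PX 0 \<oplus> PS PZ \<oplus> PX 1" "PS (PX 0) \<oplus> PX 1" "[b, x]" w'] x by (simp add: algebra_simps)
  then show "w' \<Turnstile> Bot" using nlt_irrefl_add[of w' b Zero x] f_trans[OF _ x(3)] x by auto
qed auto

text \<open>Otherwise \<open>b + 1 \<le> a\<close>, and multiplication by \<open>m + 1\<close> contradicts the assumption.\<close>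

lemma nle_mul_cancel:
  assumes le: "w \<Turnstile> nle (mul a (Succ m)) (mul b (Succ m))"
  shows "w \<Turnstile> nle a b"
proof -
  have t: "of_type w a Nat" "of_type w b Nat" "of_type w m Nat" using forces_wf[OF le] by auto
  show ?thesis
  proof (rule f_orE[OF nle_total[OF t(1,2)]])
    fix w' assume w': "w \<le> w'" and lt: "w' \<Turnstile> nlt b a"
    have t': "of_type w' a Nat" "of_type w' b Nat" "of_type w' m Nat" using t w' of_type_mono by auto
    \<comment> \<open>from \<open>b + 1 \<le> a\<close> one gets \<open>(b (m + 1)) + 1 \<le> a (m + 1)\<close>\<close>
    have 1: "w' \<Turnstile> nle (add (mul (Succ m) (Succ b)) (mul Zero Zero)) (add (mul (Succ m) a) (mul Zero Zero))"
      using t' by (intro nle_add_mul[OF lt] nle_refl) auto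
    have "w' \<Turnstile> add (Succ (mul b (Succ m))) m \<^bold>= add (mul (Succ m) (Succ b)) (mul Zero Zero)"
      using nat_ring[of "PS (PX 0 \<otimes> PS (PX 1)) \<oplus> PX 1" "PS (PX 1) \<otimes> PS (PX 0) \<oplus> PZ \<otimes> PZ" "[b, m]" w'] t'
      by (simp add: algebra_simps)
    then have 2: "w' \<Turnstile> nle (Succ (mul b (Succ m))) (add (mul (Succ m) (Succ b)) (mul Zero Zero))"
      by (rule nleI) (use t' in auto)
    have 3: "w' \<Turnstile> add (mul (Succ m) a) (mul Zero Zero) \<^bold>= mul a (Succ m)"
      using nat_ring[of "PS (PX 1) \<otimes> PX 0 \<oplus> PZ \<otimes> PZ" "PX 0 \<otimes> PS (PX 1)" "[a, m]" w'] t'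
      by (simp add: algebra_simps)
    have "w' \<Turnstile> nlt (mul b (Succ m)) (mul a (Succ m))"
      by (rule nle_cong[OF nle_trans[OF 2 1] _ 3]) (use t' in \<open>auto intro: f_refl[of _ _ Nat]\<close>)
    then have "w' \<Turnstile> Bot" using nle_nlt_Bot[OF forces_mono[OF le w']] by blast
    then show "w' \<Turnstile> nle a b" by (rule f_botE) (use t' in auto)
  qed
qed

text \<open>\<open>m a + l b\<^sub>1 + k b\<^sub>2 + r = m b + l a\<^sub>1 + k a\<^sub>2\<close> with \<open>m > 0\<close> certifies that \<open>a \<le> b\<close> follows from
  \<open>a\<^sub>1 \<le> b\<^sub>1\<close> and \<open>a\<^sub>2 \<le> b\<^sub>2\<close>.\<close>

lemma nle_cert:
  assumes h1: "w \<Turnstile> nle (val ts a1) (val ts b1)" and h2: "w \<Turnstile> nle (val ts a2) (val ts b2)"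
    and ts: "\<forall>t\<in>set ts. of_type w t Nat"
    and id: "poly (a \<otimes> PS m \<oplus> (l \<otimes> b1 \<oplus> k \<otimes> b2) \<oplus> r) = poly (b \<otimes> PS m \<oplus> (l \<otimes> a1 \<oplus> k \<otimes> a2))"
  shows "w \<Turnstile> nle (val ts a) (val ts b)"
proof -
  note t = val_typed[OF ts]
  let ?h = "l \<otimes> a1 \<oplus> k \<otimes> a2" and ?h' = "l \<otimes> b1 \<oplus> k \<otimes> b2"
  have "w \<Turnstile> nle (val ts ?h) (val ts ?h')" using nle_add_mul[OF h1 h2 t t] by simp
  from nle_add_mul[OF this nle_refl[OF t[of "a \<otimes> PS m"]], of "Succ Zero" "Succ Zero"]
  have "w \<Turnstile> nle (val ts (PS PZ \<otimes> ?h \<oplus> PS PZ \<otimes> (a \<otimes> PS m))) (val ts (PS PZ \<otimes> ?h' \<oplus> PS PZ \<otimes> (a \<otimes> PS m)))"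
    by simp
  then have "w \<Turnstile> nle (val ts (a \<otimes> PS m \<oplus> ?h)) (val ts (a \<otimes> PS m \<oplus> ?h'))"
    by (rule nle_cong) (rule nat_ring[OF _ ts], simp add: algebra_simps)+
  moreover have "w \<Turnstile> nle (val ts (a \<otimes> PS m \<oplus> ?h')) (val ts (a \<otimes> PS m \<oplus> ?h' \<oplus> r))"
    unfolding val_simps(4)[of _ "a \<otimes> PS m \<oplus> ?h'"] by (rule nle_add_right[OF t t])
  moreover have "w \<Turnstile> val ts (a \<otimes> PS m \<oplus> ?h' \<oplus> r) \<^bold>= val ts (b \<otimes> PS m \<oplus> ?h)"
    by (rule nat_ring[OF _ ts]) (rule id)
  ultimately have "w \<Turnstile> nle (val ts (a \<otimes> PS m \<oplus> ?h)) (val ts (b \<otimes> PS m \<oplus> ?h))"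
    by (meson nle_trans nle_cong f_refl[OF t])
  then have "w \<Turnstile> nle (val ts (a \<otimes> PS m)) (val ts (b \<otimes> PS m))"
    unfolding val_simps(4) by (rule nle_add_cancel)
  then show ?thesis unfolding val_simps by (rule nle_mul_cancel)
qed

section \<open>Rational numbers\<close>

lemma rat_components_typed:
  "has_type (qpos q) \<Delta> Nat \<and> has_type (qneg q) \<Delta> Nat \<and> has_type (Snd q) \<Delta> Nat \<longleftrightarrow> has_type q \<Delta> Rat"
proof
  assume "has_type (qpos q) \<Delta> Nat \<and> has_type (qneg q) \<Delta> Nat \<and> has_type (Snd q) \<Delta> Nat"
  then obtain \<sigma> \<tau> \<sigma>' \<tau>' \<rho> where t: "has_type q \<Delta> ((Nat \<^bold>\<times> \<sigma>) \<^bold>\<times> \<tau>)" "has_type q \<Delta> ((\<sigma>' \<^bold>\<times> Nat) \<^bold>\<times> \<tau>')"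
    "has_type q \<Delta> (\<rho> \<^bold>\<times> Nat)" by auto
  from has_type_unique[OF t(1,2)] has_type_unique[OF t(1,3)] t(1) show "has_type q \<Delta> Rat" by simp
qed auto

lemma qcomp_typed [simp]:
  "has_type q \<Delta> Rat \<Longrightarrow> has_type (qpos q) \<Delta> Nat"
  "has_type q \<Delta> Rat \<Longrightarrow> has_type (qneg q) \<Delta> Nat"
  "has_type q \<Delta> Rat \<Longrightarrow> has_type (Snd q) \<Delta> Nat"
  using rat_components_typed by blast+

declare has_type.simps(5,6) [simp del]

lemma rat_typed [simp]:
  "has_type (qadd q r) \<Delta> \<tau> \<longleftrightarrow> \<tau> = Rat \<and> has_type q \<Delta> Rat \<and> has_type r \<Delta> Rat"
  "has_type (quminus q) \<Delta> Rat \<longleftrightarrow> has_type q \<Delta> Rat"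
  "has_type (unit_frac n) \<Delta> Rat \<longleftrightarrow> has_type n \<Delta> Nat"
  "has_type qzero \<Delta> \<tau> \<longleftrightarrow> \<tau> = Rat"
  "has_type qone \<Delta> \<tau> \<longleftrightarrow> \<tau> = Rat"
  unfolding rat_components_typed[of q, symmetric] rat_components_typed[of r, symmetric]
  by (auto simp: qadd_def quminus_def unit_frac_def qzero_def qone_def)

lemma qminus_typed [simp]: "has_type (qminus q r) \<Delta> \<tau> \<longleftrightarrow> \<tau> = Rat \<and> has_type q \<Delta> Rat \<and> has_type r \<Delta> Rat"
  by (auto simp: qminus_def)

lemma monus_typed [simp]:
  "has_type (monus t u) \<Delta> \<tau> \<longleftrightarrow> \<tau> = Nat \<and> has_type t \<Delta> Nat \<and> has_type u \<Delta> Nat"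
  "has_type (npred t) \<Delta> \<tau> \<longleftrightarrow> \<tau> = Nat \<and> has_type t \<Delta> Nat"
  by (auto simp: monus_def npred_def)

lemma qabs_typed [simp]: "has_type (qabs q) \<Delta> Rat \<longleftrightarrow> has_type q \<Delta> Rat"
  unfolding rat_components_typed[of q, symmetric] by (auto simp: qabs_def)

lemma qle_wf [simp]: "wf_fm (qle q r) \<Delta> \<longleftrightarrow> has_type q \<Delta> Rat \<and> has_type r \<Delta> Rat"
  "wf_fm (qlt q r) \<Delta> \<longleftrightarrow> has_type q \<Delta> Rat \<and> has_type r \<Delta> Rat"
  unfolding rat_components_typed[of q, symmetric] rat_components_typed[of r, symmetric]
  by (auto simp: qle_def qlt_def)

lemma sub_rat [simp]:
  "sub s (qadd q r) = qadd (sub s q) (sub s r)" "sub s (quminus q) = quminus (sub s q)"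
  "sub s (qminus q r) = qminus (sub s q) (sub s r)" "sub s (unit_frac n) = unit_frac (sub s n)"
  "sub s qzero = qzero" "sub s qone = qone" "sub s (npred n) = npred (sub s n)"
  "sub s (monus n m) = monus (sub s n) (sub s m)" "sub s (qabs q) = qabs (sub s q)"
  by (simp_all add: qadd_def quminus_def qminus_def unit_frac_def qzero_def qone_def npred_def
      monus_def qabs_def)

lemma subf_qle [simp]:
  "subf s (qle q r) = qle (sub s q) (sub s r)" "subf s (qlt q r) = qlt (sub s q) (sub s r)"
  by (simp_all add: qle_def qlt_def)

text \<open>The components of \<open>q\<close> as polynomials in the terms \<open>ts\<close>.  With such a representation an inequality of
  rational numbers becomes an inequality of polynomials, to which certificates apply.\<close>

definition qrep :: "world \<Rightarrow> tm list \<Rightarrow> tm \<Rightarrow> px \<Rightarrow> px \<Rightarrow> px \<Rightarrow> bool" where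
  "qrep w ts q P N D \<longleftrightarrow> of_type w q Rat \<and> (w \<Turnstile> qpos q \<^bold>= val ts P) \<and>
     (w \<Turnstile> qneg q \<^bold>= val ts N) \<and> (w \<Turnstile> Snd q \<^bold>= val ts D)"

lemma qle_iff_nle:
  assumes q: "qrep w ts q P N D" and r: "qrep w ts r P' N' D'"
  shows "w \<Turnstile> qle q r \<longleftrightarrow> w \<Turnstile> nle (val ts (P \<otimes> PS D' \<oplus> N' \<otimes> PS D)) (val ts (P' \<otimes> PS D \<oplus> N \<otimes> PS D'))"
    and "w \<Turnstile> qlt q r \<longleftrightarrow> w \<Turnstile> nlt (val ts (P \<otimes> PS D' \<oplus> N' \<otimes> PS D)) (val ts (P' \<otimes> PS D \<oplus> N \<otimes> PS D'))"
proof -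
  have t: "of_type w (qpos q) Nat" "of_type w (qneg q) Nat" "of_type w (Snd q) Nat"
    "of_type w (qpos r) Nat" "of_type w (qneg r) Nat" "of_type w (Snd r) Nat"
    using q r rat_components_typed unfolding qrep_def by blast+
  have e1: "w \<Turnstile> add (mul (qpos q) (qden r)) (mul (qneg r) (qden q)) \<^bold>= val ts (P \<otimes> PS D' \<oplus> N' \<otimes> PS D)"
    and e2: "w \<Turnstile> add (mul (qpos r) (qden q)) (mul (qneg q) (qden r)) \<^bold>= val ts (P' \<otimes> PS D \<oplus> N \<otimes> PS D')"
    using q r t unfolding qrep_def val_simps by (auto intro!: add_cong mul_cong Succ_cong)
  have e3: "w \<Turnstile> Succ (add (mul (qpos q) (qden r)) (mul (qneg r) (qden q))) \<^bold>= Succ (val ts (P \<otimes> PS D' \<oplus> N' \<otimes> PS D))"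
    using t by (intro Succ_cong[OF e1]) auto
  show "w \<Turnstile> qle q r \<longleftrightarrow> w \<Turnstile> nle (val ts (P \<otimes> PS D' \<oplus> N' \<otimes> PS D)) (val ts (P' \<otimes> PS D \<oplus> N \<otimes> PS D'))"
    unfolding qle_def using nle_cong[OF _ e1 e2] nle_cong[OF _ f_sym[OF e1] f_sym[OF e2]] by blast
  show "w \<Turnstile> qlt q r \<longleftrightarrow> w \<Turnstile> nlt (val ts (P \<otimes> PS D' \<oplus> N' \<otimes> PS D)) (val ts (P' \<otimes> PS D \<oplus> N \<otimes> PS D'))"
    unfolding qlt_def using nle_cong[OF _ e3 e2] nle_cong[OF _ f_sym[OF e3] f_sym[OF e2]] by blast
qed

lemma f_fst: "of_type w t \<sigma> \<Longrightarrow> of_type w u \<tau> \<Longrightarrow> w \<Turnstile> Fst (Tup t u) \<^bold>= t"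
  and f_snd: "of_type w t \<sigma> \<Longrightarrow> of_type w u \<tau> \<Longrightarrow> w \<Turnstile> Snd (Tup t u) \<^bold>= u"
  unfolding forces_def by (rule proves.fst_tup proves.snd_tup; assumption)+

lemma qrep_Tup:
  assumes "of_type w p Nat" "of_type w n Nat" "of_type w d Nat"
    "w \<Turnstile> p \<^bold>= val ts P" "w \<Turnstile> n \<^bold>= val ts N" "w \<Turnstile> d \<^bold>= val ts D"
  shows "qrep w ts (Tup (Tup p n) d) P N D"
proof -
  have eq: "w \<Turnstile> Fst (Tup (Tup p n) d) \<^bold>= Tup p n" by (rule f_fst) (use assms in auto)
  have "w \<Turnstile> qpos (Tup (Tup p n) d) \<^bold>= Fst (Tup p n)"
    using f_cong[OF eq, of "Nat \<^bold>\<times> Nat" "Fst (Var 0)" Nat] assms by (auto simp: has_type.simps(5,6))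
  moreover have "w \<Turnstile> qneg (Tup (Tup p n) d) \<^bold>= Snd (Tup p n)"
    using f_cong[OF eq, of "Nat \<^bold>\<times> Nat" "Snd (Var 0)" Nat] assms by (auto simp: has_type.simps(5,6))
  ultimately show ?thesis
    using f_fst[of p w Nat n Nat] f_snd[of p w Nat n Nat] f_snd[of "Tup p n" w "Nat \<^bold>\<times> Nat" d Nat] assms
    unfolding qrep_def by (auto intro: f_trans)
qed

lemma qrep_qadd:
  assumes q: "qrep w ts q P N D" and r: "qrep w ts r P' N' D'"
  shows "qrep w ts (qadd q r) (P \<otimes> PS D' \<oplus> P' \<otimes> PS D) (N \<otimes> PS D' \<oplus> N' \<otimes> PS D) (D \<otimes> PS D' \<oplus> D')"
proof -
  have t: "of_type w (qpos q) Nat" "of_type w (qneg q) Nat" "of_type w (Snd q) Nat"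
    "of_type w (qpos r) Nat" "of_type w (qneg r) Nat" "of_type w (Snd r) Nat"
    using q r rat_components_typed unfolding qrep_def by blast+
  show ?thesis unfolding qadd_def
    by (rule qrep_Tup) (use q r t in \<open>auto simp: qrep_def intro!: add_cong mul_cong Succ_cong\<close>)
qed

lemma qrep_quminus: assumes q: "qrep w ts q P N D" shows "qrep w ts (quminus q) N P D"
proof -
  have t: "of_type w (qpos q) Nat" "of_type w (qneg q) Nat" "of_type w (Snd q) Nat"
    using q rat_components_typed unfolding qrep_def by blast+
  show ?thesis unfolding quminus_def by (rule qrep_Tup) (use q t in \<open>auto simp: qrep_def\<close>)
qed

lemma qrep_unit_frac: "w \<Turnstile> n \<^bold>= val ts D \<Longrightarrow> of_type w n Nat \<Longrightarrow> qrep w ts (unit_frac n) (PS PZ) PZ D"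
  unfolding unit_frac_def by (rule qrep_Tup) (auto intro: f_refl[of _ _ Nat])

lemma qrep_qzero: "qrep w ts qzero PZ PZ PZ"
  unfolding qzero_def by (rule qrep_Tup) (auto intro: f_refl[of _ _ Nat])

lemma qrep_atom:
  assumes "of_type w q Rat" "Suc (Suc i) < length ts" "ts ! i = qpos q" "ts ! Suc i = qneg q" "ts ! Suc (Suc i) = Snd q"
  shows "qrep w ts q (PX i) (PX (Suc i)) (PX (Suc (Suc i)))"
  using assms by (auto simp: qrep_def intro!: f_refl[of _ _ Nat])

abbreviation comps :: "tm \<Rightarrow> tm list" where "comps q \<equiv> [qpos q, qneg q, Snd q]"

lemma comps_typed: "of_type w q Rat \<Longrightarrow> \<forall>t\<in>set (comps q). of_type w t Nat"
  by auto

lemma rat_atoms: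
  assumes "of_type w a Rat" "of_type w b Rat" "of_type w c Rat" "of_type w d Rat"
  obtains ts where "\<forall>t\<in>set ts. of_type w t Nat"
    "qrep w ts a (PX 0) (PX 1) (PX 2)" "qrep w ts b (PX 3) (PX 4) (PX 5)"
    "qrep w ts c (PX 6) (PX 7) (PX 8)" "qrep w ts d (PX 9) (PX 10) (PX 11)"
proof (rule that)
  let ?ts = "comps a @ comps b @ comps c @ comps d"
  show "\<forall>t\<in>set ?ts. of_type w t Nat" using assms comps_typed by fastforce
  show "qrep w ?ts a (PX 0) (PX 1) (PX 2)" "qrep w ?ts b (PX 3) (PX 4) (PX 5)"
    "qrep w ?ts c (PX 6) (PX 7) (PX 8)" "qrep w ?ts d (PX 9) (PX 10) (PX 11)"
    using qrep_atom[OF assms(1), of 0 ?ts] qrep_atom[OF assms(2), of 3 ?ts] qrep_atom[OF assms(3), of 6 ?ts]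
      qrep_atom[OF assms(4), of 9 ?ts]
    by (simp_all add: eval_nat_numeral)
qed

lemma poly_den: "poly (PS (D \<otimes> PS D' \<oplus> D')) = poly (PS D) * poly (PS D')"
  by (simp add: algebra_simps)

lemma poly_PS_PZ: "poly (PS PZ) = 1" by simp

lemmas rat_poly = poly_den poly_PS_PZ poly_simps

lemma qle_trans:
  assumes ab: "w \<Turnstile> qle a b" and bc: "w \<Turnstile> qle b c"
  shows "w \<Turnstile> qle a c"
proof -
  have t: "of_type w a Rat" "of_type w b Rat" "of_type w c Rat" using forces_wf[OF ab] forces_wf[OF bc] by auto
  obtain ts where ts: "\<forall>t\<in>set ts. of_type w t Nat" and a: "qrep w ts a (PX 0) (PX 1) (PX 2)"
    and b: "qrep w ts b (PX 3) (PX 4) (PX 5)" and c: "qrep w ts c (PX 6) (PX 7) (PX 8)"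
    by (rule rat_atoms[OF t t(3)]) (rule that)
  show ?thesis
    unfolding qle_iff_nle[OF a c]
    by (rule nle_cert[OF ab[unfolded qle_iff_nle(1)[OF a b]] bc[unfolded qle_iff_nle(1)[OF b c]] ts,
          where m = "PX 5" and l = "PS (PX 8)" and k = "PS (PX 2)" and r = PZ])
      (simp add: rat_poly algebra_simps del: poly_PS)
qed

lemma qle_add:
  assumes ab: "w \<Turnstile> qle a b" and cd: "w \<Turnstile> qle c d"
  shows "w \<Turnstile> qle (qadd a c) (qadd b d)"
proof -
  have t: "of_type w a Rat" "of_type w b Rat" "of_type w c Rat" "of_type w d Rat"
    using forces_wf[OF ab] forces_wf[OF cd] by auto
  obtain ts where ts: "\<forall>t\<in>set ts. of_type w t Nat"
    and a: "qrep w ts a (PX 0) (PX 1) (PX 2)" and b: "qrep w ts b (PX 3) (PX 4) (PX 5)"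
    and c: "qrep w ts c (PX 6) (PX 7) (PX 8)" and d: "qrep w ts d (PX 9) (PX 10) (PX 11)"
    by (rule rat_atoms[OF t]) (rule that)
  show ?thesis
    unfolding qle_iff_nle[OF qrep_qadd[OF a c] qrep_qadd[OF b d]]
    by (rule nle_cert[OF ab[unfolded qle_iff_nle(1)[OF a b]] cd[unfolded qle_iff_nle(1)[OF c d]] ts,
          where m = PZ and l = "PS (PX 8) \<otimes> PS (PX 11)" and k = "PS (PX 2) \<otimes> PS (PX 5)" and r = PZ])
      (simp add: rat_poly algebra_simps del: poly_PS)
qed

lemma qle_quminus:
  assumes ab: "w \<Turnstile> qle a b"
  shows "w \<Turnstile> qle (quminus b) (quminus a)"
proof -
  have t: "of_type w a Rat" "of_type w b Rat" using forces_wf[OF ab] by auto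
  obtain ts where ts: "\<forall>t\<in>set ts. of_type w t Nat"
    and a: "qrep w ts a (PX 0) (PX 1) (PX 2)" and b: "qrep w ts b (PX 3) (PX 4) (PX 5)"
    by (rule rat_atoms[OF t t]) (rule that)
  note h = ab[unfolded qle_iff_nle(1)[OF a b]]
  show ?thesis
    unfolding qle_iff_nle[OF qrep_quminus[OF b] qrep_quminus[OF a]]
    by (rule nle_cert[OF h h ts, where m = PZ and l = "PS PZ" and k = PZ and r = PZ])
      (simp add: rat_poly algebra_simps del: poly_PS)
qed

text \<open>Equality of rational numbers is a relation coarser than the equality of their terms.\<close>

definition qeq :: "world \<Rightarrow> tm \<Rightarrow> tm \<Rightarrow> bool" where
  "qeq w a b \<longleftrightarrow> (w \<Turnstile> qle a b) \<and> (w \<Turnstile> qle b a)"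

lemma qeqI:
  assumes a: "qrep w ts a P N D" and b: "qrep w ts b P' N' D'" and ts: "\<forall>t\<in>set ts. of_type w t Nat"
    and id: "poly (P \<otimes> PS D' \<oplus> N' \<otimes> PS D) = poly (P' \<otimes> PS D \<oplus> N \<otimes> PS D')"
  shows "qeq w a b"
proof -
  have "w \<Turnstile> nle (val ts p) (val ts q)" if "poly p = poly q" for p q
    using nle_cong[OF nle_refl[OF val_typed[OF ts]] f_refl[OF val_typed[OF ts]] nat_ring[OF that ts]] .
  then show ?thesis unfolding qeq_def qle_iff_nle[OF a b] qle_iff_nle[OF b a] using id id[symmetric] by blast
qed

lemma qeq_refl: assumes "of_type w a Rat" shows "qeq w a a"
proof -
  have a: "qrep w (comps a) a (PX 0) (PX (Suc 0)) (PX (Suc (Suc 0)))" by (rule qrep_atom) (use assms in auto)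
  show ?thesis by (rule qeqI[OF a a comps_typed[OF assms] HOL.refl])
qed

lemma qeq_group:
  assumes "of_type w a Rat" "of_type w b Rat" "of_type w c Rat"
  shows "qeq w (qadd a b) (qadd b a)"
    "qeq w (qadd (qadd a b) c) (qadd a (qadd b c))"
    "qeq w (qadd qzero a) a" "qeq w (qadd (quminus a) a) qzero"
proof -
  obtain ts where ts: "\<forall>t\<in>set ts. of_type w t Nat" and a: "qrep w ts a (PX 0) (PX 1) (PX 2)"
    and b: "qrep w ts b (PX 3) (PX 4) (PX 5)" and c: "qrep w ts c (PX 6) (PX 7) (PX 8)"
    by (rule rat_atoms[OF assms assms(3)]) (rule that)
  note rules = qrep_qadd qrep_quminus qrep_qzero a b c
  show "qeq w (qadd a b) (qadd b a)"
    by (rule qeqI, (rule rules)+, rule ts) (simp add: rat_poly algebra_simps del: poly_PS)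
  show "qeq w (qadd (qadd a b) c) (qadd a (qadd b c))"
    by (rule qeqI, (rule rules)+, rule ts) (simp add: rat_poly algebra_simps del: poly_PS)
  show "qeq w (qadd qzero a) a"
    by (rule qeqI, (rule rules)+, rule ts) (simp add: rat_poly algebra_simps del: poly_PS)
  show "qeq w (qadd (quminus a) a) qzero"
    by (rule qeqI, (rule rules)+, rule ts) (simp add: rat_poly algebra_simps del: poly_PS)
qed

lemma qle_total:
  assumes t: "of_type w a Rat" "of_type w b Rat"
  shows "w \<Turnstile> qle a b \<^bold>\<or> qle b a"
proof -
  obtain ts where ts: "\<forall>t\<in>set ts. of_type w t Nat"
    and a: "qrep w ts a (PX 0) (PX 1) (PX 2)" and b: "qrep w ts b (PX 3) (PX 4) (PX 5)"
    by (rule rat_atoms[OF t t]) (rule that)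
  show ?thesis
  proof (rule f_orE[OF nle_total[OF val_typed[OF ts] val_typed[OF ts]]])
    fix w' assume "w \<le> w'" "w' \<Turnstile> nle (val ts (PX 0 \<otimes> PS (PX 5) \<oplus> PX 4 \<otimes> PS (PX 2))) (val ts (PX 3 \<otimes> PS (PX 2) \<oplus> PX 1 \<otimes> PS (PX 5)))"
    moreover from this have "qrep w' ts a (PX 0) (PX 1) (PX 2)" "qrep w' ts b (PX 3) (PX 4) (PX 5)"
      using a b unfolding qrep_def by (auto intro: forces_mono of_type_mono)
    ultimately have "w' \<Turnstile> qle a b" using qle_iff_nle(1) by blast
    then show "w' \<Turnstile> qle a b \<^bold>\<or> qle b a" by (rule f_orI1) (use t \<open>w \<le> w'\<close> in \<open>auto intro: of_type_mono\<close>)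
  next
    fix w' assume w': "w \<le> w'" and lt: "w' \<Turnstile> nlt (val ts (PX 3 \<otimes> PS (PX 2) \<oplus> PX 1 \<otimes> PS (PX 5))) (val ts (PX 0 \<otimes> PS (PX 5) \<oplus> PX 4 \<otimes> PS (PX 2)))"
    have ab: "qrep w' ts a (PX 0) (PX 1) (PX 2)" "qrep w' ts b (PX 3) (PX 4) (PX 5)"
      using a b w' unfolding qrep_def by (auto intro: forces_mono of_type_mono)
    have ts': "\<forall>t\<in>set ts. of_type w' t Nat" using ts w' of_type_mono by blast
    let ?l = "PX 3 \<otimes> PS (PX 2) \<oplus> PX 1 \<otimes> PS (PX 5)"
    have "w' \<Turnstile> add (val ts ?l) (Succ Zero) \<^bold>= Succ (val ts ?l)"
      using nat_ring[of "?l \<oplus> PS PZ" "PS ?l" ts w'] ts' by simp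
    then have "w' \<Turnstile> nle (val ts ?l) (Succ (val ts ?l))"
      by (rule nleI) (use val_typed[OF ts', of ?l] in \<open>simp_all del: val_simps\<close>)
    from nle_trans[OF this lt] have "w' \<Turnstile> qle b a" using qle_iff_nle(1)[OF ab(2,1)] by blast
    then show "w' \<Turnstile> qle a b \<^bold>\<or> qle b a" by (rule f_orI2) (use t w' in \<open>auto intro: of_type_mono\<close>)
  qed
qed


section \<open>Linear expressions\<close>

text \<open>Formal linear expressions; the terms in \<open>LX\<close> serve as names of variables, which \<open>lval\<close> interprets by
  rational terms and \<open>lev\<close> by elements of an abelian group.\<close>

datatype lx = LX tm | LZ | LA lx lx | LN lx

primrec lval :: "(tm \<Rightarrow> tm) \<Rightarrow> lx \<Rightarrow> tm" where
  "lval \<rho> (LX a) = \<rho> a"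
| "lval \<rho> LZ = qzero"
| "lval \<rho> (LA e f) = qadd (lval \<rho> e) (lval \<rho> f)"
| "lval \<rho> (LN e) = quminus (lval \<rho> e)"

primrec lev :: "(tm \<Rightarrow> 'g::ab_group_add) \<Rightarrow> lx \<Rightarrow> 'g" where
  "lev v (LX a) = v a"
| "lev v LZ = 0"
| "lev v (LA e f) = lev v e + lev v f"
| "lev v (LN e) = - lev v e"

text \<open>As for polynomials, the quotient by derivable equality is an algebraic structure, here an abelian
  group.  All variables are interpreted by well-typed terms, as otherwise transitivity would fail.\<close>

definition lx_eq :: "lx \<Rightarrow> lx \<Rightarrow> bool" where
  "lx_eq e f \<longleftrightarrow> (\<forall>w \<rho>. (\<forall>a. of_type w (\<rho> a) Rat) \<longrightarrow> qeq w (lval \<rho> e) (lval \<rho> f))"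

lemma lval_typed: "\<forall>a. of_type w (\<rho> a) Rat \<Longrightarrow> of_type w (lval \<rho> e) Rat"
  by (induction e) auto

quotient_type glx = lx / lx_eq
proof (rule equivpI)
  show "reflp lx_eq" by (auto simp: reflp_def lx_eq_def intro: qeq_refl lval_typed)
  show "symp lx_eq" by (auto simp: symp_def lx_eq_def qeq_def)
  show "transp lx_eq" unfolding transp_def lx_eq_def qeq_def by (meson qle_trans)
qed

instantiation glx :: ab_group_add
begin

lift_definition zero_glx :: glx is LZ .
lift_definition plus_glx :: "glx \<Rightarrow> glx \<Rightarrow> glx" is LA
  by (auto simp: lx_eq_def qeq_def intro: qle_add)
lift_definition uminus_glx :: "glx \<Rightarrow> glx" is LN
  by (auto simp: lx_eq_def qeq_def intro: qle_quminus)
definition minus_glx :: "glx \<Rightarrow> glx \<Rightarrow> glx" where "minus_glx a b = a + - b"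

instance
proof
  fix a b c :: glx
  show "a + b + c = a + (b + c)" by transfer (auto simp: lx_eq_def intro!: qeq_group lval_typed)
  show "a + b = b + a" by transfer (auto simp: lx_eq_def intro!: qeq_group lval_typed)
  show "0 + a = a" by transfer (auto simp: lx_eq_def intro!: qeq_group lval_typed)
  show "- a + a = 0" by transfer (auto simp: lx_eq_def intro!: qeq_group lval_typed)
  show "a - b = a + - b" by (simp add: minus_glx_def)
qed

end

lift_definition lclass :: "lx \<Rightarrow> glx" is "\<lambda>e. e" .

lemma lclass_simps [simp]:
  "lclass LZ = 0" "lclass (LA e f) = lclass e + lclass f" "lclass (LN e) = - lclass e"
  by (transfer, simp add: lx_eq_def qeq_refl[OF lval_typed] del: lval.simps)+

lemma lclass_eqD: "lclass e = lclass f \<Longrightarrow> \<forall>a. of_type w (\<rho> a) Rat \<Longrightarrow> qeq w (lval \<rho> e) (lval \<rho> f)"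
  by transfer (simp add: lx_eq_def)

lemma lclass_lev: "lclass e = lev (\<lambda>a. lclass (LX a)) e"
  by (induction e) simp_all

text \<open>Positive and negative coefficients.  They determine the value of an expression in any abelian
  group, so that equality of values over \<open>\<rat>\<close> carries over to every abelian group.\<close>

primrec coeffs :: "lx \<Rightarrow> (tm \<Rightarrow> nat) \<times> (tm \<Rightarrow> nat)" where
  "coeffs (LX a) = ((\<lambda>b. if b = a then 1 else 0), (\<lambda>_. 0))"
| "coeffs LZ = ((\<lambda>_. 0), (\<lambda>_. 0))"
| "coeffs (LA e f) = ((\<lambda>a. fst (coeffs e) a + fst (coeffs f) a), (\<lambda>a. snd (coeffs e) a + snd (coeffs f) a))"
| "coeffs (LN e) = (snd (coeffs e), fst (coeffs e))"

definition nsum :: "tm set \<Rightarrow> (tm \<Rightarrow> nat) \<Rightarrow> (tm \<Rightarrow> 'g::ab_group_add) \<Rightarrow> 'g" where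
  "nsum A k v = (\<Sum>a\<in>A. \<Sum>j<k a. v a)"

lemma nsum_zero [simp]: "nsum A (\<lambda>_. 0) v = 0"
  by (simp add: nsum_def)

lemma nsum_add: "nsum A (\<lambda>a. k a + l a) v = nsum A k v + nsum A l v"
proof -
  have "(\<Sum>j<m + n. x) = (\<Sum>j<m. x) + (\<Sum>j<n. x)" for m n :: nat and x :: 'a
    by (induction m) (simp_all add: add.assoc add.left_commute)
  then show ?thesis by (simp add: nsum_def sum.distrib)
qed

primrec atoms :: "lx \<Rightarrow> tm set" where
  "atoms (LX a) = {a}"
| "atoms LZ = {}"
| "atoms (LA e f) = atoms e \<union> atoms f"
| "atoms (LN e) = atoms e"

lemma lev_coeffs:
  "finite A \<Longrightarrow> atoms e \<subseteq> A \<Longrightarrow> lev v e = nsum A (fst (coeffs e)) v - nsum A (snd (coeffs e)) v"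
proof (induction e)
  case (LX a)
  have "nsum A (\<lambda>b. if b = a then 1 else 0) v = (\<Sum>b\<in>A. if b = a then v b else 0)"
    unfolding nsum_def by (rule sum.cong) auto
  with LX show ?case by simp
qed (simp_all add: nsum_add)

lemma finite_atoms: "finite (atoms e)"
  by (induction e) simp_all

text \<open>Evaluation at the unit vectors recovers the difference of the two coefficients of each variable.\<close>

lemma lev_eq_transfer:
  assumes eq: "\<And>v :: tm \<Rightarrow> rat. lev v e = lev v f"
  shows "lev (v :: tm \<Rightarrow> 'g::ab_group_add) e = lev v f"
proof -
  let ?A = "atoms e \<union> atoms f"
  have fin: "finite ?A" by (simp add: finite_atoms)
  have "fst (coeffs e) a + snd (coeffs f) a = fst (coeffs f) a + snd (coeffs e) a" if "a \<in> ?A" for a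
  proof -
    have unit: "nsum ?A k (\<lambda>b. if b = a then 1 else 0) = (of_nat (k a) :: rat)" for k
    proof -
      have "nsum ?A k (\<lambda>b. if b = a then 1 else 0) = (\<Sum>b\<in>?A. if b = a then (of_nat (k b) :: rat) else 0)"
        unfolding nsum_def by (rule sum.cong) auto
      with fin that show ?thesis by simp
    qed
    have "(of_nat (fst (coeffs e) a) - of_nat (snd (coeffs e) a) :: rat) = of_nat (fst (coeffs f) a) - of_nat (snd (coeffs f) a)"
      using eq[of "\<lambda>b. if b = a then 1 else 0"] lev_coeffs[OF fin, of e "\<lambda>b. if b = a then 1 else (0::rat)"]
        lev_coeffs[OF fin, of f "\<lambda>b. if b = a then 1 else (0::rat)"] unit by simp
    then have "(of_nat (fst (coeffs e) a + snd (coeffs f) a) :: rat) = of_nat (fst (coeffs f) a + snd (coeffs e) a)"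
      by simp
    then show ?thesis by (simp only: of_nat_eq_iff)
  qed
  then have "nsum ?A (\<lambda>a. fst (coeffs e) a + snd (coeffs f) a) v = nsum ?A (\<lambda>a. fst (coeffs f) a + snd (coeffs e) a) v"
    unfolding nsum_def by (intro sum.cong) auto
  then have "nsum ?A (fst (coeffs e)) v - nsum ?A (snd (coeffs e)) v = nsum ?A (fst (coeffs f)) v - nsum ?A (snd (coeffs f)) v"
    by (simp add: nsum_add algebra_simps)
  then show ?thesis using lev_coeffs[OF fin, of e v] lev_coeffs[OF fin, of f v] by simp
qed

lemma lev_eq_qeq:
  assumes "\<And>v :: tm \<Rightarrow> rat. lev v e = lev v f" "\<forall>a. of_type w (\<rho> a) Rat"
  shows "qeq w (lval \<rho> e) (lval \<rho> f)"
proof (rule lclass_eqD[OF _ assms(2)])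
  show "lclass e = lclass f"
    using lev_eq_transfer[OF assms(1), where v = "\<lambda>a. lclass (LX a)"] lclass_lev by metis
qed


section \<open>Farkas' lemma\<close>

definition functional :: "(('x \<Rightarrow> rat) \<Rightarrow> rat) \<Rightarrow> bool" where
  "functional f \<longleftrightarrow> (\<forall>u v. f (\<lambda>x. u x + v x) = f u + f v) \<and> (\<forall>c v. f (\<lambda>x. c * v x) = c * f v)"

lemma functional_comb: "functional f \<Longrightarrow> functional g \<Longrightarrow> functional (\<lambda>v. f v - c * g v)"
  by (simp add: functional_def algebra_simps)

text \<open>By induction on the number of constraints.  If the constraints of \<open>I\<close> alone do not imply \<open>0 \<le> g\<close>, some
  \<open>x\<close> satisfies them but has \<open>g x < 0\<close>, hence \<open>f j x < 0\<close>.  Projection along \<open>x\<close> onto the hyperplane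
  \<open>f j = 0\<close> leaves a problem with the constraints \<open>I\<close>, and its solution determines the coefficient of \<open>f j\<close>.\<close>

lemma farkas:
  assumes "finite I" "\<And>i. i \<in> I \<Longrightarrow> functional (f i)" "functional g"
    and "\<And>v. (\<forall>i\<in>I. 0 \<le> f i v) \<Longrightarrow> 0 \<le> g v"
  shows "\<exists>c. (\<forall>i\<in>I. 0 \<le> c i) \<and> (\<forall>v. g v = (\<Sum>i\<in>I. c i * f i v))"
  using assms
proof (induction I arbitrary: f g rule: finite_induct)
  case empty
  have "g v = 0" for v
  proof -
    have "g (\<lambda>x. (- 1) * v x) = (- 1) * g v" using empty.prems(2) unfolding functional_def by blast
    moreover have "0 \<le> g v" "0 \<le> g (\<lambda>x. (- 1) * v x)" using empty.prems(3) by blast+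
    ultimately show ?thesis by simp
  qed
  then show ?case by simp
next
  case (insert j I)
  show ?case
  proof (cases "\<forall>v. (\<forall>i\<in>I. 0 \<le> f i v) \<longrightarrow> 0 \<le> g v")
    case True
    then obtain c where c: "\<forall>i\<in>I. 0 \<le> c i" "\<forall>v. g v = (\<Sum>i\<in>I. c i * f i v)"
      using insert.IH[of f g] insert.prems by auto
    show ?thesis
    proof (intro HOL.exI conjI ballI HOL.allI)
      show "0 \<le> (c(j := 0)) i" if "i \<in> insert j I" for i using that c by auto
      have "(\<Sum>i\<in>I. (c(j := 0)) i * f i v) = (\<Sum>i\<in>I. c i * f i v)" for v
        using insert.hyps by (intro sum.cong) auto
      then show "g v = (\<Sum>i\<in>insert j I. (c(j := 0)) i * f i v)" for v using c insert.hyps by simp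
    qed
  next
    case False
    then obtain x where x: "\<forall>i\<in>I. 0 \<le> f i x" "g x < 0" by force
    have neg: "f j x < 0" using insert.prems(3)[of x] x by force
    \<comment> \<open>\<open>x\<close> violates only the constraint \<open>j\<close>; projecting along \<open>x\<close> to the hyperplane \<open>f j = 0\<close> removes it\<close>
    let ?p = "\<lambda>h v. h v - (h x / f j x) * f j v"
    let ?y = "\<lambda>v z. v z + (- (f j v / f j x)) * x z"
    have proj: "h (?y v) = ?p h v" if "functional h" for h v
    proof -
      have "h (?y v) = h v + h (\<lambda>z. (- (f j v / f j x)) * x z)"
        using that[unfolded functional_def, THEN conjunct1, rule_format, of v "\<lambda>z. (- (f j v / f j x)) * x z"] .
      also have "h (\<lambda>z. (- (f j v / f j x)) * x z) = (- (f j v / f j x)) * h x"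
        using that[unfolded functional_def, THEN conjunct2, rule_format, of "- (f j v / f j x)" x] .
      finally show ?thesis by simp
    qed
    have "\<exists>c. (\<forall>i\<in>I. 0 \<le> c i) \<and> (\<forall>v. ?p g v = (\<Sum>i\<in>I. c i * ?p (f i) v))"
    proof (rule insert.IH)
      show "functional (?p (f i))" if "i \<in> I" for i using insert.prems that by (intro functional_comb) auto
      show "functional (?p g)" using insert.prems by (intro functional_comb) auto
      fix v assume pos: "\<forall>i\<in>I. 0 \<le> ?p (f i) v"
      have "f j (?y v) = 0" using proj[of "f j" v] insert.prems neg by simp
      moreover have "0 \<le> f i (?y v)" if "i \<in> I" for i
        using bspec[OF pos that] insert.prems(1)[of i] that by (simp only: proj insert_iff simp_thms)
      ultimately have "0 \<le> g (?y v)" by (intro insert.prems(3)) auto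
      then show "0 \<le> ?p g v" using insert.prems(2) by (simp only: proj)
    qed
    then obtain c where c: "\<forall>i\<in>I. 0 \<le> c i" "\<forall>v. ?p g v = (\<Sum>i\<in>I. c i * ?p (f i) v)" by auto
    define d where "d = (g x - (\<Sum>i\<in>I. c i * f i x)) / f j x"
    have "(\<Sum>i\<in>I. c i * f i x) \<ge> 0" using c x by (intro sum_nonneg) simp
    then have "0 \<le> d" unfolding d_def using x neg by (intro divide_nonpos_neg) auto
    show ?thesis
    proof (intro HOL.exI conjI ballI HOL.allI)
      show "0 \<le> (c(j := d)) i" if "i \<in> insert j I" for i using that c \<open>0 \<le> d\<close> by auto
      fix v
      have "g v = (\<Sum>i\<in>I. c i * ?p (f i) v) + (g x / f j x) * f j v" using c(2)[rule_format, of v] by simp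
      also have "(\<Sum>i\<in>I. c i * ?p (f i) v) = (\<Sum>i\<in>I. c i * f i v) - (\<Sum>i\<in>I. c i * f i x) / f j x * f j v"
        by (simp add: algebra_simps sum_subtractf sum_divide_distrib sum_distrib_left)
      finally have "g v = d * f j v + (\<Sum>i\<in>I. c i * f i v)"
        unfolding d_def by (simp add: diff_divide_distrib algebra_simps)
      also have "(\<Sum>i\<in>I. c i * f i v) = (\<Sum>i\<in>I. (c(j := d)) i * f i v)"
        using insert.hyps by (intro sum.cong) auto
      finally show "g v = (\<Sum>i\<in>insert j I. (c(j := d)) i * f i v)" using insert.hyps by simp
    qed
  qed
qed

lemma functional_lev: "functional (\<lambda>v. lev v e)"
  by (induction e) (simp_all add: functional_def algebra_simps)

lemma common_denominator:
  fixes c :: "'i \<Rightarrow> rat"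
  assumes "finite I" "\<forall>i\<in>I. 0 \<le> c i"
  shows "\<exists>n > 0. \<forall>i\<in>I. \<exists>k. of_nat n * c i = of_nat k"
  using assms
proof (induction I rule: finite_induct)
  case empty show ?case by auto
next
  case (insert j I)
  then obtain n where n: "n > 0" "\<forall>i\<in>I. \<exists>k. of_nat n * c i = of_nat k" by auto
  obtain p q where pq: "c j = Fract p q" "0 < q" by (cases "c j") auto
  then have "0 \<le> p" using insert.prems by (simp add: zero_le_Fract_iff)
  have q: "of_nat (nat q) * c j = of_nat (nat p)"
    using pq \<open>0 \<le> p\<close> by (simp add: Fract_of_int_quotient)
  show ?case
  proof (rule HOL.exI[of _ "n * nat q"], intro conjI ballI)
    show "0 < n * nat q" using n pq by simp
    fix i assume "i \<in> insert j I"
    then show "\<exists>k. of_nat (n * nat q) * c i = of_nat k"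
    proof
      assume "i = j"
      then have "of_nat (n * nat q) * c i = of_nat (n * nat p)" using q by (simp add: mult.assoc)
      then show ?thesis by blast
    next
      assume "i \<in> I"
      then obtain k where "of_nat n * c i = of_nat k" using n by blast
      then have "of_nat (n * nat q) * c i = of_nat (nat q * k)" by (simp add: ac_simps)
      then show ?thesis by blast
    qed
  qed
qed

primrec lmul :: "nat \<Rightarrow> lx \<Rightarrow> lx" where
  "lmul 0 e = LZ"
| "lmul (Suc n) e = LA e (lmul n e)"

lemma lev_lmul [simp]: "lev v (lmul n e) = (of_nat n :: rat) * lev v e"
  by (induction n) (simp_all add: algebra_simps)


section \<open>Linear arithmetic\<close>

definition lpos :: "world \<Rightarrow> (tm \<Rightarrow> tm) \<Rightarrow> lx \<Rightarrow> bool" where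
  "lpos w \<rho> e \<longleftrightarrow> w \<Turnstile> qle qzero (lval \<rho> e)"

lemma lpos_cong:
  assumes "lpos w \<rho> e" "\<And>v :: tm \<Rightarrow> rat. lev v e = lev v f" "\<forall>a. of_type w (\<rho> a) Rat"
  shows "lpos w \<rho> f"
  using qle_trans[OF assms(1)[unfolded lpos_def] lev_eq_qeq[OF assms(2,3), unfolded qeq_def, THEN conjunct1]]
  by (simp add: lpos_def)

lemma lpos_LA:
  assumes "lpos w \<rho> e" "lpos w \<rho> f" and \<rho>: "\<forall>a. of_type w (\<rho> a) Rat"
  shows "lpos w \<rho> (LA e f)"
proof -
  have "w \<Turnstile> qle qzero (qadd qzero qzero)"
    using lev_eq_qeq[of LZ "LA LZ LZ" \<rho> w] \<rho> by (simp add: qeq_def)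
  from qle_trans[OF this qle_add[OF assms(1,2)[unfolded lpos_def]]] show ?thesis by (simp add: lpos_def)
qed

lemma lpos_LZ: "lpos w \<rho> LZ"
  using qeq_refl[of qzero w] by (simp add: lpos_def qeq_def)

lemma lpos_lmul: "lpos w \<rho> e \<Longrightarrow> \<forall>a. of_type w (\<rho> a) Rat \<Longrightarrow> lpos w \<rho> (lmul n e)"
  by (induction n) (auto intro: lpos_LZ lpos_LA)

text \<open>If \<open>n e \<ge> 0\<close> and \<open>e \<le> 0\<close>, then \<open>e = n e - (n - 1) e \<ge> 0\<close>; so decidability of the order gives
  divisibility.\<close>

lemma lpos_divide:
  assumes pos: "lpos w \<rho> (lmul (Suc n) e)" and \<rho>: "\<forall>a. of_type w (\<rho> a) Rat"
  shows "lpos w \<rho> e"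
proof -
  have t: "of_type w (lval \<rho> e) Rat" by (rule lval_typed[OF \<rho>])
  have "w \<Turnstile> qle qzero (lval \<rho> e) \<^bold>\<or> qle (lval \<rho> e) qzero" using t by (intro qle_total) auto
  then show ?thesis unfolding lpos_def
  proof (rule f_orE)
    fix w' assume w': "w \<le> w'" and "w' \<Turnstile> qle (lval \<rho> e) qzero"
    have \<rho>': "\<forall>a. of_type w' (\<rho> a) Rat" using \<rho> w' of_type_mono by blast
    from \<open>w' \<Turnstile> qle (lval \<rho> e) qzero\<close> have "w' \<Turnstile> qle (lval \<rho> (LN LZ)) (lval \<rho> (LN e))"
      by (simp add: qle_quminus)
    moreover have "w' \<Turnstile> qle qzero (lval \<rho> (LN LZ))"
      using lev_eq_qeq[of LZ "LN LZ" \<rho> w'] \<rho>' by (simp add: qeq_def)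
    ultimately have "lpos w' \<rho> (LN e)" unfolding lpos_def by (metis qle_trans)
    moreover have "lpos w' \<rho> (lmul (Suc n) e)" using pos w' unfolding lpos_def by (rule forces_mono)
    ultimately have "lpos w' \<rho> (LA (lmul (Suc n) e) (lmul n (LN e)))"
      using lpos_LA[OF _ lpos_lmul] \<rho>' by blast
    then have "lpos w' \<rho> e" by (rule lpos_cong) (use \<rho>' in \<open>simp_all add: algebra_simps\<close>)
    then show "w' \<Turnstile> qle qzero (lval \<rho> e)" by (simp add: lpos_def)
  qed
qed

text \<open>The rational coefficients given by Farkas' lemma become natural numbers after multiplication by a
  common denominator; the hypotheses can then be added up inside the system.\<close>

lemma lpos_farkas:
  assumes \<rho>: "\<forall>a. of_type w (\<rho> a) Rat" and fin: "finite E" and E: "\<forall>e\<in>E. lpos w \<rho> e"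
    and sem: "\<And>v :: tm \<Rightarrow> rat. \<forall>e\<in>E. 0 \<le> lev v e \<Longrightarrow> 0 \<le> lev v g"
  shows "lpos w \<rho> g"
proof -
  have "\<exists>c :: lx \<Rightarrow> rat. (\<forall>e\<in>E. 0 \<le> c e) \<and> (\<forall>v. lev v g = (\<Sum>e\<in>E. c e * lev v e))"
    by (rule farkas[of E "\<lambda>e v. lev v e" "\<lambda>v. lev v g", OF fin functional_lev functional_lev]) (rule sem)
  then obtain c where c: "\<forall>e\<in>E. (0 :: rat) \<le> c e" "\<forall>v. lev v g = (\<Sum>e\<in>E. c e * lev v e)" by blast
  obtain n where n: "n > 0" "\<forall>e\<in>E. \<exists>k. of_nat n * c e = of_nat k"
    using common_denominator[OF fin c(1)] by auto
  from bchoice[OF n(2)] obtain k where k: "\<forall>e\<in>E. of_nat n * c e = of_nat (k e)" by blast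
  have "\<exists>s. lpos w \<rho> s \<and> (\<forall>v. lev v s = (\<Sum>e\<in>E. of_nat (k e) * lev v e :: rat))"
    using fin E
  proof (induction E rule: finite_induct)
    case empty
    show ?case by (rule HOL.exI[of _ LZ]) (simp add: lpos_LZ)
  next
    case (insert e E)
    then obtain s where s: "lpos w \<rho> s" "\<forall>v. lev v s = (\<Sum>e\<in>E. of_nat (k e) * lev v e :: rat)" by blast
    then have "lpos w \<rho> (LA (lmul (k e) e) s)" using insert.prems \<rho> by (intro lpos_LA lpos_lmul) auto
    moreover have "\<forall>v. lev v (LA (lmul (k e) e) s) = (\<Sum>e\<in>insert e E. of_nat (k e) * lev v e :: rat)"
      using s insert.hyps by simp
    ultimately show ?case by blast
  qed
  then obtain s where s: "lpos w \<rho> s" "\<forall>v. lev v s = (\<Sum>e\<in>E. of_nat (k e) * lev v e :: rat)" by blast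
  have "lev v s = lev v (lmul n g)" for v :: "tm \<Rightarrow> rat"
  proof -
    have "of_nat n * lev v g = (\<Sum>e\<in>E. (of_nat n * c e) * lev v e)"
      using c(2) by (simp add: sum_distrib_left mult.assoc)
    also have "\<dots> = (\<Sum>e\<in>E. of_nat (k e) * lev v e)" using k by (intro sum.cong) auto
    finally show ?thesis using s by simp
  qed
  from lpos_cong[OF s(1) this \<rho>] have "lpos w \<rho> (lmul n g)" .
  moreover obtain m where "n = Suc m" using n by (cases n) auto
  ultimately show ?thesis using lpos_divide[OF _ \<rho>] by blast
qed

lemma rat_ops_inject [simp]:
  "qadd a b = qadd a' b' \<longleftrightarrow> a = a' \<and> b = b'"
  "quminus a = quminus a' \<longleftrightarrow> a = a'"
  "qadd a b \<noteq> quminus c" "quminus c \<noteq> qadd a b" "qadd a b \<noteq> qzero" "quminus c \<noteq> qzero"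
  "qzero \<noteq> qadd a b" "qzero \<noteq> quminus c"
  by (auto simp: qadd_def quminus_def qzero_def mul_def add_def)

lemma rat_ops_size: "size a < size (qadd a b)" "size b < size (qadd a b)" "size a < size (quminus a)"
  by (simp_all add: qadd_def quminus_def mul_def add_def)

text \<open>A rational term is read as a linear expression in its maximal subterms that are not sums,
  opposites or zero.\<close>

function reify :: "tm \<Rightarrow> lx" where
  "reify t = (if \<exists>a b. t = qadd a b
      then LA (reify (THE a. \<exists>b. t = qadd a b)) (reify (THE b. \<exists>a. t = qadd a b))
    else if \<exists>a. t = quminus a then LN (reify (THE a. t = quminus a))
    else if t = qzero then LZ else LX t)"
  by auto
termination by (relation "measure size") (auto simp: rat_ops_size)

declare reify.simps [simp del]

lemma reify_simps [simp]:
  "reify (qadd a b) = LA (reify a) (reify b)" "reify (quminus a) = LN (reify a)" "reify qzero = LZ"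
  using reify.simps[of "qadd a b"] reify.simps[of "quminus a"] reify.simps[of qzero] by auto

lemma lval_reify:
  assumes "of_type w t Rat" "\<And>a. of_type w a Rat \<Longrightarrow> \<rho> a = a"
  shows "lval \<rho> (reify t) = t"
  using assms(1)
proof (induction t rule: reify.induct)
  case (1 t)
  consider a b where "t = qadd a b" | a where "t = quminus a" | "t = qzero"
    | "\<nexists>a b. t = qadd a b" "\<nexists>a. t = quminus a" "t \<noteq> qzero" by blast
  then show ?case
  proof cases
    case (1 a b)
    with "1.IH"(1,2) "1.prems" show ?thesis by auto
  next
    case (2 a)
    with "1.IH"(3) "1.prems" show ?thesis by auto
  next
    case 4
    then show ?thesis using "1.prems" assms(2) by (subst reify.simps) auto
  qed simp
qed

definition hom :: "(tm \<Rightarrow> rat) \<Rightarrow> bool" where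
  "hom v \<longleftrightarrow> (\<forall>a b. v (qadd a b) = v a + v b) \<and> (\<forall>a. v (quminus a) = - v a) \<and> v qzero = 0"

lemma hom_reify: "hom (\<lambda>t. lev v (reify t))"
  by (simp add: hom_def)

lemma qle_inject [simp]: "qle a b = qle a' b' \<longleftrightarrow> a = a' \<and> b = b'"
  by (auto simp: qle_def nle_def add_def mul_def)

text \<open>Truth under a valuation, for formulas composed of inequalities by conjunction and disjunction.
  Every other formula counts as true and thereby contributes nothing as a hypothesis.\<close>

primrec hold :: "(tm \<Rightarrow> rat) \<Rightarrow> fm \<Rightarrow> bool" where
  "hold v (t \<^bold>= u) = True"
| "hold v Bot = True"
| "hold v (A \<^bold>\<and> B) = (hold v A \<and> hold v B)"
| "hold v (A \<^bold>\<or> B) = (hold v A \<or> hold v B)"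
| "hold v (A \<^bold>\<longrightarrow> B) = True"
| "hold v (All \<sigma> A) = True"
| "hold v (Ex \<sigma> A) = (\<forall>a b. Ex \<sigma> A = qle a b \<longrightarrow> v a \<le> v b)"

lemma hold_qle [simp]: "hold v (qle a b) \<longleftrightarrow> v a \<le> v b"
proof -
  obtain \<sigma> A where A: "qle a b = Ex \<sigma> A" by (simp add: qle_def nle_def)
  then have "hold v (qle a b) \<longleftrightarrow> (\<forall>a' b'. qle a b = qle a' b' \<longrightarrow> v a' \<le> v b')" by simp
  then show ?thesis by simp
qed

lemma lin_conj:
  assumes H: "\<forall>(a, b)\<in>set H. w \<Turnstile> qle a b" and t: "of_type w s Rat" "of_type w t Rat"
    and sem: "\<And>v. hom v \<Longrightarrow> \<forall>(a, b)\<in>set H. v a \<le> v b \<Longrightarrow> v s \<le> v t"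
  shows "w \<Turnstile> qle s t"
proof -
  define \<rho> where "\<rho> a = (if of_type w a Rat then a else qzero)" for a
  have \<rho>: "\<forall>a. of_type w (\<rho> a) Rat" and id: "\<And>a. of_type w a Rat \<Longrightarrow> \<rho> a = a" by (auto simp: \<rho>_def)
  note reify = lval_reify[OF _ id]
  let ?d = "\<lambda>(a, b). LA (reify b) (LN (reify a))"
  have "lpos w \<rho> (?d (s, t))"
  proof (rule lpos_farkas[OF \<rho>])
    show "finite (?d ` set H)" by simp
    show "\<forall>e\<in>?d ` set H. lpos w \<rho> e"
    proof
      fix e assume "e \<in> ?d ` set H"
      then obtain a b where ab: "e = ?d (a, b)" "w \<Turnstile> qle a b" using H by auto
      then have "of_type w a Rat" "of_type w b Rat" using forces_wf[OF ab(2)] by auto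
      then have "w \<Turnstile> qle (lval \<rho> (LA (reify a) (LN (reify a)))) (lval \<rho> e)"
        using ab qle_add[OF ab(2) qeq_refl[of "quminus a" w, unfolded qeq_def, THEN conjunct1]]
        by (simp add: reify)
      moreover have "w \<Turnstile> qle qzero (lval \<rho> (LA (reify a) (LN (reify a))))"
        using lev_eq_qeq[of LZ "LA (reify a) (LN (reify a))" \<rho> w] \<rho> by (simp add: qeq_def)
      ultimately show "lpos w \<rho> e" unfolding lpos_def by (metis qle_trans)
    qed
    fix v :: "tm \<Rightarrow> rat" assume "\<forall>e\<in>?d ` set H. 0 \<le> lev v e"
    then have "lev v (reify s) \<le> lev v (reify t)" by (intro sem[OF hom_reify]) auto
    then show "0 \<le> lev v (?d (s, t))" by simp
  qed
  then have "w \<Turnstile> qle qzero (qadd t (quminus s))" using t by (simp add: lpos_def reify)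
  then have "w \<Turnstile> qle (qadd qzero s) (qadd (qadd t (quminus s)) s)"
    using t by (intro qle_add) (simp_all add: qeq_refl[unfolded qeq_def])
  moreover have "w \<Turnstile> qle (lval \<rho> (LX s)) (lval \<rho> (LA LZ (LX s)))"
    "w \<Turnstile> qle (lval \<rho> (LA (LA (LX t) (LN (LX s))) (LX s))) (lval \<rho> (LX t))"
    using lev_eq_qeq[of "LX s" "LA LZ (LX s)" \<rho> w] lev_eq_qeq[of "LA (LA (LX t) (LN (LX s))) (LX s)" "LX t" \<rho> w] \<rho>
    by (simp_all add: qeq_def)
  ultimately show ?thesis using t id by simp (metis qle_trans)
qed

text \<open>The main tool for rational numbers: an inequality that follows from derivable ones over \<open>\<rat>\<close> in
  the theory of ordered groups is derivable.  Disjunctive hypotheses are eliminated one after another by a case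
  distinction, which enlarges the world; what remains is Farkas' lemma.\<close>

theorem lin:
  assumes "\<forall>A\<in>set As. w \<Turnstile> A" "of_type w s Rat" "of_type w t Rat"
    "\<And>v. hom v \<Longrightarrow> \<forall>A\<in>set As. hold v A \<Longrightarrow> v s \<le> v t"
  shows "w \<Turnstile> qle s t"
proof -
  have "w \<Turnstile> qle s t"
    if "\<forall>A\<in>set As. w \<Turnstile> A" "\<forall>(a, b)\<in>set H. w \<Turnstile> qle a b" "of_type w s Rat" "of_type w t Rat"
      "\<And>v. hom v \<Longrightarrow> \<forall>A\<in>set As. hold v A \<Longrightarrow> \<forall>(a, b)\<in>set H. v a \<le> v b \<Longrightarrow> v s \<le> v t" for H
    using that
  proof (induction "\<Sum>A\<leftarrow>As. 2 * size A + 1" arbitrary: As H w rule: less_induct)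
    case less
    show ?case
    proof (cases As)
      case Nil
      with less.prems show ?thesis by (intro lin_conj) auto
    next
      case (Cons A As')
      consider a b where "A = qle a b" | B C where "A = (B \<^bold>\<and> C)" | B C where "A = (B \<^bold>\<or> C)"
        | "\<And>v. hold v A"
        by (cases "\<exists>a b. A = qle a b", blast, cases A) auto
      then show ?thesis
      proof cases
        case (1 a b)
        show ?thesis
          by (rule less.hyps[of As' _ "(a, b) # H"]) (use Cons 1 less.prems in auto)
      next
        case (2 B C)
        show ?thesis
          by (rule less.hyps[of "B # C # As'" _ H]) (use Cons 2 less.prems in \<open>auto simp: f_conj_iff\<close>)
      next
        case (3 B C)
        then have "w \<Turnstile> B \<^bold>\<or> C" using Cons less.prems by simp
        then show ?thesis
        proof (rule f_orE)
          fix w' assume w': "w \<le> w'" "w' \<Turnstile> B"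
          show "w' \<Turnstile> qle s t"
            by (rule less.hyps[of "B # As'" _ H])
              (use Cons 3 less.prems w' in \<open>auto intro: forces_mono of_type_mono\<close>)
        next
          fix w' assume w': "w \<le> w'" "w' \<Turnstile> C"
          show "w' \<Turnstile> qle s t"
            by (rule less.hyps[of "C # As'" _ H])
              (use Cons 3 less.prems w' in \<open>auto intro: forces_mono of_type_mono\<close>)
        qed
      next
        case 4
        show ?thesis by (rule less.hyps[of As' _ H]) (use Cons 4 less.prems in auto)
      qed
    qed
  qed
  from this[of "[]"] assms show ?thesis by auto
qed

lemma lin1: "w \<Turnstile> A1 \<Longrightarrow> (\<And>v. hom v \<Longrightarrow> hold v A1 \<Longrightarrow> v s \<le> v t) \<Longrightarrow>
    of_type w s Rat \<Longrightarrow> of_type w t Rat \<Longrightarrow> w \<Turnstile> qle s t"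
  by (rule lin[of "[A1]"]) simp_all

lemma lin2: "w \<Turnstile> A1 \<Longrightarrow> w \<Turnstile> A2 \<Longrightarrow> (\<And>v. hom v \<Longrightarrow> hold v A1 \<Longrightarrow> hold v A2 \<Longrightarrow> v s \<le> v t) \<Longrightarrow>
    of_type w s Rat \<Longrightarrow> of_type w t Rat \<Longrightarrow> w \<Turnstile> qle s t"
  by (rule lin[of "[A1, A2]"]) simp_all

lemma lin3: "w \<Turnstile> A1 \<Longrightarrow> w \<Turnstile> A2 \<Longrightarrow> w \<Turnstile> A3 \<Longrightarrow>
    (\<And>v. hom v \<Longrightarrow> hold v A1 \<Longrightarrow> hold v A2 \<Longrightarrow> hold v A3 \<Longrightarrow> v s \<le> v t) \<Longrightarrow>
    of_type w s Rat \<Longrightarrow> of_type w t Rat \<Longrightarrow> w \<Turnstile> qle s t"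
  by (rule lin[of "[A1, A2, A3]"]) simp_all

lemma lin4: "w \<Turnstile> A1 \<Longrightarrow> w \<Turnstile> A2 \<Longrightarrow> w \<Turnstile> A3 \<Longrightarrow> w \<Turnstile> A4 \<Longrightarrow>
    (\<And>v. hom v \<Longrightarrow> hold v A1 \<Longrightarrow> hold v A2 \<Longrightarrow> hold v A3 \<Longrightarrow> hold v A4 \<Longrightarrow> v s \<le> v t) \<Longrightarrow>
    of_type w s Rat \<Longrightarrow> of_type w t Rat \<Longrightarrow> w \<Turnstile> qle s t"
  by (rule lin[of "[A1, A2, A3, A4]"]) simp_all

lemma lin5: "w \<Turnstile> A1 \<Longrightarrow> w \<Turnstile> A2 \<Longrightarrow> w \<Turnstile> A3 \<Longrightarrow> w \<Turnstile> A4 \<Longrightarrow> w \<Turnstile> A5 \<Longrightarrow>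
    (\<And>v. hom v \<Longrightarrow> hold v A1 \<Longrightarrow> hold v A2 \<Longrightarrow> hold v A3 \<Longrightarrow> hold v A4 \<Longrightarrow> hold v A5 \<Longrightarrow> v s \<le> v t) \<Longrightarrow>
    of_type w s Rat \<Longrightarrow> of_type w t Rat \<Longrightarrow> w \<Turnstile> qle s t"
  by (rule lin[of "[A1, A2, A3, A4, A5]"]) simp_all

lemma lin6: "w \<Turnstile> A1 \<Longrightarrow> w \<Turnstile> A2 \<Longrightarrow> w \<Turnstile> A3 \<Longrightarrow> w \<Turnstile> A4 \<Longrightarrow> w \<Turnstile> A5 \<Longrightarrow> w \<Turnstile> A6 \<Longrightarrow>
    (\<And>v. hom v \<Longrightarrow> hold v A1 \<Longrightarrow> hold v A2 \<Longrightarrow> hold v A3 \<Longrightarrow> hold v A4 \<Longrightarrow> hold v A5 \<Longrightarrow> hold v A6 \<Longrightarrow>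
      v s \<le> v t) \<Longrightarrow>
    of_type w s Rat \<Longrightarrow> of_type w t Rat \<Longrightarrow> w \<Turnstile> qle s t"
  by (rule lin[of "[A1, A2, A3, A4, A5, A6]"]) simp_all

lemma lin7: "w \<Turnstile> A1 \<Longrightarrow> w \<Turnstile> A2 \<Longrightarrow> w \<Turnstile> A3 \<Longrightarrow> w \<Turnstile> A4 \<Longrightarrow> w \<Turnstile> A5 \<Longrightarrow> w \<Turnstile> A6 \<Longrightarrow> w \<Turnstile> A7 \<Longrightarrow>
    (\<And>v. hom v \<Longrightarrow> hold v A1 \<Longrightarrow> hold v A2 \<Longrightarrow> hold v A3 \<Longrightarrow> hold v A4 \<Longrightarrow> hold v A5 \<Longrightarrow> hold v A6 \<Longrightarrow>
      hold v A7 \<Longrightarrow> v s \<le> v t) \<Longrightarrow>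
    of_type w s Rat \<Longrightarrow> of_type w t Rat \<Longrightarrow> w \<Turnstile> qle s t"
  by (rule lin[of "[A1, A2, A3, A4, A5, A6, A7]"]) simp_all

lemma lin8: "w \<Turnstile> A1 \<Longrightarrow> w \<Turnstile> A2 \<Longrightarrow> w \<Turnstile> A3 \<Longrightarrow> w \<Turnstile> A4 \<Longrightarrow> w \<Turnstile> A5 \<Longrightarrow> w \<Turnstile> A6 \<Longrightarrow> w \<Turnstile> A7 \<Longrightarrow> w \<Turnstile> A8 \<Longrightarrow>
    (\<And>v. hom v \<Longrightarrow> hold v A1 \<Longrightarrow> hold v A2 \<Longrightarrow> hold v A3 \<Longrightarrow> hold v A4 \<Longrightarrow> hold v A5 \<Longrightarrow> hold v A6 \<Longrightarrow>
      hold v A7 \<Longrightarrow> hold v A8 \<Longrightarrow> v s \<le> v t) \<Longrightarrow>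
    of_type w s Rat \<Longrightarrow> of_type w t Rat \<Longrightarrow> w \<Turnstile> qle s t"
  by (rule lin[of "[A1, A2, A3, A4, A5, A6, A7, A8]"]) simp_all

section \<open>Particular rational numbers\<close>

lemma nle_poly:
  "poly (a \<oplus> r) = poly b \<Longrightarrow> \<forall>t\<in>set ts. of_type w t Nat \<Longrightarrow> w \<Turnstile> nle (val ts a) (val ts b)"
  using nat_ring[of "a \<oplus> r" b ts w] by (auto intro!: nleI val_typed)

lemma f_eq_qle:
  assumes "w \<Turnstile> a \<^bold>= b" "of_type w a Rat"
  shows "w \<Turnstile> qle a b \<^bold>\<and> qle b a"
proof -
  have "w \<Turnstile> qle a a" using qeq_refl[OF assms(2)] by (simp add: qeq_def)
  with f_subst[OF assms, of "qle (ren Suc a) (Var 0) \<^bold>\<and> qle (Var 0) (ren Suc a)"] assms(2)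
  show ?thesis by (auto simp: f_conj_iff)
qed

text \<open>Index \<open>k\<close> stands for the accuracy \<open>1/(k + 1)\<close>; \<open>hf k\<close> is the index of half that accuracy, and
  also the index at which a difference of real numbers takes its \<open>k\<close>-th approximation.\<close>

abbreviation hf :: "tm \<Rightarrow> tm" where "hf k \<equiv> Succ (add k k)"

lemma uf_pos: assumes "of_type w n Nat" shows "w \<Turnstile> qle qzero (unit_frac n)"
proof -
  have u: "qrep w [n] (unit_frac n) (PS PZ) PZ (PX 0)" using assms by (intro qrep_unit_frac) (auto intro: f_refl[of _ _ Nat])
  show ?thesis unfolding qle_iff_nle[OF qrep_qzero u] by (rule nle_poly[where r = "PS PZ"]) (use assms in auto)
qed

lemma uf_half:
  assumes "of_type w n Nat"
  shows "w \<Turnstile> qle (qadd (unit_frac (hf n)) (unit_frac (hf n))) (unit_frac n) \<^bold>\<and>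
    qle (unit_frac n) (qadd (unit_frac (hf n)) (unit_frac (hf n)))"
proof -
  have n: "qrep w [n] (unit_frac n) (PS PZ) PZ (PX 0)" using assms by (intro qrep_unit_frac) (auto intro: f_refl[of _ _ Nat])
  have h: "qrep w [n] (unit_frac (hf n)) (PS PZ) PZ (PS (PX 0 \<oplus> PX 0))"
    using assms by (intro qrep_unit_frac) (auto intro!: f_refl[of _ _ Nat])
  have "qeq w (qadd (unit_frac (hf n)) (unit_frac (hf n))) (unit_frac n)"
    by (rule qeqI[OF qrep_qadd[OF h h] n]) (use assms in \<open>auto simp: algebra_simps\<close>)
  then show ?thesis by (simp add: qeq_def f_conj_iff)
qed

lemma uf_not_le_zero:
  assumes le: "w \<Turnstile> qle (unit_frac n) qzero"
  shows "w \<Turnstile> Bot"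
proof -
  have t: "of_type w n Nat" using forces_wf[OF le] by simp
  have u: "qrep w [n] (unit_frac n) (PS PZ) PZ (PX 0)" using t by (intro qrep_unit_frac) (auto intro: f_refl[of _ _ Nat])
  have ts: "\<forall>t\<in>set [n]. of_type w t Nat" using t by simp
  note h = le[unfolded qle_iff_nle[OF u qrep_qzero]]
  have "w \<Turnstile> nle (val [n] (PS PZ)) (val [n] PZ)"
    by (rule nle_cert[OF h h ts, where m = PZ and l = "PS PZ" and k = PZ and r = PZ]) simp
  then have "w \<Turnstile> nlt Zero Zero" by simp
  from nle_nlt_Bot[OF nle_refl this] show ?thesis by simp
qed

text \<open>If \<open>a - b\<close> is positive, it is at least the reciprocal of the product of the two denominators; so
  one instance of \<open>a \<le> b + 1/(m + 1)\<close> suffices for \<open>a \<le> b\<close>.\<close>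

lemma qle_archimedean:
  assumes le: "w \<Turnstile> qle a (qadd b (unit_frac (mul (qden a) (qden b))))"
  shows "w \<Turnstile> qle a b"
proof -
  have t: "of_type w a Rat" "of_type w b Rat" using forces_wf[OF le] by auto
  let ?m = "PS (PX 2) \<otimes> PS (PX 5)"
  obtain ts where ts: "\<forall>t\<in>set ts. of_type w t Nat"
    and a: "qrep w ts a (PX 0) (PX 1) (PX 2)" and b: "qrep w ts b (PX 3) (PX 4) (PX 5)"
    by (rule rat_atoms[OF t t]) (rule that)
  have m: "qrep w ts (unit_frac (mul (qden a) (qden b))) (PS PZ) PZ ?m"
    using t a b by (intro qrep_unit_frac) (auto simp: qrep_def intro!: mul_cong Succ_cong)
  note h = le[unfolded qle_iff_nle(1)[OF a qrep_qadd[OF b m]]]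
  let ?A = "PX 0 \<otimes> PS (PX 5) \<oplus> PX 4 \<otimes> PS (PX 2)" and ?B = "PX 3 \<otimes> PS (PX 2) \<oplus> PX 1 \<otimes> PS (PX 5)"
  show ?thesis unfolding qle_iff_nle[OF a b]
  proof (rule f_orE[OF nle_total[OF val_typed[OF ts] val_typed[OF ts]]])
    fix w' assume w': "w \<le> w'" and "w' \<Turnstile> nlt (val ts ?B) (val ts ?A)"
    then have lt: "w' \<Turnstile> nle (val ts (PS ?B)) (val ts ?A)" by simp
    have ts': "\<forall>t\<in>set ts. of_type w' t Nat" using ts w' of_type_mono by blast
    have "w' \<Turnstile> nle (val ts (PS ?m)) (val ts ?m)"
      by (rule nle_cert[OF lt forces_mono[OF h w'] ts', where m = PZ and l = "PS ?m" and k = "PS PZ" and r = PZ])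
        (simp add: algebra_simps)
    then have "w' \<Turnstile> nlt (val ts ?m) (val ts ?m)" by simp
    then have "w' \<Turnstile> Bot" by (rule nle_nlt_Bot[OF nle_refl[OF val_typed[OF ts']]])
    then show "w' \<Turnstile> nle (val ts ?A) (val ts ?B)"
      by (rule f_botE) (unfold nle_wf, intro conjI val_typed[OF ts'])
  qed
qed

text \<open>If instead \<open>b \<le> a\<close>, the hypothesis would make the product of the denominators vanish.\<close>

lemma qlt_intro:
  assumes le: "w \<Turnstile> qle (qadd a (unit_frac n)) b"
  shows "w \<Turnstile> qlt a b"
proof -
  have t: "of_type w a Rat" "of_type w b Rat" "of_type w n Nat" using forces_wf[OF le] by auto
  define ts where "ts = comps a @ comps b @ [n]"
  have ts: "\<forall>t\<in>set ts. of_type w t Nat" using t comps_typed unfolding ts_def by fastforce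
  have a: "qrep w ts a (PX 0) (PX 1) (PX 2)" and b: "qrep w ts b (PX 3) (PX 4) (PX 5)"
    using qrep_atom[OF t(1), of 0 ts] qrep_atom[OF t(2), of 3 ts] by (simp_all add: ts_def eval_nat_numeral)
  have n: "qrep w ts (unit_frac n) (PS PZ) PZ (PX 6)"
    using t by (intro qrep_unit_frac) (auto simp: ts_def intro!: f_refl[of _ _ Nat])
  note h = le[unfolded qle_iff_nle(1)[OF qrep_qadd[OF a n] b]]
  let ?A = "PX 0 \<otimes> PS (PX 5) \<oplus> PX 4 \<otimes> PS (PX 2)" and ?B = "PX 3 \<otimes> PS (PX 2) \<oplus> PX 1 \<otimes> PS (PX 5)"
  let ?y = "PX 2 \<otimes> PX 5 \<oplus> PX 2 \<oplus> PX 5"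
  show ?thesis unfolding qle_iff_nle[OF a b]
  proof (rule f_orE[OF nle_total[OF val_typed[OF ts] val_typed[OF ts]]])
    fix w' assume w': "w \<le> w'" and ge: "w' \<Turnstile> nle (val ts ?B) (val ts ?A)"
    have ts': "\<forall>t\<in>set ts. of_type w' t Nat" using ts w' of_type_mono by blast
    have "w' \<Turnstile> nle (val ts (PS ?y)) (val ts PZ)"
      by (rule nle_cert[OF ge forces_mono[OF h w'] ts', where m = PZ and l = "PS (PX 6)" and k = "PS PZ" and r = PZ])
        (simp add: algebra_simps)
    then have "w' \<Turnstile> nlt (val ts ?y) Zero" by simp
    then have "w' \<Turnstile> Bot" by (rule nle_nlt_Bot[OF nle_Zero[OF val_typed[OF ts']]])
    then show "w' \<Turnstile> nlt (val ts ?A) (val ts ?B)"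
      by (rule f_botE) (use val_typed[OF ts'] in \<open>simp_all del: val_simps\<close>)
  qed
qed

text \<open>The converse of the preceding lemma: a positive difference is at least the reciprocal of the
  product of the denominators.\<close>

lemma qlt_gap:
  assumes lt: "w \<Turnstile> qlt a b"
  shows "w \<Turnstile> qle (qadd a (unit_frac (mul (qden a) (qden b)))) b"
proof -
  have t: "of_type w a Rat" "of_type w b Rat" using forces_wf[OF lt] by auto
  let ?m = "PS (PX 2) \<otimes> PS (PX 5)"
  obtain ts where ts: "\<forall>t\<in>set ts. of_type w t Nat"
    and a: "qrep w ts a (PX 0) (PX 1) (PX 2)" and b: "qrep w ts b (PX 3) (PX 4) (PX 5)"
    by (rule rat_atoms[OF t t]) (rule that)
  have m: "qrep w ts (unit_frac (mul (qden a) (qden b))) (PS PZ) PZ ?m"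
    using t a b by (intro qrep_unit_frac) (auto simp: qrep_def intro!: mul_cong Succ_cong)
  note h = lt[unfolded qle_iff_nle(2)[OF a b] val_simps(3)[symmetric]]
  show ?thesis unfolding qle_iff_nle[OF qrep_qadd[OF a m] b]
    by (rule nle_cert[OF h h ts, where m = PZ and l = "PS ?m" and k = PZ and r = "PS PZ"]) (simp add: algebra_simps)
qed

definition qnat :: "tm \<Rightarrow> tm" where "qnat n = Tup (Tup n Zero) Zero"

lemma qnat_typed [simp]: "has_type (qnat n) \<Delta> Rat \<longleftrightarrow> has_type n \<Delta> Nat"
  by (simp add: qnat_def)

lemma sub_qnat [simp]: "sub s (qnat n) = qnat (sub s n)"
  by (simp add: qnat_def)

lemma qnat_Zero: "qnat Zero = qzero"
  by (simp add: qnat_def qzero_def)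

lemma qrep_qnat: "w \<Turnstile> n \<^bold>= val ts P \<Longrightarrow> of_type w n Nat \<Longrightarrow> qrep w ts (qnat n) P PZ PZ"
  unfolding qnat_def by (rule qrep_Tup) (auto intro: f_refl[of _ _ Nat])

lemma qnat_Succ:
  assumes "of_type w n Nat"
  shows "w \<Turnstile> qle (qnat (Succ n)) (qadd (qnat n) qone) \<^bold>\<and> qle (qadd (qnat n) qone) (qnat (Succ n))"
proof -
  have n: "qrep w [n] (qnat n) (PX 0) PZ PZ" using assms by (intro qrep_qnat) (auto intro: f_refl[of _ _ Nat])
  have s: "qrep w [n] (qnat (Succ n)) (PS (PX 0)) PZ PZ"
    using assms by (intro qrep_qnat) (auto intro!: f_refl[of _ _ Nat])
  have one: "qrep w [n] qone (PS PZ) PZ PZ"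
    unfolding qone_def by (rule qrep_Tup) (auto intro!: f_refl[of _ _ Nat])
  have "qeq w (qnat (Succ n)) (qadd (qnat n) qone)"
    by (rule qeqI[OF s qrep_qadd[OF n one]]) (use assms in \<open>auto simp: algebra_simps\<close>)
  then show ?thesis by (simp add: qeq_def f_conj_iff)
qed

lemma qle_qnat:
  assumes "of_type w q Rat" shows "w \<Turnstile> qle q (qnat (qpos q))"
proof -
  have q: "qrep w (comps q) q (PX 0) (PX 1) (PX 2)"
    using qrep_atom[OF assms, of 0 "comps q"] by (simp add: eval_nat_numeral)
  have n: "qrep w (comps q) (qnat (qpos q)) (PX 0) PZ PZ"
    using assms by (intro qrep_qnat) (auto intro!: f_refl[of _ _ Nat])
  show ?thesis unfolding qle_iff_nle[OF q n]
    by (rule nle_poly[where r = "PX 0 \<otimes> PX 2 \<oplus> PX 1"]) (use assms in \<open>auto simp: algebra_simps\<close>)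
qed


subsection \<open>Absolute value\<close>

lemma npred_Zero: "w \<Turnstile> npred Zero \<^bold>= Zero"
  unfolding npred_def by (rule f_rec_Zero[of _ _ _ Nat]) simp

lemma npred_Succ: "of_type w n Nat \<Longrightarrow> w \<Turnstile> npred (Succ n) \<^bold>= n"
  using f_rec_Succ[of Zero w Nat "Var 1" n] by (simp add: npred_def)

lemma npred_cong: "w \<Turnstile> t \<^bold>= u \<Longrightarrow> of_type w t Nat \<Longrightarrow> w \<Turnstile> npred t \<^bold>= npred u"
  using f_cong[of w t u Nat "npred (Var 0)" Nat] by simp

lemma monus_Zero: "of_type w t Nat \<Longrightarrow> w \<Turnstile> monus t Zero \<^bold>= t"
  unfolding monus_def by (rule f_rec_Zero[of _ _ _ Nat]) (simp add: npred_def)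

lemma monus_Succ: "of_type w t Nat \<Longrightarrow> of_type w u Nat \<Longrightarrow> w \<Turnstile> monus t (Succ u) \<^bold>= npred (monus t u)"
  using f_rec_Succ[of t w Nat "npred (Var 0)" u] by (simp add: monus_def)

lemma monus_cong1: "w \<Turnstile> t \<^bold>= t' \<Longrightarrow> of_type w t Nat \<Longrightarrow> of_type w u Nat \<Longrightarrow> w \<Turnstile> monus t u \<^bold>= monus t' u"
  using f_cong[of w t t' Nat "monus (Var 0) (ren Suc u)" Nat] by simp

lemma monus_cong2: "w \<Turnstile> u \<^bold>= u' \<Longrightarrow> of_type w t Nat \<Longrightarrow> of_type w u Nat \<Longrightarrow> w \<Turnstile> monus t u \<^bold>= monus t u'"
  using f_cong[of w u u' Nat "monus (ren Suc t) (Var 0)" Nat] by simp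

lemma monus_Succ_Succ:
  assumes t: "of_type w t Nat" and u: "of_type w u Nat"
  shows "w \<Turnstile> monus (Succ t) (Succ u) \<^bold>= monus t u"
proof -
  let ?A = "monus (Succ (ren Suc t)) (Succ (Var 0)) \<^bold>= monus (ren Suc t) (Var 0)"
  have "w \<Turnstile> subf (inst u) ?A"
  proof (rule f_nat_induct[OF _ _ _ order_refl u])
    have "w \<Turnstile> monus (Succ t) (Succ Zero) \<^bold>= npred (monus (Succ t) Zero)" using t by (intro monus_Succ) auto
    also have "w \<Turnstile> npred (monus (Succ t) Zero) \<^bold>= npred (Succ t)" using t by (intro npred_cong monus_Zero) auto
    also have "w \<Turnstile> npred (Succ t) \<^bold>= t" using t by (rule npred_Succ)
    also have "w \<Turnstile> t \<^bold>= monus t Zero" using t by (intro f_sym[OF monus_Zero])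
    finally show "w \<Turnstile> subf (inst Zero) ?A" by simp
  next
    fix w' n assume w': "w \<le> w'" and n: "of_type w' n Nat" and IH: "w' \<Turnstile> subf (inst n) ?A"
    have t': "of_type w' t Nat" using t w' by (rule of_type_mono)
    from IH have IH: "w' \<Turnstile> monus (Succ t) (Succ n) \<^bold>= monus t n" by simp
    have "w' \<Turnstile> monus (Succ t) (Succ (Succ n)) \<^bold>= npred (monus (Succ t) (Succ n))"
      using t' n by (intro monus_Succ) auto
    also have "w' \<Turnstile> npred (monus (Succ t) (Succ n)) \<^bold>= npred (monus t n)"
      using t' n by (intro npred_cong IH) auto
    also have "w' \<Turnstile> npred (monus t n) \<^bold>= monus t (Succ n)" using t' n by (intro f_sym[OF monus_Succ])
    finally show "w' \<Turnstile> subf (inst (Succ n)) ?A" by simp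
  qed (use t in auto)
  then show ?thesis by simp
qed

lemma Zero_monus:
  assumes "of_type w u Nat" shows "w \<Turnstile> monus Zero u \<^bold>= Zero"
proof -
  have "w \<Turnstile> subf (inst u) (monus Zero (Var 0) \<^bold>= Zero)"
  proof (rule f_nat_induct[OF _ _ _ order_refl assms])
    show "w \<Turnstile> subf (inst Zero) (monus Zero (Var 0) \<^bold>= Zero)" by (simp add: monus_Zero)
  next
    fix w' n assume n: "of_type w' n Nat" and IH: "w' \<Turnstile> subf (inst n) (monus Zero (Var 0) \<^bold>= Zero)"
    have "w' \<Turnstile> monus Zero (Succ n) \<^bold>= npred (monus Zero n)" using n by (intro monus_Succ) auto
    also have "w' \<Turnstile> npred (monus Zero n) \<^bold>= npred Zero" using n IH by (intro npred_cong) auto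
    also note npred_Zero
    finally show "w' \<Turnstile> subf (inst (Succ n)) (monus Zero (Var 0) \<^bold>= Zero)" by simp
  qed auto
  then show ?thesis by simp
qed

text \<open>Both values of truncated subtraction that occur in an absolute value.\<close>

lemma monus_add:
  assumes t: "of_type w t Nat" and c: "of_type w c Nat"
  shows "w \<Turnstile> (monus (add t c) t \<^bold>= c) \<^bold>\<and> (monus t (add t c) \<^bold>= Zero)"
proof -
  let ?A = "(monus (add (Var 0) (ren Suc c)) (Var 0) \<^bold>= ren Suc c) \<^bold>\<and> (monus (Var 0) (add (Var 0) (ren Suc c)) \<^bold>= Zero)"
  have "w \<Turnstile> subf (inst t) ?A"
  proof (rule f_nat_induct[OF _ _ _ order_refl t])
    have "w \<Turnstile> monus (add Zero c) Zero \<^bold>= c"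
      using c by (intro f_trans[OF monus_Zero add_Zero_left]) auto
    moreover have "w \<Turnstile> monus Zero (add Zero c) \<^bold>= Zero" using c by (intro Zero_monus) auto
    ultimately show "w \<Turnstile> subf (inst Zero) ?A" by (simp add: f_conj_iff)
  next
    fix w' n assume w': "w \<le> w'" and n: "of_type w' n Nat" and IH: "w' \<Turnstile> subf (inst n) ?A"
    have c': "of_type w' c Nat" using c w' by (rule of_type_mono)
    have eq: "w' \<Turnstile> add (Succ n) c \<^bold>= Succ (add n c)" using n c' by (rule add_Succ_left)
    have "w' \<Turnstile> monus (add (Succ n) c) (Succ n) \<^bold>= monus (Succ (add n c)) (Succ n)"
      using n c' by (intro monus_cong1 eq) auto
    also have "w' \<Turnstile> monus (Succ (add n c)) (Succ n) \<^bold>= monus (add n c) n"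
      using n c' by (intro monus_Succ_Succ) auto
    finally have 1: "w' \<Turnstile> monus (add (Succ n) c) (Succ n) \<^bold>= monus (add n c) n" .
    have "w' \<Turnstile> monus (Succ n) (add (Succ n) c) \<^bold>= monus (Succ n) (Succ (add n c))"
      using n c' by (intro monus_cong2 eq) auto
    also have "w' \<Turnstile> monus (Succ n) (Succ (add n c)) \<^bold>= monus n (add n c)"
      using n c' by (intro monus_Succ_Succ) auto
    finally have 2: "w' \<Turnstile> monus (Succ n) (add (Succ n) c) \<^bold>= monus n (add n c)" .
    from 1 2 IH show "w' \<Turnstile> subf (inst (Succ n)) ?A" by (auto simp: f_conj_iff intro: f_trans)
  qed (use c in auto)
  then show ?thesis by simp
qed

text \<open>All that is used of the absolute value, in a form that linear arithmetic can take as a hypothesis.\<close>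

definition abs_spec :: "tm \<Rightarrow> fm" where
  "abs_spec q = ((qle q (qabs q) \<^bold>\<and> qle (quminus q) (qabs q)) \<^bold>\<and> (qle (qabs q) q \<^bold>\<or> qle (qabs q) (quminus q)))"

lemma hold_abs_spec [simp]: "hold v (abs_spec q) \<longleftrightarrow>
    v q \<le> v (qabs q) \<and> v (quminus q) \<le> v (qabs q) \<and> (v (qabs q) \<le> v q \<or> v (qabs q) \<le> v (quminus q))"
  by (auto simp: abs_spec_def)

lemma abs_spec:
  assumes q: "of_type w q Rat" shows "w \<Turnstile> abs_spec q"
proof -
  \<comment> \<open>if the two components differ by \<open>c\<close>, then \<open>c\<close> is the numerator of the absolute value\<close>
  have rep: "qrep w' [a, c, Snd q] (qabs q) (PX 1) PZ (PX 2)"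
    if w': "w \<le> w'" and t: "of_type w' a Nat" "of_type w' c Nat"
      and ac: "(w' \<Turnstile> a \<^bold>= qpos q) \<and> (w' \<Turnstile> add a c \<^bold>= qneg q) \<or> (w' \<Turnstile> a \<^bold>= qneg q) \<and> (w' \<Turnstile> add a c \<^bold>= qpos q)"
    for w' a c
  proof -
    have q': "of_type w' q Rat" using q w' by (rule of_type_mono)
    have m: "w' \<Turnstile> monus (add a c) a \<^bold>= c" "w' \<Turnstile> monus a (add a c) \<^bold>= Zero"
      using monus_add[OF t] by (simp_all add: f_conj_iff)
    have cong: "w' \<Turnstile> monus y x \<^bold>= c" "w' \<Turnstile> monus x y \<^bold>= Zero"
      if x: "w' \<Turnstile> a \<^bold>= x" and y: "w' \<Turnstile> add a c \<^bold>= y" for x y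
    proof -
      have t': "of_type w' x Nat" "of_type w' y Nat"
        using t f_eq_typed[OF x, of Nat] f_eq_typed[OF y, of Nat] by auto
      have "w' \<Turnstile> monus y x \<^bold>= monus (add a c) x" using t' by (intro monus_cong1 f_sym[OF y])
      also have "w' \<Turnstile> monus (add a c) x \<^bold>= monus (add a c) a" using t t' by (intro monus_cong2 f_sym[OF x]) auto
      also note m(1)
      finally show "w' \<Turnstile> monus y x \<^bold>= c" .
      have "w' \<Turnstile> monus x y \<^bold>= monus x (add a c)" using t' by (intro monus_cong2 f_sym[OF y])
      also have "w' \<Turnstile> monus x (add a c) \<^bold>= monus a (add a c)" using t t' by (intro monus_cong1 f_sym[OF x]) auto
      also note m(2)
      finally show "w' \<Turnstile> monus x y \<^bold>= Zero" .
    qed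
    have "w' \<Turnstile> add (monus (qpos q) (qneg q)) (monus (qneg q) (qpos q)) \<^bold>= c"
      using ac
    proof
      assume "(w' \<Turnstile> a \<^bold>= qpos q) \<and> (w' \<Turnstile> add a c \<^bold>= qneg q)"
      then have "w' \<Turnstile> add (monus (qpos q) (qneg q)) (monus (qneg q) (qpos q)) \<^bold>= add Zero c"
        using cong q' by (intro add_cong) auto
      also have "w' \<Turnstile> add Zero c \<^bold>= c" using t by (intro add_Zero_left)
      finally show ?thesis .
    next
      assume "(w' \<Turnstile> a \<^bold>= qneg q) \<and> (w' \<Turnstile> add a c \<^bold>= qpos q)"
      then have "w' \<Turnstile> add (monus (qpos q) (qneg q)) (monus (qneg q) (qpos q)) \<^bold>= add c Zero"
        using cong q' by (intro add_cong) auto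
      also have "w' \<Turnstile> add c Zero \<^bold>= c" using t by (intro add_Zero)
      finally show ?thesis .
    qed
    then show ?thesis unfolding qabs_def
      by (intro qrep_Tup) (use q' t in \<open>auto intro!: f_refl[of _ _ Nat]\<close>)
  qed
  have t: "of_type w (qpos q) Nat" "of_type w (qneg q) Nat" using q by auto
  have wf: "wf_fm (abs_spec q) (ctx w)" using q by (simp add: abs_spec_def)
  show ?thesis
  proof (rule f_orE[OF nle_total[OF t]])
    fix w1 assume w1: "w \<le> w1" and "w1 \<Turnstile> nle (qpos q) (qneg q)"
    from this(2) show "w1 \<Turnstile> abs_spec q"
    proof (rule nleE)
      fix w2 c assume w2: "w1 \<le> w2" and c: "of_type w2 c Nat" and tp: "of_type w2 (qpos q) Nat"
        and eq: "w2 \<Turnstile> add (qpos q) c \<^bold>= qneg q"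
      have le: "w \<le> w2" using w1 w2 by (rule order_trans)
      have q2: "of_type w2 q Rat" using q le by (rule of_type_mono)
      let ?ts = "[qpos q, c, Snd q]"
      have ts: "\<forall>t\<in>set ?ts. of_type w2 t Nat" using q2 c by auto
      have ra: "qrep w2 ?ts (qabs q) (PX 1) PZ (PX 2)"
        using rep[OF le tp c] eq f_refl[OF tp] by blast
      have rq: "qrep w2 ?ts q (PX 0) (PX 0 \<oplus> PX 1) (PX 2)"
        using q2 f_sym[OF eq] by (auto simp: qrep_def intro: f_refl[of _ _ Nat])
      have "qeq w2 (qabs q) (quminus q)"
        by (rule qeqI[OF ra qrep_quminus[OF rq] ts]) (simp add: algebra_simps)
      moreover have "w2 \<Turnstile> qle q (qabs q)" unfolding qle_iff_nle[OF rq ra]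
        by (rule nle_poly[OF _ ts, where r = "(PX 1 \<oplus> PX 1) \<otimes> PS (PX 2)"]) (simp add: algebra_simps)
      ultimately show "w2 \<Turnstile> abs_spec q"
        using q2 by (auto simp: abs_spec_def qeq_def f_conj_iff intro: f_orI2)
    qed (use wf w1 wf_fm_mono in auto)
  next
    fix w1 assume w1: "w \<le> w1" and lt: "w1 \<Turnstile> nlt (qneg q) (qpos q)"
    have tn: "of_type w1 (qneg q) Nat" using forces_wf[OF lt] by simp
    have "w1 \<Turnstile> nle (qneg q) (Succ (qneg q))"
      using nle_poly[of "PX 0" "PS PZ" "PS (PX 0)" "[qneg q]" w1] tn by simp
    from nle_trans[OF this lt] show "w1 \<Turnstile> abs_spec q"
    proof (rule nleE)
      fix w2 c assume w2: "w1 \<le> w2" and c: "of_type w2 c Nat" and tp: "of_type w2 (qneg q) Nat"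
        and eq: "w2 \<Turnstile> add (qneg q) c \<^bold>= qpos q"
      have le: "w \<le> w2" using w1 w2 by (rule order_trans)
      have q2: "of_type w2 q Rat" using q le by (rule of_type_mono)
      let ?ts = "[qneg q, c, Snd q]"
      have ts: "\<forall>t\<in>set ?ts. of_type w2 t Nat" using q2 c by auto
      have ra: "qrep w2 ?ts (qabs q) (PX 1) PZ (PX 2)"
        using rep[OF le tp c] eq f_refl[OF tp] by blast
      have rq: "qrep w2 ?ts q (PX 0 \<oplus> PX 1) (PX 0) (PX 2)"
        using q2 f_sym[OF eq] by (auto simp: qrep_def intro: f_refl[of _ _ Nat])
      have "qeq w2 (qabs q) q"
        by (rule qeqI[OF ra rq ts]) (simp add: algebra_simps)
      moreover have "w2 \<Turnstile> qle (quminus q) (qabs q)" unfolding qle_iff_nle[OF qrep_quminus[OF rq] ra]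
        by (rule nle_poly[OF _ ts, where r = "(PX 1 \<oplus> PX 1) \<otimes> PS (PX 2)"]) (simp add: algebra_simps)
      ultimately show "w2 \<Turnstile> abs_spec q"
        using q2 by (auto simp: abs_spec_def qeq_def f_conj_iff intro: f_orI1)
    qed (use wf w1 wf_fm_mono in auto)
  qed
qed

section \<open>Real numbers\<close>

lemma sub_wk3 [simp]:
  "sub (up_sub (case_nat a (case_nat b Var))) (wk 3 t) = ren Suc t"
  by (simp add: ren_sub_Var sub_sub o_def eval_nat_numeral)

lemma real_app [simp]: "has_type x \<Delta> Real \<Longrightarrow> has_type (x \<^bold>\<cdot> k) \<Delta> Rat \<longleftrightarrow> has_type k \<Delta> Nat"
  using has_type_unique by auto

lemma seq_app [simp]: "has_type x \<Delta> (Nat \<^bold>\<Rightarrow> Real) \<Longrightarrow> has_type (x \<^bold>\<cdot> k) \<Delta> Real \<longleftrightarrow> has_type k \<Delta> Nat"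
  using has_type_unique by auto

lemma real_ops_typed [simp]:
  "has_type (real_of q) \<Delta> Real \<longleftrightarrow> has_type q \<Delta> Rat"
  "has_type (rminus x y) \<Delta> Real \<longleftrightarrow> has_type x \<Delta> Real \<and> has_type y \<Delta> Real"
  "has_type (rabs x) \<Delta> Real \<longleftrightarrow> has_type x \<Delta> Real"
  by (simp_all add: real_of_def rminus_def rabs_def)

lemma real_wf [simp]:
  "wf_fm (is_real x) \<Delta> \<longleftrightarrow> has_type x \<Delta> Real"
  "wf_fm (rle x y) \<Delta> \<longleftrightarrow> has_type x \<Delta> Real \<and> has_type y \<Delta> Real"
  "wf_fm (rlt x y) \<Delta> \<longleftrightarrow> has_type x \<Delta> Real \<and> has_type y \<Delta> Real"
  "wf_fm (is_real_seq s) \<Delta> \<longleftrightarrow> has_type s \<Delta> (Nat \<^bold>\<Rightarrow> Real)"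
  by (auto simp: is_real_def rle_def rlt_def rnonneg_def rpositive_def is_real_seq_def)

declare has_type.simps(2) [simp del]

lemma sub_real [simp]:
  "sub s (real_of q) = real_of (sub s q)"
  "sub s (rminus x y) = rminus (sub s x) (sub s y)"
  "sub s (rabs x) = rabs (sub s x)"
  by (simp_all add: real_of_def rminus_def rabs_def)

lemma subf_real [simp]:
  "subf s (is_real x) = is_real (sub s x)"
  "subf s (rle x y) = rle (sub s x) (sub s y)"
  "subf s (rlt x y) = rlt (sub s x) (sub s y)"
  "subf s (is_real_seq x) = is_real_seq (sub s x)"
  by (simp_all add: is_real_def rle_def rlt_def rnonneg_def rpositive_def is_real_seq_def)

abbreviation Qeq :: "tm \<Rightarrow> tm \<Rightarrow> fm" where "Qeq a b \<equiv> qle a b \<^bold>\<and> qle b a"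

lemma real_of_val:
  assumes "of_type w q Rat" "of_type w k Nat" shows "w \<Turnstile> Qeq (real_of q \<^bold>\<cdot> k) q"
  using f_eq_qle[OF f_beta[of "ren Suc q" Nat w Rat k]] assms
  by (simp add: real_of_def has_type.simps(2))

lemma rminus_val:
  assumes "of_type w x Real" "of_type w y Real" "of_type w k Nat"
  shows "w \<Turnstile> Qeq (rminus x y \<^bold>\<cdot> k) (qminus (x \<^bold>\<cdot> hf k) (y \<^bold>\<cdot> hf k))"
  using f_eq_qle[OF f_beta[of "qminus (ren Suc x \<^bold>\<cdot> hf (Var 0)) (ren Suc y \<^bold>\<cdot> hf (Var 0))" Nat w Rat k]] assms
  by (simp add: rminus_def has_type.simps(2))

lemma rabs_val:
  assumes "of_type w x Real" "of_type w k Nat"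
  shows "w \<Turnstile> Qeq (rabs x \<^bold>\<cdot> k) (qabs (x \<^bold>\<cdot> k))"
  using f_eq_qle[OF f_beta[of "qabs (ren Suc x \<^bold>\<cdot> Var 0)" Nat w Rat k]] assms
  by (simp add: rabs_def has_type.simps(2))

lemma is_real_typed: "w \<Turnstile> is_real x \<Longrightarrow> of_type w x Real"
  using forces_wf by fastforce

text \<open>Regularity, in the one-sided form in which it is used.\<close>

lemma reg:
  assumes x: "w \<Turnstile> is_real x" and w': "w \<le> w'" and m: "of_type w' m Nat" and n: "of_type w' n Nat"
  shows "w' \<Turnstile> qle (x \<^bold>\<cdot> m) (qadd (x \<^bold>\<cdot> n) (qadd (unit_frac m) (unit_frac n)))"
proof -
  have t: "of_type w' x Real" using is_real_typed[OF x] w' by (rule of_type_mono)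
  have "w' \<Turnstile> All Nat (qle (qabs (qminus (ren Suc x \<^bold>\<cdot> ren Suc m) (ren Suc x \<^bold>\<cdot> Var 0)))
      (qadd (unit_frac (ren Suc m)) (unit_frac (Var 0))))"
    using f_allE[OF x[unfolded is_real_def] w' m] by simp
  from f_allE[OF this order_refl n]
  have h: "w' \<Turnstile> qle (qabs (qminus (x \<^bold>\<cdot> m) (x \<^bold>\<cdot> n))) (qadd (unit_frac m) (unit_frac n))" by simp
  have a: "w' \<Turnstile> abs_spec (qminus (x \<^bold>\<cdot> m) (x \<^bold>\<cdot> n))" using t m n by (intro abs_spec) simp
  show ?thesis using h a by (rule lin2) (use t m n in \<open>auto simp: hom_def qminus_def\<close>)
qed

lemma is_realI:
  assumes t: "of_type w x Real"
    and r: "\<And>w' m n. w \<le> w' \<Longrightarrow> of_type w' x Real \<Longrightarrow> of_type w' m Nat \<Longrightarrow> of_type w' n Nat \<Longrightarrow>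
      w' \<Turnstile> qle (x \<^bold>\<cdot> m) (qadd (x \<^bold>\<cdot> n) (qadd (unit_frac m) (unit_frac n)))"
  shows "w \<Turnstile> is_real x"
  unfolding is_real_def
proof (rule f_allI)
  fix w1 m assume w1: "w \<le> w1" "of_type w1 m Nat"
  have t1: "of_type w1 x Real" using t w1 of_type_mono by blast
  have "w1 \<Turnstile> All Nat (qle (qabs (qminus (ren Suc x \<^bold>\<cdot> ren Suc m) (ren Suc x \<^bold>\<cdot> Var 0)))
      (qadd (unit_frac (ren Suc m)) (unit_frac (Var 0))))"
  proof (rule f_allI)
    fix w2 n assume w2: "w1 \<le> w2" "of_type w2 n Nat"
    have t2: "of_type w2 x Real" "of_type w2 m Nat" using t1 w1 w2 of_type_mono by blast+
    have le: "w \<le> w2" using w1 w2 order_trans by blast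
    have "w2 \<Turnstile> abs_spec (qminus (x \<^bold>\<cdot> m) (x \<^bold>\<cdot> n))" using t2 w2 by (intro abs_spec) simp
    with r[OF le t2(1) t2(2) w2(2)] r[OF le t2(1) w2(2) t2(2)]
    have "w2 \<Turnstile> qle (qabs (qminus (x \<^bold>\<cdot> m) (x \<^bold>\<cdot> n))) (qadd (unit_frac m) (unit_frac n))"
      by (rule lin3) (use t2 w2 in \<open>auto simp: hom_def qminus_def\<close>)
    then show "w2 \<Turnstile> subf (inst n) (qle (qabs (qminus (ren Suc x \<^bold>\<cdot> ren Suc m) (ren Suc x \<^bold>\<cdot> Var 0)))
      (qadd (unit_frac (ren Suc m)) (unit_frac (Var 0))))" by simp
  qed (use t1 w1 in simp)
  then show "w1 \<Turnstile> subf (inst m) (All Nat (qle (qabs (qminus (wk 2 x \<^bold>\<cdot> Var 1) (wk 2 x \<^bold>\<cdot> Var 0)))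
         (qadd (unit_frac (Var 1)) (unit_frac (Var 0)))))" by simp
qed (use t in simp)

lemma is_real_real_of:
  assumes q: "of_type w q Rat" shows "w \<Turnstile> is_real (real_of q)"
proof (rule is_realI)
  fix w' m n assume w': "w \<le> w'" and t: "of_type w' m Nat" "of_type w' n Nat"
  have q': "of_type w' q Rat" using q w' by (rule of_type_mono)
  show "w' \<Turnstile> qle (real_of q \<^bold>\<cdot> m) (qadd (real_of q \<^bold>\<cdot> n) (qadd (unit_frac m) (unit_frac n)))"
    by (rule lin4[OF real_of_val[OF q' t(1)] real_of_val[OF q' t(2)] uf_pos[OF t(1)] uf_pos[OF t(2)]])
      (use q' t in \<open>auto simp: hom_def\<close>)
qed (use q in simp)

lemma is_real_rminus:
  assumes x: "w \<Turnstile> is_real x" and y: "w \<Turnstile> is_real y" shows "w \<Turnstile> is_real (rminus x y)"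
proof (rule is_realI)
  fix w' m n assume w': "w \<le> w'" and t: "of_type w' m Nat" "of_type w' n Nat"
  have xy: "of_type w' x Real" "of_type w' y Real" using x y w' is_real_typed of_type_mono by blast+
  have h: "of_type w' (hf m) Nat" "of_type w' (hf n) Nat" using t by auto
  show "w' \<Turnstile> qle (rminus x y \<^bold>\<cdot> m) (qadd (rminus x y \<^bold>\<cdot> n) (qadd (unit_frac m) (unit_frac n)))"
    by (rule lin6[OF rminus_val[OF xy t(1)] rminus_val[OF xy t(2)] reg[OF x w' h] reg[OF y w' h(2,1)]
          uf_half[OF t(1)] uf_half[OF t(2)]]) (use xy t in \<open>auto simp: hom_def qminus_def\<close>)
qed (use x y is_real_typed in auto)

lemma is_real_rabs:
  assumes x: "w \<Turnstile> is_real x" shows "w \<Turnstile> is_real (rabs x)"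
proof (rule is_realI)
  fix w' m n assume w': "w \<le> w'" and t: "of_type w' m Nat" "of_type w' n Nat"
  have x': "of_type w' x Real" using x w' is_real_typed of_type_mono by blast
  have a: "w' \<Turnstile> abs_spec (x \<^bold>\<cdot> m)" "w' \<Turnstile> abs_spec (x \<^bold>\<cdot> n)" using x' t by (auto intro: abs_spec)
  show "w' \<Turnstile> qle (rabs x \<^bold>\<cdot> m) (qadd (rabs x \<^bold>\<cdot> n) (qadd (unit_frac m) (unit_frac n)))"
    by (rule lin6[OF rabs_val[OF x' t(1)] rabs_val[OF x' t(2)] reg[OF x w' t] reg[OF x w' t(2,1)] a])
      (use x' t in \<open>auto simp: hom_def\<close>)
qed (use x is_real_typed in auto)


subsection \<open>Order of real numbers, pointwise\<close>

text \<open>\<open>ei k\<close> is \<open>2\<^sup>i/(k + 1)\<close>.  Inequalities of real numbers are used in the form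
  \<open>x\<^sub>k \<le> y\<^sub>k + C/(k + 1)\<close> for all \<open>k\<close>, where \<open>C\<close> is smaller in what one derives from \<open>x \<le> y\<close> than in
  what one may establish in order to show it; this leaves room for the regularity errors of several
  approximations taken at the same index.\<close>

abbreviation e1 :: "tm \<Rightarrow> tm" where "e1 k \<equiv> qadd (unit_frac k) (unit_frac k)"
abbreviation e2 :: "tm \<Rightarrow> tm" where "e2 k \<equiv> qadd (e1 k) (e1 k)"
abbreviation e3 :: "tm \<Rightarrow> tm" where "e3 k \<equiv> qadd (e2 k) (e2 k)"
abbreviation e4 :: "tm \<Rightarrow> tm" where "e4 k \<equiv> qadd (e3 k) (e3 k)"
abbreviation e5 :: "tm \<Rightarrow> tm" where "e5 k \<equiv> qadd (e4 k) (e4 k)"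

text \<open>Five halvings absorb the factor \<open>32\<close>.\<close>

lemma qle_limit:
  assumes t: "of_type w a Rat" "of_type w b Rat"
    and le: "\<And>m. of_type w m Nat \<Longrightarrow> w \<Turnstile> qle a (qadd b (e5 m))"
  shows "w \<Turnstile> qle a b"
proof (rule qle_archimedean)
  let ?m = "mul (qden a) (qden b)"
  have m: "of_type w ?m Nat" using t by simp
  let ?h1 = "hf ?m" let ?h2 = "hf ?h1" let ?h3 = "hf ?h2" let ?h4 = "hf ?h3" let ?h5 = "hf ?h4"
  have h: "of_type w ?h1 Nat" "of_type w ?h2 Nat" "of_type w ?h3 Nat" "of_type w ?h4 Nat" "of_type w ?h5 Nat"
    using m by auto
  show "w \<Turnstile> qle a (qadd b (unit_frac ?m))"
    by (rule lin6[OF le[OF h(5)] uf_half[OF m] uf_half[OF h(1)] uf_half[OF h(2)] uf_half[OF h(3)] uf_half[OF h(4)]])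
      (use t m in \<open>auto simp: hom_def\<close>)
qed

lemma rleD:
  assumes le: "w \<Turnstile> rle x y" and x: "w \<Turnstile> is_real x" and y: "w \<Turnstile> is_real y"
    and w': "w \<le> w'" and k: "of_type w' k Nat"
  shows "w' \<Turnstile> qle (x \<^bold>\<cdot> k) (qadd (y \<^bold>\<cdot> k) (e2 k))"
proof -
  have xy: "of_type w' x Real" "of_type w' y Real" using x y w' is_real_typed of_type_mono by blast+
  have h: "of_type w' (hf k) Nat" using k by simp
  have "w' \<Turnstile> qle (quminus (unit_frac k)) (rminus y x \<^bold>\<cdot> k)"
    using f_allE[OF le[unfolded rle_def rnonneg_def] w' k] by simp
  from this rminus_val[OF xy(2,1) k] reg[OF x w' k h] reg[OF y w' h k] uf_half[OF k]
  show ?thesis by (rule lin5) (use xy k in \<open>auto simp: hom_def qminus_def\<close>)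
qed

text \<open>Compare \<open>x\<close> and \<open>y\<close> at their \<open>m\<close>-th approximations and let \<open>m\<close> tend to infinity.\<close>

lemma rleI:
  assumes x: "w \<Turnstile> is_real x" and y: "w \<Turnstile> is_real y"
    and le: "\<And>w' k. w \<le> w' \<Longrightarrow> of_type w' x Real \<Longrightarrow> of_type w' y Real \<Longrightarrow> of_type w' k Nat \<Longrightarrow>
      w' \<Turnstile> qle (x \<^bold>\<cdot> k) (qadd (y \<^bold>\<cdot> k) (e4 k))"
  shows "w \<Turnstile> rle x y"
  unfolding rle_def rnonneg_def
proof (rule f_allI)
  fix w' k assume w': "w \<le> w'" and k: "of_type w' k Nat"
  have xy: "of_type w' x Real" "of_type w' y Real" using x y w' is_real_typed of_type_mono by blast+
  have h: "of_type w' (hf k) Nat" using k by simp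
  have lim: "w' \<Turnstile> qle (x \<^bold>\<cdot> hf k) (qadd (y \<^bold>\<cdot> hf k) (unit_frac k))"
  proof (rule qle_limit)
    fix m assume m: "of_type w' m Nat"
    show "w' \<Turnstile> qle (x \<^bold>\<cdot> hf k) (qadd (qadd (y \<^bold>\<cdot> hf k) (unit_frac k)) (e5 m))"
      by (rule lin5[OF le[OF w' xy m] reg[OF x w' h m] reg[OF y w' m h] uf_half[OF k] uf_pos[OF m]])
        (use xy k m in \<open>auto simp: hom_def\<close>)
  qed (use xy k in auto)
  have "w' \<Turnstile> qle (quminus (unit_frac k)) (rminus y x \<^bold>\<cdot> k)"
    by (rule lin2[OF lim rminus_val[OF xy(2,1) k]]) (use xy k in \<open>auto simp: hom_def qminus_def\<close>)
  then show "w' \<Turnstile> subf (inst k) (qle (quminus (unit_frac (Var 0))) (wk 1 (rminus y x) \<^bold>\<cdot> Var 0))"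
    by simp
qed (use x y is_real_typed in auto)

lemma rle_trans:
  assumes "w \<Turnstile> rle x y" "w \<Turnstile> rle y z" "w \<Turnstile> is_real x" "w \<Turnstile> is_real y" "w \<Turnstile> is_real z"
  shows "w \<Turnstile> rle x z"
proof (rule rleI[OF assms(3,5)])
  fix w' k assume w': "w \<le> w'" "of_type w' x Real" "of_type w' z Real" and k: "of_type w' k Nat"
  have "of_type w' y Real" using assms(4) w' is_real_typed of_type_mono by blast
  with w' k show "w' \<Turnstile> qle (x \<^bold>\<cdot> k) (qadd (z \<^bold>\<cdot> k) (e4 k))"
    by (intro lin3[OF rleD[OF assms(1,3,4) w'(1) k] rleD[OF assms(2,4,5) w'(1) k] uf_pos[OF k]])
      (auto simp: hom_def)
qed

lemma rle_refl: "w \<Turnstile> is_real x \<Longrightarrow> w \<Turnstile> rle x x"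
  by (rule rleI, assumption, assumption, rule lin1[OF uf_pos]) (auto simp: hom_def)

text \<open>The approximation that witnesses \<open>x < y\<close> exceeds its own error bound by some \<open>1/(j + 1)\<close>, and
  this excess remains at every other index.\<close>

lemma rltD:
  assumes lt: "w \<Turnstile> rlt x y" and x: "w \<Turnstile> is_real x" and y: "w \<Turnstile> is_real y" and C: "wf_fm C (ctx w)"
    and step: "\<And>w' j. w \<le> w' \<Longrightarrow> of_type w' j Nat \<Longrightarrow>
      (\<And>w'' k. w' \<le> w'' \<Longrightarrow> of_type w'' k Nat \<Longrightarrow> w'' \<Turnstile> qle (qadd (x \<^bold>\<cdot> k) (unit_frac j)) (qadd (y \<^bold>\<cdot> k) (e1 k))) \<Longrightarrow>
      w' \<Turnstile> C"
  shows "w \<Turnstile> C"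
  using lt[unfolded rlt_def rpositive_def] C
proof (rule f_exE)
  fix w' i assume w': "w \<le> w'" and i: "of_type w' i Nat"
    and "w' \<Turnstile> subf (inst i) (qlt (unit_frac (Var 0)) (wk 1 (rminus y x) \<^bold>\<cdot> Var 0))"
  then have lt': "w' \<Turnstile> qlt (unit_frac i) (rminus y x \<^bold>\<cdot> i)" by simp
  have xy: "of_type w' x Real" "of_type w' y Real" using x y w' is_real_typed of_type_mono by blast+
  obtain j where j: "of_type w' j Nat" and gap: "w' \<Turnstile> qle (qadd (unit_frac i) (unit_frac j)) (rminus y x \<^bold>\<cdot> i)"
    by (rule that[OF _ qlt_gap[OF lt']]) (use xy i in simp)
  from w' j show "w' \<Turnstile> C"
  proof (rule step)
    fix w'' k assume w'': "w' \<le> w''" and k: "of_type w'' k Nat"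
    have t: "of_type w'' x Real" "of_type w'' y Real" "of_type w'' i Nat" "of_type w'' (hf i) Nat" "of_type w'' j Nat"
      using xy i j w'' of_type_mono by auto
    have le: "w \<le> w''" using w' w'' by (rule order_trans)
    show "w'' \<Turnstile> qle (qadd (x \<^bold>\<cdot> k) (unit_frac j)) (qadd (y \<^bold>\<cdot> k) (e1 k))"
      by (rule lin5[OF forces_mono[OF gap w''] rminus_val[OF t(2,1,3)] reg[OF x le k t(4)]
            reg[OF y le t(4) k] uf_half[OF t(3)]])
        (use t k in \<open>auto simp: hom_def qminus_def\<close>)
  qed
qed

text \<open>At the index \<open>i\<close> of a sixteenth of the accuracy of \<open>j\<close> the difference exceeds \<open>16/(i + 1) - 8/(i + 1)\<close>,
  which is more than the \<open>1/(i + 1)\<close> asked for.\<close>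

lemma rltI:
  assumes x: "w \<Turnstile> is_real x" and y: "w \<Turnstile> is_real y" and j: "of_type w j Nat"
    and le: "\<And>k. of_type w k Nat \<Longrightarrow> w \<Turnstile> qle (qadd (x \<^bold>\<cdot> k) (unit_frac j)) (qadd (y \<^bold>\<cdot> k) (e4 k))"
  shows "w \<Turnstile> rlt x y"
  unfolding rlt_def rpositive_def
proof (rule f_exI)
  let ?h1 = "hf j" let ?h2 = "hf ?h1" let ?h3 = "hf ?h2" let ?i = "hf ?h3"
  have h: "of_type w ?h1 Nat" "of_type w ?h2 Nat" "of_type w ?h3 Nat" and i: "of_type w ?i Nat" "of_type w (hf ?i) Nat"
    using j by auto
  have xy: "of_type w x Real" "of_type w y Real" using x y is_real_typed by blast+
  show "of_type w ?i Nat" by (rule i(1))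
  have "w \<Turnstile> qle (qadd (unit_frac ?i) (unit_frac ?i)) (rminus y x \<^bold>\<cdot> ?i)"
    by (rule lin8[OF le[OF i(2)] rminus_val[OF xy(2,1) i(1)] uf_half[OF j] uf_half[OF h(1)] uf_half[OF h(2)]
          uf_half[OF h(3)] uf_half[OF i(1)] uf_pos[OF i(1)]]) (use xy j in \<open>auto simp: hom_def qminus_def\<close>)
  then show "w \<Turnstile> subf (inst ?i) (qlt (unit_frac (Var 0)) (wk 1 (rminus y x) \<^bold>\<cdot> Var 0))"
    by (simp add: qlt_intro)
qed (use x y is_real_typed in auto)

lemma f_conjI: "w \<Turnstile> A \<Longrightarrow> w \<Turnstile> B \<Longrightarrow> w \<Turnstile> A \<^bold>\<and> B"
  by (simp add: f_conj_iff)

text \<open>The distance \<open>\<bar>a - b\<bar>\<close> is computed at index \<open>hf k\<close>; passing to index \<open>k\<close> costs a regularity error.\<close>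

lemma rabs_rminus_val:
  assumes a: "w \<Turnstile> is_real a" and b: "w \<Turnstile> is_real b" and w': "w \<le> w'" and k: "of_type w' k Nat"
  shows "w' \<Turnstile> qle (rabs (rminus a b) \<^bold>\<cdot> k) (qadd (qabs (qminus (a \<^bold>\<cdot> k) (b \<^bold>\<cdot> k))) (e2 k)) \<^bold>\<and>
    qle (qabs (qminus (a \<^bold>\<cdot> k) (b \<^bold>\<cdot> k))) (qadd (rabs (rminus a b) \<^bold>\<cdot> k) (e2 k))"
proof -
  have ab: "of_type w' a Real" "of_type w' b Real" using a b w' is_real_typed of_type_mono by blast+
  then have t: "of_type w' a Real" "of_type w' b Real" "of_type w' (rminus a b) Real" by simp_all
  have h: "of_type w' (hf k) Nat" using k by simp
  have abs: "w' \<Turnstile> abs_spec (rminus a b \<^bold>\<cdot> k) \<^bold>\<and> abs_spec (qminus (a \<^bold>\<cdot> k) (b \<^bold>\<cdot> k))"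
    using t k by (intro f_conjI abs_spec) auto
  have val: "w' \<Turnstile> Qeq (rabs (rminus a b) \<^bold>\<cdot> k) (qabs (rminus a b \<^bold>\<cdot> k)) \<^bold>\<and>
      Qeq (rminus a b \<^bold>\<cdot> k) (qminus (a \<^bold>\<cdot> hf k) (b \<^bold>\<cdot> hf k))"
    using rabs_val[OF t(3) k] rminus_val[OF t(1,2) k] by (rule f_conjI)
  note facts = abs val reg[OF a w' h k] reg[OF a w' k h] reg[OF b w' h k] reg[OF b w' k h] uf_half[OF k] uf_pos[OF k]
  show ?thesis
  proof (rule f_conjI)
    show "w' \<Turnstile> qle (rabs (rminus a b) \<^bold>\<cdot> k) (qadd (qabs (qminus (a \<^bold>\<cdot> k) (b \<^bold>\<cdot> k))) (e2 k))"
      by (rule lin8[OF facts]) (use t k in \<open>auto simp: hom_def qminus_def\<close>)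
    show "w' \<Turnstile> qle (qabs (qminus (a \<^bold>\<cdot> k) (b \<^bold>\<cdot> k))) (qadd (rabs (rminus a b) \<^bold>\<cdot> k) (e2 k))"
      by (rule lin8[OF facts]) (use t k in \<open>auto simp: hom_def qminus_def\<close>)
  qed
qed

lemma dist_geD:
  assumes le: "w \<Turnstile> rle d (rabs (rminus a b))" and d: "w \<Turnstile> is_real d" and a: "w \<Turnstile> is_real a" and b: "w \<Turnstile> is_real b"
    and w': "w \<le> w'" and k: "of_type w' k Nat"
  shows "w' \<Turnstile> qle (d \<^bold>\<cdot> k) (qadd (qabs (qminus (a \<^bold>\<cdot> k) (b \<^bold>\<cdot> k))) (e3 k))"
proof -
  have t: "of_type w' d Real" "of_type w' a Real" "of_type w' b Real"
    using d a b w' is_real_typed of_type_mono by blast+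
  show ?thesis
    by (rule lin3[OF rleD[OF le d is_real_rabs[OF is_real_rminus[OF a b]] w' k] rabs_rminus_val[OF a b w' k] uf_pos[OF k]])
      (use t k in \<open>auto simp: hom_def\<close>)
qed

lemma dist_leD:
  assumes le: "w \<Turnstile> rle (rabs (rminus a b)) d" and d: "w \<Turnstile> is_real d" and a: "w \<Turnstile> is_real a" and b: "w \<Turnstile> is_real b"
    and w': "w \<le> w'" and k: "of_type w' k Nat"
  shows "w' \<Turnstile> qle (qabs (qminus (a \<^bold>\<cdot> k) (b \<^bold>\<cdot> k))) (qadd (d \<^bold>\<cdot> k) (e3 k))"
proof -
  have t: "of_type w' d Real" "of_type w' a Real" "of_type w' b Real"
    using d a b w' is_real_typed of_type_mono by blast+
  show ?thesis
    by (rule lin3[OF rleD[OF le is_real_rabs[OF is_real_rminus[OF a b]] d w' k] rabs_rminus_val[OF a b w' k] uf_pos[OF k]])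
      (use t k in \<open>auto simp: hom_def\<close>)
qed

lemma dist_geI:
  assumes d: "w \<Turnstile> is_real d" and a: "w \<Turnstile> is_real a" and b: "w \<Turnstile> is_real b"
    and le: "\<And>w' k. w \<le> w' \<Longrightarrow> of_type w' k Nat \<Longrightarrow>
      w' \<Turnstile> qle (d \<^bold>\<cdot> k) (qadd (qabs (qminus (a \<^bold>\<cdot> k) (b \<^bold>\<cdot> k))) (qadd (e3 k) (e2 k)))"
  shows "w \<Turnstile> rle d (rabs (rminus a b))"
proof (rule rleI[OF d is_real_rabs[OF is_real_rminus[OF a b]]])
  fix w' k assume w': "w \<le> w'" and "of_type w' d Real" "of_type w' (rabs (rminus a b)) Real" and k: "of_type w' k Nat"
  then show "w' \<Turnstile> qle (d \<^bold>\<cdot> k) (qadd (rabs (rminus a b) \<^bold>\<cdot> k) (e4 k))"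
    by (intro lin2[OF le[OF w' k] rabs_rminus_val[OF a b w' k]]) (auto simp: hom_def)
qed

lemma dist_leI:
  assumes d: "w \<Turnstile> is_real d" and a: "w \<Turnstile> is_real a" and b: "w \<Turnstile> is_real b"
    and le: "\<And>w' k. w \<le> w' \<Longrightarrow> of_type w' k Nat \<Longrightarrow>
      w' \<Turnstile> qle (qabs (qminus (a \<^bold>\<cdot> k) (b \<^bold>\<cdot> k))) (qadd (d \<^bold>\<cdot> k) (qadd (e3 k) (e2 k)))"
  shows "w \<Turnstile> rle (rabs (rminus a b)) d"
proof (rule rleI[OF is_real_rabs[OF is_real_rminus[OF a b]] d])
  fix w' k assume w': "w \<le> w'" and "of_type w' d Real" "of_type w' (rabs (rminus a b)) Real" and k: "of_type w' k Nat"
  then show "w' \<Turnstile> qle (rabs (rminus a b) \<^bold>\<cdot> k) (qadd (d \<^bold>\<cdot> k) (e4 k))"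
    by (intro lin2[OF le[OF w' k] rabs_rminus_val[OF a b w' k]]) (auto simp: hom_def)
qed

text \<open>The minimum of two real numbers exists by countable choice, since the order of the rationals is decidable.\<close>

definition min_spec :: "tm \<Rightarrow> tm \<Rightarrow> tm \<Rightarrow> fm" where
  "min_spec m a b = ((qle a b \<^bold>\<and> Qeq m a) \<^bold>\<or> (qle b a \<^bold>\<and> Qeq m b))"

lemma min_spec_simps [simp]:
  "hold v (min_spec m a b) \<longleftrightarrow> v a \<le> v b \<and> v m = v a \<or> v b \<le> v a \<and> v m = v b"
  "subf s (min_spec m a b) = min_spec (sub s m) (sub s a) (sub s b)"
  "wf_fm (min_spec m a b) \<Delta> \<longleftrightarrow> has_type m \<Delta> Rat \<and> has_type a \<Delta> Rat \<and> has_type b \<Delta> Rat"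
  by (auto simp: min_spec_def)

lemma real_min:
  assumes a: "w \<Turnstile> is_real a" and b: "w \<Turnstile> is_real b" and C: "wf_fm C (ctx w)"
    and step: "\<And>w' m. w \<le> w' \<Longrightarrow> w' \<Turnstile> is_real m \<Longrightarrow>
      (\<And>w'' k. w' \<le> w'' \<Longrightarrow> of_type w'' k Nat \<Longrightarrow> w'' \<Turnstile> min_spec (m \<^bold>\<cdot> k) (a \<^bold>\<cdot> k) (b \<^bold>\<cdot> k)) \<Longrightarrow> w' \<Turnstile> C"
  shows "w \<Turnstile> C"
proof (rule f_choice[where \<sigma> = Rat and A = "min_spec (Var 0) (wk 2 a \<^bold>\<cdot> Var 1) (wk 2 b \<^bold>\<cdot> Var 1)"])
  have ab: "of_type w a Real" "of_type w b Real" using a b is_real_typed by auto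
  then show "wf_fm (min_spec (Var 0) (wk 2 a \<^bold>\<cdot> Var 1) (wk 2 b \<^bold>\<cdot> Var 1)) (Rat # Nat # ctx w)" by simp
  show "wf_fm C (ctx w)" by (rule C)
  fix w' n assume w': "w \<le> w'" and n: "of_type w' n Nat"
  have t: "of_type w' (a \<^bold>\<cdot> n) Rat" "of_type w' (b \<^bold>\<cdot> n) Rat" using of_type_mono[OF ab(1) w'] of_type_mono[OF ab(2) w'] n by auto
  have refl: "w'' \<Turnstile> Qeq q q" if "of_type w'' q Rat" for q w''
    using qeq_refl[OF that] by (simp add: qeq_def f_conj_iff)
  have "w' \<Turnstile> Ex Rat (min_spec (Var 0) (ren Suc (a \<^bold>\<cdot> n)) (ren Suc (b \<^bold>\<cdot> n)))"
  proof (rule f_orE[OF qle_total[OF t]])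
    fix w'' assume w'': "w' \<le> w''" and le: "w'' \<Turnstile> qle (a \<^bold>\<cdot> n) (b \<^bold>\<cdot> n)"
    have t': "of_type w'' (a \<^bold>\<cdot> n) Rat" "of_type w'' (b \<^bold>\<cdot> n) Rat" using t w'' of_type_mono by auto
    have "w'' \<Turnstile> min_spec (a \<^bold>\<cdot> n) (a \<^bold>\<cdot> n) (b \<^bold>\<cdot> n)"
      unfolding min_spec_def by (rule f_orI1) (use le refl[OF t'(1)] t' in \<open>auto simp: f_conj_iff\<close>)
    then show "w'' \<Turnstile> Ex Rat (min_spec (Var 0) (ren Suc (a \<^bold>\<cdot> n)) (ren Suc (b \<^bold>\<cdot> n)))"
      using t' by (intro f_exI[where t = "a \<^bold>\<cdot> n"]) (auto simp del: ren.simps)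
  next
    fix w'' assume w'': "w' \<le> w''" and le: "w'' \<Turnstile> qle (b \<^bold>\<cdot> n) (a \<^bold>\<cdot> n)"
    have t': "of_type w'' (a \<^bold>\<cdot> n) Rat" "of_type w'' (b \<^bold>\<cdot> n) Rat" using t w'' of_type_mono by auto
    have "w'' \<Turnstile> min_spec (b \<^bold>\<cdot> n) (a \<^bold>\<cdot> n) (b \<^bold>\<cdot> n)"
      unfolding min_spec_def by (rule f_orI2) (use le refl[OF t'(2)] t' in \<open>auto simp: f_conj_iff\<close>)
    then show "w'' \<Turnstile> Ex Rat (min_spec (Var 0) (ren Suc (a \<^bold>\<cdot> n)) (ren Suc (b \<^bold>\<cdot> n)))"
      using t' by (intro f_exI[where t = "b \<^bold>\<cdot> n"]) (auto simp del: ren.simps)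
  qed
  then show "w' \<Turnstile> Ex Rat (subf (up_sub (inst n)) (min_spec (Var 0) (wk 2 a \<^bold>\<cdot> Var 1) (wk 2 b \<^bold>\<cdot> Var 1)))"
    by simp
next
  fix w' m assume w': "w \<le> w'" and m: "of_type w' m (Nat \<^bold>\<Rightarrow> Rat)"
    and "\<And>w'' n. w' \<le> w'' \<Longrightarrow> of_type w'' n Nat \<Longrightarrow>
      w'' \<Turnstile> subf (case_nat (m \<^bold>\<cdot> n) (case_nat n Var)) (min_spec (Var 0) (wk 2 a \<^bold>\<cdot> Var 1) (wk 2 b \<^bold>\<cdot> Var 1))"
  then have spec: "\<And>w'' n. w' \<le> w'' \<Longrightarrow> of_type w'' n Nat \<Longrightarrow> w'' \<Turnstile> min_spec (m \<^bold>\<cdot> n) (a \<^bold>\<cdot> n) (b \<^bold>\<cdot> n)" by simp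
  have "w' \<Turnstile> is_real m"
  proof (rule is_realI[OF m])
    fix w'' i j assume w'': "w' \<le> w''" and t: "of_type w'' m Real" "of_type w'' i Nat" "of_type w'' j Nat"
    have le: "w \<le> w''" using w' w'' by (rule order_trans)
    show "w'' \<Turnstile> qle (m \<^bold>\<cdot> i) (qadd (m \<^bold>\<cdot> j) (qadd (unit_frac i) (unit_frac j)))"
      by (rule lin4[OF spec[OF w'' t(2)] spec[OF w'' t(3)] reg[OF a le t(2,3)] reg[OF b le t(2,3)]])
        (use t in \<open>auto simp: hom_def\<close>)
  qed
  from step[OF w' this spec] show "w' \<Turnstile> C" .
qed

section \<open>Sequences of real numbers\<close>

lemma is_real_typed_mono: "w \<Turnstile> is_real x \<Longrightarrow> w \<le> w' \<Longrightarrow> of_type w' x Real"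
  using is_real_typed of_type_mono by blast

lemma seq_wf [simp]:
  "has_type x \<Delta> (Nat \<^bold>\<Rightarrow> Real) \<Longrightarrow> wf_fm (decreasing x) \<Delta>"
  "has_type x \<Delta> (Nat \<^bold>\<Rightarrow> Real) \<Longrightarrow> wf_fm (nonneg_seq x) \<Delta>"
  "has_type x \<Delta> (Nat \<^bold>\<Rightarrow> Real) \<Longrightarrow> has_type y \<Delta> Real \<Longrightarrow> wf_fm (converges x y) \<Delta>"
  "has_type x \<Delta> (Nat \<^bold>\<Rightarrow> Real) \<Longrightarrow> has_type y \<Delta> Real \<Longrightarrow> wf_fm (bounded_away x y) \<Delta>"
  "has_type x \<Delta> (Nat \<^bold>\<Rightarrow> Real) \<Longrightarrow> wf_fm (apparently_convergent x) \<Delta>"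
  "has_type x \<Delta> (Nat \<^bold>\<Rightarrow> Real) \<Longrightarrow> wf_fm (unif_bounded_away_unit x) \<Delta>"
  "has_type y \<Delta> Real \<Longrightarrow> wf_fm (in_unit_interval y) \<Delta>"
  by (simp_all add: decreasing_def nonneg_seq_def converges_def bounded_away_def in_unit_interval_def
      apparently_convergent_def unif_bounded_away_unit_def AllR_def ExR_def)

lemma subf_seq [simp]:
  "subf s (decreasing x) = decreasing (sub s x)"
  "subf s (nonneg_seq x) = nonneg_seq (sub s x)"
  "subf s (converges x y) = converges (sub s x) (sub s y)"
  "subf s (bounded_away x y) = bounded_away (sub s x) (sub s y)"
  "subf s (apparently_convergent x) = apparently_convergent (sub s x)"
  "subf s (unif_bounded_away_unit x) = unif_bounded_away_unit (sub s x)"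
  "subf s (in_unit_interval x) = in_unit_interval (sub s x)"
  by (simp_all add: decreasing_def nonneg_seq_def converges_def bounded_away_def in_unit_interval_def
      apparently_convergent_def unif_bounded_away_unit_def AllR_def ExR_def)
    (simp_all add: numeral_2_eq_2 numeral_3_eq_3)

lemma seq_typed: "w \<Turnstile> is_real_seq x \<Longrightarrow> w \<le> w' \<Longrightarrow> of_type w' x (Nat \<^bold>\<Rightarrow> Real)"
  using forces_wf of_type_mono by fastforce

lemma seqD: "w \<Turnstile> is_real_seq x \<Longrightarrow> w \<le> w' \<Longrightarrow> of_type w' n Nat \<Longrightarrow> w' \<Turnstile> is_real (x \<^bold>\<cdot> n)"
  using f_allE[of w Nat "is_real (ren Suc x \<^bold>\<cdot> Var 0)" w' n] by (simp add: is_real_seq_def)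

lemma nonnegD: "w \<Turnstile> nonneg_seq x \<Longrightarrow> w \<le> w' \<Longrightarrow> of_type w' n Nat \<Longrightarrow> w' \<Turnstile> rle rzero (x \<^bold>\<cdot> n)"
  using f_allE[of w Nat "rle rzero (ren Suc x \<^bold>\<cdot> Var 0)" w' n] by (simp add: nonneg_seq_def)

lemma decreasingD: "w \<Turnstile> decreasing x \<Longrightarrow> w \<le> w' \<Longrightarrow> of_type w' n Nat \<Longrightarrow> w' \<Turnstile> rle (x \<^bold>\<cdot> Succ n) (x \<^bold>\<cdot> n)"
  using f_allE[of w Nat "rle (ren Suc x \<^bold>\<cdot> Succ (Var 0)) (ren Suc x \<^bold>\<cdot> Var 0)" w' n]
  by (simp add: decreasing_def)

lemma rle_index_cong:
  assumes "w \<Turnstile> i \<^bold>= j" "of_type w i Nat" "of_type w x (Nat \<^bold>\<Rightarrow> Real)" "w \<Turnstile> rle (x \<^bold>\<cdot> i) y"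
  shows "w \<Turnstile> rle (x \<^bold>\<cdot> j) y"
proof -
  have "of_type w y Real" using forces_wf[OF assms(4)] by simp
  then show ?thesis using f_subst[OF assms(1,2), of "rle (ren Suc x \<^bold>\<cdot> Var 0) (ren Suc y)"] assms(3,4) by simp
qed

text \<open>By induction on the difference of the indices.\<close>

lemma decreasing_le:
  assumes x: "w \<Turnstile> is_real_seq x" and dec: "w \<Turnstile> decreasing x" and le: "w \<Turnstile> nle m n"
  shows "w \<Turnstile> rle (x \<^bold>\<cdot> n) (x \<^bold>\<cdot> m)"
proof -
  have t: "of_type w x (Nat \<^bold>\<Rightarrow> Real)" "of_type w m Nat" "of_type w n Nat"
    using seq_typed[OF x order_refl] forces_wf[OF le] by auto
  show ?thesis
  proof (rule nleE[OF le])
    fix w' c assume w': "w \<le> w'" and c: "of_type w' c Nat" and m: "of_type w' m Nat" and n: "w' \<Turnstile> add m c \<^bold>= n"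
    have x': "of_type w' x (Nat \<^bold>\<Rightarrow> Real)" by (rule seq_typed[OF x w'])
    let ?A = "rle (ren Suc x \<^bold>\<cdot> add (ren Suc m) (Var 0)) (ren Suc x \<^bold>\<cdot> ren Suc m)"
    have "w' \<Turnstile> subf (inst c) ?A"
    proof (rule f_nat_induct[OF _ _ _ order_refl c])
      have "w' \<Turnstile> rle (x \<^bold>\<cdot> add m Zero) (x \<^bold>\<cdot> m)"
        using rle_refl[OF seqD[OF x w' m]] m x' by (intro rle_index_cong[OF f_sym[OF add_Zero]])
      then show "w' \<Turnstile> subf (inst Zero) ?A" by simp
    next
      fix w'' i assume w'': "w' \<le> w''" and i: "of_type w'' i Nat" and "w'' \<Turnstile> subf (inst i) ?A"
      then have IH: "w'' \<Turnstile> rle (x \<^bold>\<cdot> add m i) (x \<^bold>\<cdot> m)" by simp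
      have le': "w \<le> w''" using w' w'' by (rule order_trans)
      have m': "of_type w'' m Nat" using m w'' by (rule of_type_mono)
      have "w'' \<Turnstile> rle (x \<^bold>\<cdot> Succ (add m i)) (x \<^bold>\<cdot> add m i)" using m' i by (intro decreasingD[OF dec le']) simp
      then have "w'' \<Turnstile> rle (x \<^bold>\<cdot> Succ (add m i)) (x \<^bold>\<cdot> m)"
        using IH by (rule rle_trans) (use m' i in \<open>auto intro: seqD[OF x le']\<close>)
      then have "w'' \<Turnstile> rle (x \<^bold>\<cdot> add m (Succ i)) (x \<^bold>\<cdot> m)"
        using m' i seq_typed[OF x le'] by (intro rle_index_cong[OF f_sym[OF add_Succ]]) simp_all
      then show "w'' \<Turnstile> subf (inst (Succ i)) ?A" by simp
    qed (use x' m in simp)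
    then have "w' \<Turnstile> rle (x \<^bold>\<cdot> add m c) (x \<^bold>\<cdot> m)" by simp
    then show "w' \<Turnstile> rle (x \<^bold>\<cdot> n) (x \<^bold>\<cdot> m)" using n m c x' by (intro rle_index_cong[OF n]) simp_all
  qed (use t in simp)
qed

lemma eventuallyE:
  assumes ev: "w \<Turnstile> Ex Nat (All Nat (nle (Var 1) (Var 0) \<^bold>\<longrightarrow> B))" and C: "wf_fm C (ctx w)"
    and step: "\<And>w' N. w \<le> w' \<Longrightarrow> of_type w' N Nat \<Longrightarrow>
      (\<And>w'' n. w' \<le> w'' \<Longrightarrow> of_type w'' n Nat \<Longrightarrow> w'' \<Turnstile> nle N n \<Longrightarrow> w'' \<Turnstile> subf (case_nat n (case_nat N Var)) B) \<Longrightarrow>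
      w' \<Turnstile> C"
  shows "w \<Turnstile> C"
  using ev C
proof (rule f_exE)
  fix w' N assume w': "w \<le> w'" and N: "of_type w' N Nat"
    and all: "w' \<Turnstile> subf (inst N) (All Nat (nle (Var 1) (Var 0) \<^bold>\<longrightarrow> B))"
  from w' N show "w' \<Turnstile> C"
  proof (rule step)
    fix w'' n assume w'': "w' \<le> w''" and n: "of_type w'' n Nat" and le: "w'' \<Turnstile> nle N n"
    have "sub (inst n) \<circ> up_sub (inst N) = case_nat n (case_nat N Var)"
      by (rule ext) (simp add: up_sub_def split: nat.split)
    then have B: "subf (inst n) (subf (up_sub (inst N)) B) = subf (case_nat n (case_nat N Var)) B"
      by (simp add: subf_subf)
    have "w'' \<Turnstile> nle N n \<^bold>\<longrightarrow> subf (case_nat n (case_nat N Var)) B"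
      using f_allE[OF all[unfolded subf.simps] w'' n] B by simp
    then show "w'' \<Turnstile> subf (case_nat n (case_nat N Var)) B" by (rule f_impE[OF _ order_refl le])
  qed
qed

lemma eventuallyI:
  assumes wf: "wf_fm B (Nat # Nat # ctx w)" and N: "of_type w N Nat"
    and step: "\<And>w' n. w \<le> w' \<Longrightarrow> of_type w' n Nat \<Longrightarrow> w' \<Turnstile> nle N n \<Longrightarrow> w' \<Turnstile> subf (case_nat n (case_nat N Var)) B"
  shows "w \<Turnstile> Ex Nat (All Nat (nle (Var 1) (Var 0) \<^bold>\<longrightarrow> B))"
proof (rule f_exI[OF _ N])
  show "wf_fm (All Nat (nle (Var 1) (Var 0) \<^bold>\<longrightarrow> B)) (Nat # ctx w)" using wf by simp
  have typed: "sub_typed (up_sub (inst N)) (Nat # Nat # ctx w) (Nat # ctx w)"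
    using N by (intro sub_typed_up sub_typed_inst)
  have "w \<Turnstile> All Nat (nle (ren Suc N) (Var 0) \<^bold>\<longrightarrow> subf (up_sub (inst N)) B)"
  proof (rule f_allI)
    show "wf_fm (nle (ren Suc N) (Var 0) \<^bold>\<longrightarrow> subf (up_sub (inst N)) B) (Nat # ctx w)"
      using N wf_fm_sub[OF wf typed] by simp
    fix w' n assume w': "w \<le> w'" and n: "of_type w' n Nat"
    have "sub (inst n) \<circ> up_sub (inst N) = case_nat n (case_nat N Var)"
      by (rule ext) (simp add: up_sub_def split: nat.split)
    then have B: "subf (inst n) (subf (up_sub (inst N)) B) = subf (case_nat n (case_nat N Var)) B"
      by (simp add: subf_subf)
    have "w' \<Turnstile> nle N n \<^bold>\<longrightarrow> subf (case_nat n (case_nat N Var)) B"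
      using of_type_mono[OF N w'] n by (intro f_impI) (auto intro!: step intro: order_trans[OF w'] of_type_mono)
    then show "w' \<Turnstile> subf (inst n) (nle (ren Suc N) (Var 0) \<^bold>\<longrightarrow> subf (up_sub (inst N)) B)" by (simp add: B)
  qed
  then show "w \<Turnstile> subf (inst N) (All Nat (nle (Var 1) (Var 0) \<^bold>\<longrightarrow> B))" by simp
qed

lemma bounded_awayE:
  assumes ba: "w \<Turnstile> bounded_away x y" and C: "wf_fm C (ctx w)"
    and step: "\<And>w' d N. w \<le> w' \<Longrightarrow> w' \<Turnstile> is_real d \<Longrightarrow> w' \<Turnstile> rlt rzero d \<Longrightarrow> of_type w' N Nat \<Longrightarrow>
      (\<And>w'' n. w' \<le> w'' \<Longrightarrow> of_type w'' n Nat \<Longrightarrow> w'' \<Turnstile> nle N n \<Longrightarrow> w'' \<Turnstile> rle d (rabs (rminus (x \<^bold>\<cdot> n) y))) \<Longrightarrow>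
      w' \<Turnstile> C"
  shows "w \<Turnstile> C"
  using ba[unfolded bounded_away_def ExR_def] C
proof (rule f_exE)
  fix w1 d assume w1: "w \<le> w1" and h: "w1 \<Turnstile> subf (inst d) (is_real (Var 0) \<^bold>\<and> rlt rzero (Var 0) \<^bold>\<and>
    Ex Nat (All Nat (nle (Var 1) (Var 0) \<^bold>\<longrightarrow> rle (Var 2) (rabs (rminus (wk 3 x \<^bold>\<cdot> Var 0) (wk 3 y))))))"
  then have d: "w1 \<Turnstile> is_real d" "w1 \<Turnstile> rlt rzero d" and ev: "w1 \<Turnstile> Ex Nat (All Nat (nle (Var 1) (Var 0) \<^bold>\<longrightarrow>
      rle (wk 2 d) (rabs (rminus (wk 2 x \<^bold>\<cdot> Var 0) (wk 2 y)))))"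
    by (simp_all add: f_conj_iff)
  from ev wf_fm_mono[OF C w1] show "w1 \<Turnstile> C"
  proof (rule eventuallyE)
    fix w2 N assume w2: "w1 \<le> w2" "of_type w2 N Nat"
      and "\<And>w'' n. w2 \<le> w'' \<Longrightarrow> of_type w'' n Nat \<Longrightarrow> w'' \<Turnstile> nle N n \<Longrightarrow>
        w'' \<Turnstile> subf (case_nat n (case_nat N Var)) (rle (wk 2 d) (rabs (rminus (wk 2 x \<^bold>\<cdot> Var 0) (wk 2 y))))"
    then show "w2 \<Turnstile> C" using d w1 w2 by (intro step[of w2 d N]) (auto intro: forces_mono order_trans)
  qed
qed

lemma bounded_awayI:
  assumes x: "of_type w x (Nat \<^bold>\<Rightarrow> Real)" and y: "of_type w y Real"
    and d: "w \<Turnstile> is_real d" "w \<Turnstile> rlt rzero d" and N: "of_type w N Nat"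
    and le: "\<And>w' n. w \<le> w' \<Longrightarrow> of_type w' n Nat \<Longrightarrow> w' \<Turnstile> nle N n \<Longrightarrow> w' \<Turnstile> rle d (rabs (rminus (x \<^bold>\<cdot> n) y))"
  shows "w \<Turnstile> bounded_away x y"
  unfolding bounded_away_def ExR_def
proof (rule f_exI)
  have td: "of_type w d Real" using d is_real_typed by auto
  then show "of_type w d Real" .
  show "wf_fm (is_real (Var 0) \<^bold>\<and> rlt rzero (Var 0) \<^bold>\<and> Ex Nat (All Nat (nle (Var 1) (Var 0) \<^bold>\<longrightarrow>
    rle (Var 2) (rabs (rminus (wk 3 x \<^bold>\<cdot> Var 0) (wk 3 y)))))) (Real # ctx w)" using x y by simp
  have "w \<Turnstile> Ex Nat (All Nat (nle (Var 1) (Var 0) \<^bold>\<longrightarrow> rle (wk 2 d) (rabs (rminus (wk 2 x \<^bold>\<cdot> Var 0) (wk 2 y)))))"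
    by (rule eventuallyI[OF _ N]) (use x y td le in simp_all)
  then show "w \<Turnstile> subf (inst d) (is_real (Var 0) \<^bold>\<and> rlt rzero (Var 0) \<^bold>\<and> Ex Nat (All Nat (nle (Var 1) (Var 0) \<^bold>\<longrightarrow>
    rle (Var 2) (rabs (rminus (wk 3 x \<^bold>\<cdot> Var 0) (wk 3 y))))))"
    using d by (simp add: f_conj_iff)
qed

lemma unif_bounded_awayE:
  assumes ba: "w \<Turnstile> unif_bounded_away_unit x" and C: "wf_fm C (ctx w)"
    and step: "\<And>w' d N. w \<le> w' \<Longrightarrow> w' \<Turnstile> is_real d \<Longrightarrow> w' \<Turnstile> rlt rzero d \<Longrightarrow> of_type w' N Nat \<Longrightarrow>
      (\<And>w'' n y. w' \<le> w'' \<Longrightarrow> of_type w'' n Nat \<Longrightarrow> w'' \<Turnstile> nle N n \<Longrightarrow> w'' \<Turnstile> is_real y \<Longrightarrow>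
        w'' \<Turnstile> in_unit_interval y \<Longrightarrow> w'' \<Turnstile> rle d (rabs (rminus (x \<^bold>\<cdot> n) y))) \<Longrightarrow>
      w' \<Turnstile> C"
  shows "w \<Turnstile> C"
  using ba[unfolded unif_bounded_away_unit_def ExR_def AllR_def] C
proof (rule f_exE)
  fix w1 d assume w1: "w \<le> w1" and h: "w1 \<Turnstile> subf (inst d) (is_real (Var 0) \<^bold>\<and> rlt rzero (Var 0) \<^bold>\<and>
    Ex Nat (All Nat (nle (Var 1) (Var 0) \<^bold>\<longrightarrow> All Real (is_real (Var 0) \<^bold>\<longrightarrow> in_unit_interval (Var 0) \<^bold>\<longrightarrow>
      rle (Var 3) (rabs (rminus (wk 4 x \<^bold>\<cdot> Var 1) (Var 0)))))))"
  let ?B = "All Real (is_real (Var 0) \<^bold>\<longrightarrow> in_unit_interval (Var 0) \<^bold>\<longrightarrow> rle (wk 3 d) (rabs (rminus (wk 3 x \<^bold>\<cdot> Var 1) (Var 0))))"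
  from h have d: "w1 \<Turnstile> is_real d" "w1 \<Turnstile> rlt rzero d" and ev: "w1 \<Turnstile> Ex Nat (All Nat (nle (Var 1) (Var 0) \<^bold>\<longrightarrow> ?B))"
    by (simp_all add: f_conj_iff)
  from ev wf_fm_mono[OF C w1] show "w1 \<Turnstile> C"
  proof (rule eventuallyE)
    fix w2 N assume w2: "w1 \<le> w2" and N: "of_type w2 N Nat"
      and all: "\<And>w'' n. w2 \<le> w'' \<Longrightarrow> of_type w'' n Nat \<Longrightarrow> w'' \<Turnstile> nle N n \<Longrightarrow> w'' \<Turnstile> subf (case_nat n (case_nat N Var)) ?B"
    show "w2 \<Turnstile> C"
    proof (rule step)
      show "w \<le> w2" using w1 w2 by (rule order_trans)
      show "w2 \<Turnstile> is_real d" "w2 \<Turnstile> rlt rzero d" using d w2 by (auto intro: forces_mono)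
      show "of_type w2 N Nat" by (rule N)
      fix w3 n y assume w3: "w2 \<le> w3" and n: "of_type w3 n Nat" "w3 \<Turnstile> nle N n"
        and y: "w3 \<Turnstile> is_real y" "w3 \<Turnstile> in_unit_interval y"
      have "w3 \<Turnstile> All Real (is_real (Var 0) \<^bold>\<longrightarrow> in_unit_interval (Var 0) \<^bold>\<longrightarrow>
          rle (ren Suc d) (rabs (rminus (ren Suc x \<^bold>\<cdot> ren Suc n) (Var 0))))"
        using all[OF w3 n] by simp
      from f_allE[OF this order_refl is_real_typed[OF y(1)]]
      have "w3 \<Turnstile> is_real y \<^bold>\<longrightarrow> in_unit_interval y \<^bold>\<longrightarrow> rle d (rabs (rminus (x \<^bold>\<cdot> n) y))" by simp
      from f_impE[OF f_impE[OF this order_refl y(1)] order_refl y(2)]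
      show "w3 \<Turnstile> rle d (rabs (rminus (x \<^bold>\<cdot> n) y))" .
    qed
  qed
qed

section \<open>Convergent sequences are apparently convergent\<close>

lemma rzero_val: "of_type w k Nat \<Longrightarrow> w \<Turnstile> Qeq (rzero \<^bold>\<cdot> k) qzero"
  by (rule real_of_val) simp

lemma is_real_rzero: "w \<Turnstile> is_real rzero"
  by (rule is_real_real_of) simp

text \<open>If \<open>y \<ge> 1/(j + 1)\<close>, then eventually \<open>x\<^sub>n\<close> is at most half that number, and the other half
  separates \<open>x\<^sub>n\<close> from \<open>y\<close>.\<close>

lemma converges_bounded_away:
  assumes x: "w \<Turnstile> is_real_seq x" and conv: "w \<Turnstile> converges x rzero"
    and y: "w \<Turnstile> is_real y" and pos: "w \<Turnstile> rlt rzero y"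
  shows "w \<Turnstile> bounded_away x y"
proof (rule rltD[OF pos is_real_rzero y])
  show "wf_fm (bounded_away x y) (ctx w)" using seq_typed[OF x order_refl] is_real_typed[OF y] by simp
next
  fix w1 j assume w1: "w \<le> w1" and j: "of_type w1 j Nat"
    and lb: "\<And>w'' k. w1 \<le> w'' \<Longrightarrow> of_type w'' k Nat \<Longrightarrow>
      w'' \<Turnstile> qle (qadd (rzero \<^bold>\<cdot> k) (unit_frac j)) (qadd (y \<^bold>\<cdot> k) (e1 k))"
  let ?h = "hf j" let ?d = "real_of (unit_frac ?h)"
  have h: "of_type w1 ?h Nat" using j by simp
  have "w1 \<Turnstile> Ex Nat (All Nat (nle (Var 1) (Var 0) \<^bold>\<longrightarrow>
      rle (rabs (rminus (wk 2 x \<^bold>\<cdot> Var 0) (wk 2 rzero))) (real_of (unit_frac (wk 2 ?h)))))"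
    using f_allE[OF conv[unfolded converges_def] w1 h] by simp
  then show "w1 \<Turnstile> bounded_away x y"
  proof (rule eventuallyE)
    show "wf_fm (bounded_away x y) (ctx w1)" using seq_typed[OF x w1] is_real_typed_mono[OF y w1] by simp
  next
    fix w2 N assume w2: "w1 \<le> w2" and N: "of_type w2 N Nat"
      and ev: "\<And>w'' n. w2 \<le> w'' \<Longrightarrow> of_type w'' n Nat \<Longrightarrow> w'' \<Turnstile> nle N n \<Longrightarrow>
        w'' \<Turnstile> subf (case_nat n (case_nat N Var)) (rle (rabs (rminus (wk 2 x \<^bold>\<cdot> Var 0) (wk 2 rzero)))
          (real_of (unit_frac (wk 2 ?h))))"
    have le2: "w \<le> w2" using w1 w2 by (rule order_trans)
    have h2: "of_type w2 j Nat" "of_type w2 ?h Nat" "of_type w2 (unit_frac ?h) Rat"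
      using j w2 of_type_mono by auto
    show "w2 \<Turnstile> bounded_away x y"
    proof (rule bounded_awayI)
      show "of_type w2 x (Nat \<^bold>\<Rightarrow> Real)" by (rule seq_typed[OF x le2])
      show "of_type w2 y Real" by (rule is_real_typed_mono[OF y le2])
      show "w2 \<Turnstile> is_real ?d" by (rule is_real_real_of[OF h2(3)])
      show "w2 \<Turnstile> rlt rzero ?d"
      proof (rule rltI[OF is_real_rzero is_real_real_of[OF h2(3)] h2(2)])
        fix k assume k: "of_type w2 k Nat"
        show "w2 \<Turnstile> qle (qadd (rzero \<^bold>\<cdot> k) (unit_frac ?h)) (qadd (?d \<^bold>\<cdot> k) (e4 k))"
          by (rule lin3[OF rzero_val[OF k] real_of_val[OF h2(3) k] uf_pos[OF k]])
            (use k h2 in \<open>auto simp: hom_def\<close>)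
      qed
      show "of_type w2 N Nat" by (rule N)
      fix w3 n assume w3: "w2 \<le> w3" and n: "of_type w3 n Nat" "w3 \<Turnstile> nle N n"
      have le3: "w \<le> w3" "w1 \<le> w3" using le2 w2 w3 by (auto intro: order_trans)
      have h3: "of_type w3 j Nat" "of_type w3 ?h Nat" "of_type w3 (unit_frac ?h) Rat"
        using h2 w3 of_type_mono by auto
      have xn: "w3 \<Turnstile> is_real (x \<^bold>\<cdot> n)" by (rule seqD[OF x le3(1) n(1)])
      have y3: "w3 \<Turnstile> is_real y" using y le3(1) by (rule forces_mono)
      have le: "w3 \<Turnstile> rle (rabs (rminus (x \<^bold>\<cdot> n) rzero)) ?d" using ev[OF w3 n] by simp
      show "w3 \<Turnstile> rle ?d (rabs (rminus (x \<^bold>\<cdot> n) y))"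
      proof (rule dist_geI[OF is_real_real_of[OF h3(3)] xn y3])
        fix w4 k assume w4: "w3 \<le> w4" and k: "of_type w4 k Nat"
        have le4: "w1 \<le> w4" using le3(2) w4 by (rule order_trans)
        have h4: "of_type w4 j Nat" "of_type w4 (unit_frac ?h) Rat" using h3 w4 of_type_mono by auto
        have t: "of_type w4 (x \<^bold>\<cdot> n) Real" "of_type w4 y Real"
          using is_real_typed_mono[OF xn w4] is_real_typed_mono[OF y3 w4] .
        have abs: "w4 \<Turnstile> abs_spec (qminus (x \<^bold>\<cdot> n \<^bold>\<cdot> k) (rzero \<^bold>\<cdot> k)) \<^bold>\<and> abs_spec (qminus (x \<^bold>\<cdot> n \<^bold>\<cdot> k) (y \<^bold>\<cdot> k))"
          using t k by (intro f_conjI abs_spec) simp_all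
        show "w4 \<Turnstile> qle (?d \<^bold>\<cdot> k) (qadd (qabs (qminus (x \<^bold>\<cdot> n \<^bold>\<cdot> k) (y \<^bold>\<cdot> k))) (qadd (e3 k) (e2 k)))"
          by (rule lin7[OF lb[OF le4 k] dist_leD[OF le is_real_real_of[OF h3(3)] xn is_real_rzero w4 k] abs
                real_of_val[OF h4(2) k] rzero_val[OF k] uf_half[OF h4(1)] uf_pos[OF k]])
            (use t k h4 in \<open>auto simp: hom_def qminus_def\<close>)
      qed
    qed
  qed
qed

lemma converges_apparently_convergent:
  assumes x: "w \<Turnstile> is_real_seq x" and conv: "w \<Turnstile> converges x rzero"
  shows "w \<Turnstile> apparently_convergent x"
  unfolding apparently_convergent_def AllR_def
proof (rule f_allI)
  show "wf_fm (is_real (Var 0) \<^bold>\<longrightarrow> rlt rzero (Var 0) \<^bold>\<and> rle (Var 0) (wk 1 x \<^bold>\<cdot> Zero) \<^bold>\<longrightarrow>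
      bounded_away (wk 1 x) (Var 0)) (Real # ctx w)"
    using seq_typed[OF x order_refl] by simp
  fix w1 y assume w1: "w \<le> w1" and y: "of_type w1 y Real"
  have x1: "of_type w1 x (Nat \<^bold>\<Rightarrow> Real)" by (rule seq_typed[OF x w1])
  have "w1 \<Turnstile> is_real y \<^bold>\<longrightarrow> rlt rzero y \<^bold>\<and> rle y (x \<^bold>\<cdot> Zero) \<^bold>\<longrightarrow> bounded_away x y"
  proof (rule f_impI)
    fix w2 assume w2: "w1 \<le> w2" and y2: "w2 \<Turnstile> is_real y"
    show "w2 \<Turnstile> rlt rzero y \<^bold>\<and> rle y (x \<^bold>\<cdot> Zero) \<^bold>\<longrightarrow> bounded_away x y"
    proof (rule f_impI)
      fix w3 assume w3: "w2 \<le> w3" and h: "w3 \<Turnstile> rlt rzero y \<^bold>\<and> rle y (x \<^bold>\<cdot> Zero)"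
      have le: "w \<le> w3" using w1 w2 w3 order_trans by blast
      from h have "w3 \<Turnstile> rlt rzero y" by (simp add: f_conj_iff)
      then show "w3 \<Turnstile> bounded_away x y"
        by (rule converges_bounded_away[OF forces_mono[OF x le] forces_mono[OF conv le] forces_mono[OF y2 w3]])
    qed (use is_real_typed[OF y2] of_type_mono[OF x1 w2] in simp)
  qed (use y in simp)
  then show "w1 \<Turnstile> subf (inst y) (is_real (Var 0) \<^bold>\<longrightarrow> rlt rzero (Var 0) \<^bold>\<and> rle (Var 0) (wk 1 x \<^bold>\<cdot> Zero) \<^bold>\<longrightarrow>
      bounded_away (wk 1 x) (Var 0))" by simp
qed

lemma apparently_convergentD:
  assumes app: "w \<Turnstile> apparently_convergent x" and w': "w \<le> w'" and y: "w' \<Turnstile> is_real y"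
    and pos: "w' \<Turnstile> rlt rzero y" and le: "w' \<Turnstile> rle y (x \<^bold>\<cdot> Zero)"
  shows "w' \<Turnstile> bounded_away x y"
proof -
  have "w' \<Turnstile> is_real y \<^bold>\<longrightarrow> rlt rzero y \<^bold>\<and> rle y (x \<^bold>\<cdot> Zero) \<^bold>\<longrightarrow> bounded_away x y"
    using f_allE[OF app[unfolded apparently_convergent_def AllR_def] w' is_real_typed[OF y]] by simp
  from f_impE[OF f_impE[OF this order_refl y] order_refl f_conjI[OF pos le]] show ?thesis .
qed


section \<open>Searching with Markov's principle\<close>

lemma nat_fun_app [simp]: "has_type f \<Delta> (Nat \<^bold>\<Rightarrow> Nat) \<Longrightarrow> has_type (f \<^bold>\<cdot> k) \<Delta> Nat \<longleftrightarrow> has_type k \<Delta> Nat"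
  using has_type_unique by (auto simp: has_type.simps(2))

lemma f_Zero_Succ: "w \<Turnstile> t \<^bold>= Zero \<Longrightarrow> w \<Turnstile> t \<^bold>= Succ u \<Longrightarrow> w \<Turnstile> Bot"
  using f_Succ_Zero[OF f_trans[OF f_sym]] by blast

text \<open>For rational \<open>s\<^sub>n\<close> and \<open>c\<close> one of \<open>c \<le> s\<^sub>n\<close> and \<open>s\<^sub>n \<le> c\<close> can be chosen for each \<open>n\<close>.
  Markov's principle, applied to the binary sequence of choices, finds an \<open>n\<close> of the second kind as
  soon as not all of them can be of the first.\<close>

lemma markov_search:
  assumes mp: "w \<Turnstile> MP" and s: "of_type w s Real" and c: "of_type w c Rat" and C: "wf_fm C (ctx w)"
    and no: "\<And>w'. w \<le> w' \<Longrightarrow> (\<And>w'' n. w' \<le> w'' \<Longrightarrow> of_type w'' n Nat \<Longrightarrow> w'' \<Turnstile> qle c (s \<^bold>\<cdot> n)) \<Longrightarrow> w' \<Turnstile> Bot"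
    and yes: "\<And>w' n. w \<le> w' \<Longrightarrow> of_type w' n Nat \<Longrightarrow> w' \<Turnstile> qle (s \<^bold>\<cdot> n) c \<Longrightarrow> w' \<Turnstile> C"
  shows "w \<Turnstile> C"
proof -
  let ?A = "(Var 0 \<^bold>= Zero \<^bold>\<and> qle (wk 2 c) (wk 2 s \<^bold>\<cdot> Var 1)) \<^bold>\<or> (Var 0 \<^bold>= Succ Zero \<^bold>\<and> qle (wk 2 s \<^bold>\<cdot> Var 1) (wk 2 c))"
  show ?thesis
  proof (rule f_choice[where \<sigma> = Nat and A = ?A])
    show "wf_fm ?A (Nat # Nat # ctx w)" using s c by auto
    show "wf_fm C (ctx w)" by (rule C)
    fix w1 n assume w1: "w \<le> w1" and n: "of_type w1 n Nat"
    have t: "of_type w1 c Rat" "of_type w1 (s \<^bold>\<cdot> n) Rat"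
      using of_type_mono[OF s w1] of_type_mono[OF c w1] n by auto
    have "w1 \<Turnstile> Ex Nat ((Var 0 \<^bold>= Zero \<^bold>\<and> qle (ren Suc c) (ren Suc (s \<^bold>\<cdot> n))) \<^bold>\<or>
        (Var 0 \<^bold>= Succ Zero \<^bold>\<and> qle (ren Suc (s \<^bold>\<cdot> n)) (ren Suc c)))"
    proof (rule f_orE[OF qle_total[OF t]])
      fix w2 assume w2: "w1 \<le> w2" and le: "w2 \<Turnstile> qle c (s \<^bold>\<cdot> n)"
      have t2: "of_type w2 c Rat" "of_type w2 (s \<^bold>\<cdot> n) Rat" using t w2 of_type_mono by blast+
      have "w2 \<Turnstile> (Zero \<^bold>= Zero \<^bold>\<and> qle c (s \<^bold>\<cdot> n)) \<^bold>\<or> (Zero \<^bold>= Succ Zero \<^bold>\<and> qle (s \<^bold>\<cdot> n) c)"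
        using le t2 by (intro f_orI1 f_conjI f_refl[of _ _ Nat]) auto
      then show "w2 \<Turnstile> Ex Nat ((Var 0 \<^bold>= Zero \<^bold>\<and> qle (ren Suc c) (ren Suc (s \<^bold>\<cdot> n))) \<^bold>\<or>
        (Var 0 \<^bold>= Succ Zero \<^bold>\<and> qle (ren Suc (s \<^bold>\<cdot> n)) (ren Suc c)))"
        using t2 by (intro f_exI[where t = Zero]) (auto simp del: ren.simps)
    next
      fix w2 assume w2: "w1 \<le> w2" and le: "w2 \<Turnstile> qle (s \<^bold>\<cdot> n) c"
      have t2: "of_type w2 c Rat" "of_type w2 (s \<^bold>\<cdot> n) Rat" using t w2 of_type_mono by blast+
      have "w2 \<Turnstile> (Succ Zero \<^bold>= Zero \<^bold>\<and> qle c (s \<^bold>\<cdot> n)) \<^bold>\<or> (Succ Zero \<^bold>= Succ Zero \<^bold>\<and> qle (s \<^bold>\<cdot> n) c)"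
        using le t2 by (intro f_orI2 f_conjI f_refl[of _ _ Nat]) auto
      then show "w2 \<Turnstile> Ex Nat ((Var 0 \<^bold>= Zero \<^bold>\<and> qle (ren Suc c) (ren Suc (s \<^bold>\<cdot> n))) \<^bold>\<or>
        (Var 0 \<^bold>= Succ Zero \<^bold>\<and> qle (ren Suc (s \<^bold>\<cdot> n)) (ren Suc c)))"
        using t2 by (intro f_exI[where t = "Succ Zero"]) (auto simp del: ren.simps)
    qed
    then show "w1 \<Turnstile> Ex Nat (subf (up_sub (inst n)) ?A)" by simp
  next
    fix w1 f assume w1: "w \<le> w1" and f: "of_type w1 f (Nat \<^bold>\<Rightarrow> Nat)"
      and "\<And>w'' n. w1 \<le> w'' \<Longrightarrow> of_type w'' n Nat \<Longrightarrow> w'' \<Turnstile> subf (case_nat (f \<^bold>\<cdot> n) (case_nat n Var)) ?A"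
    then have spec: "\<And>w'' n. w1 \<le> w'' \<Longrightarrow> of_type w'' n Nat \<Longrightarrow>
        w'' \<Turnstile> (f \<^bold>\<cdot> n \<^bold>= Zero \<^bold>\<and> qle c (s \<^bold>\<cdot> n)) \<^bold>\<or> (f \<^bold>\<cdot> n \<^bold>= Succ Zero \<^bold>\<and> qle (s \<^bold>\<cdot> n) c)" by simp
    have binary: "w1 \<Turnstile> All Nat (ren Suc f \<^bold>\<cdot> Var 0 \<^bold>= Zero \<^bold>\<or> ren Suc f \<^bold>\<cdot> Var 0 \<^bold>= Succ Zero)"
    proof (rule f_allI)
      show "wf_fm (ren Suc f \<^bold>\<cdot> Var 0 \<^bold>= Zero \<^bold>\<or> ren Suc f \<^bold>\<cdot> Var 0 \<^bold>= Succ Zero) (Nat # ctx w1)" using f by auto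
      fix w2 n assume w2: "w1 \<le> w2" and n: "of_type w2 n Nat"
      have "w2 \<Turnstile> f \<^bold>\<cdot> n \<^bold>= Zero \<^bold>\<or> f \<^bold>\<cdot> n \<^bold>= Succ Zero"
      proof (rule f_orE[OF spec[OF w2 n]])
        fix w3 assume w3: "w2 \<le> w3"
        have t: "of_type w3 (f \<^bold>\<cdot> n) Nat" using of_type_mono[OF f order_trans[OF w2 w3]] of_type_mono[OF n w3] by simp
        show "w3 \<Turnstile> f \<^bold>\<cdot> n \<^bold>= Zero \<^bold>\<or> f \<^bold>\<cdot> n \<^bold>= Succ Zero" if "w3 \<Turnstile> f \<^bold>\<cdot> n \<^bold>= Zero \<^bold>\<and> qle c (s \<^bold>\<cdot> n)"
          by (rule f_orI1) (use that t in \<open>auto simp: f_conj_iff\<close>)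
        show "w3 \<Turnstile> f \<^bold>\<cdot> n \<^bold>= Zero \<^bold>\<or> f \<^bold>\<cdot> n \<^bold>= Succ Zero" if "w3 \<Turnstile> f \<^bold>\<cdot> n \<^bold>= Succ Zero \<^bold>\<and> qle (s \<^bold>\<cdot> n) c"
          by (rule f_orI2) (use that t in \<open>auto simp: f_conj_iff\<close>)
      qed
      then show "w2 \<Turnstile> subf (inst n) (ren Suc f \<^bold>\<cdot> Var 0 \<^bold>= Zero \<^bold>\<or> ren Suc f \<^bold>\<cdot> Var 0 \<^bold>= Succ Zero)" by simp
    qed
    have nonzero: "w1 \<Turnstile> Neg (All Nat (ren Suc f \<^bold>\<cdot> Var 0 \<^bold>= Zero))"
    proof (rule f_impI)
      show "wf_fm (All Nat (ren Suc f \<^bold>\<cdot> Var 0 \<^bold>= Zero)) (ctx w1)" using f by auto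
      fix w2 assume w2: "w1 \<le> w2" and all: "w2 \<Turnstile> All Nat (ren Suc f \<^bold>\<cdot> Var 0 \<^bold>= Zero)"
      show "w2 \<Turnstile> Bot"
      proof (rule no)
        show "w \<le> w2" using w1 w2 by (rule order_trans)
        fix w3 n assume w3: "w2 \<le> w3" and n: "of_type w3 n Nat"
        have le: "w1 \<le> w3" "w \<le> w3" using w1 w2 w3 order_trans by blast+
        have zero: "w3 \<Turnstile> f \<^bold>\<cdot> n \<^bold>= Zero" using f_allE[OF all w3 n] by simp
        show "w3 \<Turnstile> qle c (s \<^bold>\<cdot> n)"
        proof (rule f_orE[OF spec[OF le(1) n]])
          fix w4 assume w4: "w3 \<le> w4" and "w4 \<Turnstile> f \<^bold>\<cdot> n \<^bold>= Succ Zero \<^bold>\<and> qle (s \<^bold>\<cdot> n) c"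
          then have one: "w4 \<Turnstile> f \<^bold>\<cdot> n \<^bold>= Succ Zero" and "w4 \<Turnstile> qle (s \<^bold>\<cdot> n) c" by (simp_all add: f_conj_iff)
          from f_Zero_Succ[OF forces_mono[OF zero w4] one]
          show "w4 \<Turnstile> qle c (s \<^bold>\<cdot> n)"
            by (rule f_botE) (use forces_wf[OF \<open>w4 \<Turnstile> qle (s \<^bold>\<cdot> n) c\<close>] in simp)
        qed (simp add: f_conj_iff)
      qed
    qed
    have "w1 \<Turnstile> All Nat (ren Suc f \<^bold>\<cdot> Var 0 \<^bold>= Zero \<^bold>\<or> ren Suc f \<^bold>\<cdot> Var 0 \<^bold>= Succ Zero) \<^bold>\<longrightarrow>
        Neg (All Nat (ren Suc f \<^bold>\<cdot> Var 0 \<^bold>= Zero)) \<^bold>\<longrightarrow> Ex Nat (ren Suc f \<^bold>\<cdot> Var 0 \<^bold>= Succ Zero)"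
      using f_allE[OF mp[unfolded MP_def] w1 f] by simp
    from f_impE[OF f_impE[OF this order_refl binary] order_refl nonzero]
    show "w1 \<Turnstile> C"
    proof (rule f_exE)
      show "wf_fm C (ctx w1)" using C w1 by (rule wf_fm_mono)
      fix w2 n assume w2: "w1 \<le> w2" and n: "of_type w2 n Nat" and "w2 \<Turnstile> subf (inst n) (ren Suc f \<^bold>\<cdot> Var 0 \<^bold>= Succ Zero)"
      then have one: "w2 \<Turnstile> f \<^bold>\<cdot> n \<^bold>= Succ Zero" by simp
      have le: "w \<le> w2" using w1 w2 by (rule order_trans)
      show "w2 \<Turnstile> C"
      proof (rule f_orE[OF spec[OF w2 n]])
        fix w3 assume w3: "w2 \<le> w3" and "w3 \<Turnstile> f \<^bold>\<cdot> n \<^bold>= Zero \<^bold>\<and> qle c (s \<^bold>\<cdot> n)"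
        then have "w3 \<Turnstile> f \<^bold>\<cdot> n \<^bold>= Zero" by (simp add: f_conj_iff)
        from f_Zero_Succ[OF this forces_mono[OF one w3]]
        show "w3 \<Turnstile> C" by (rule f_botE) (rule wf_fm_mono[OF C order_trans[OF le w3]])
      next
        fix w3 assume w3: "w2 \<le> w3" and "w3 \<Turnstile> f \<^bold>\<cdot> n \<^bold>= Succ Zero \<^bold>\<and> qle (s \<^bold>\<cdot> n) c"
        then show "w3 \<Turnstile> C"
          using of_type_mono[OF n w3] order_trans[OF le w3] by (intro yes[of w3 n]) (simp_all add: f_conj_iff)
      qed
    qed
  qed
qed


section \<open>The anti-Specker property\<close>

text \<open>\<open>shift x c\<close> is the sequence \<open>x\<^sub>n - c\<close>, and \<open>plus y c\<close> the number \<open>y + c\<close>, for rational \<open>c\<close>.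
  Unlike \<open>rminus\<close> they keep the indices of the rational approximations.\<close>

definition shift :: "tm \<Rightarrow> tm \<Rightarrow> tm" where
  "shift x c = Lam Nat (Lam Nat (qminus (wk 2 x \<^bold>\<cdot> Var 1 \<^bold>\<cdot> Var 0) (wk 2 c)))"

definition plus :: "tm \<Rightarrow> tm \<Rightarrow> tm" where
  "plus y c = Lam Nat (qadd (wk 1 y \<^bold>\<cdot> Var 0) (wk 1 c))"

lemma shift_typed: "of_type w x (Nat \<^bold>\<Rightarrow> Real) \<Longrightarrow> of_type w c Rat \<Longrightarrow> of_type w (shift x c) (Nat \<^bold>\<Rightarrow> Real)"
  by (simp add: shift_def)

lemma shift_val:
  assumes "of_type w x (Nat \<^bold>\<Rightarrow> Real)" "of_type w c Rat" "of_type w n Nat" "of_type w k Nat"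
  shows "w \<Turnstile> Qeq (shift x c \<^bold>\<cdot> n \<^bold>\<cdot> k) (qminus (x \<^bold>\<cdot> n \<^bold>\<cdot> k) c)"
  using f_eq_qle[OF f_beta2[of "qminus (wk 2 x \<^bold>\<cdot> Var 1 \<^bold>\<cdot> Var 0) (wk 2 c)" Nat Nat w Rat n k]] assms
    shift_typed[OF assms(1,2)]
  by (simp add: shift_def)

lemma plus_typed: "of_type w y Real \<Longrightarrow> of_type w c Rat \<Longrightarrow> of_type w (plus y c) Real"
  by (simp add: plus_def)

lemma plus_val:
  assumes "of_type w y Real" "of_type w c Rat" "of_type w k Nat"
  shows "w \<Turnstile> Qeq (plus y c \<^bold>\<cdot> k) (qadd (y \<^bold>\<cdot> k) c)"
  using f_eq_qle[OF f_beta[of "qadd (wk 1 y \<^bold>\<cdot> Var 0) (wk 1 c)" Nat w Rat k]] assms plus_typed[OF assms(1,2)]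
  by (simp add: plus_def)

lemma is_real_plus:
  assumes y: "w \<Turnstile> is_real y" and c: "of_type w c Rat" shows "w \<Turnstile> is_real (plus y c)"
proof (rule is_realI[OF plus_typed[OF is_real_typed[OF y] c]])
  fix w' m n assume w': "w \<le> w'" and t: "of_type w' (plus y c) Real" "of_type w' m Nat" "of_type w' n Nat"
  note y' = is_real_typed_mono[OF y w'] and c' = of_type_mono[OF c w']
  show "w' \<Turnstile> qle (plus y c \<^bold>\<cdot> m) (qadd (plus y c \<^bold>\<cdot> n) (qadd (unit_frac m) (unit_frac n)))"
    by (rule lin3[OF plus_val[OF y' c' t(2)] plus_val[OF y' c' t(3)] reg[OF y w' t(2,3)]])
      (use t in \<open>auto simp: hom_def\<close>)
qed

lemma is_real_shift:
  assumes x: "w \<Turnstile> is_real_seq x" and c: "of_type w c Rat" and i: "of_type w i Nat"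
  shows "w \<Turnstile> is_real (shift x c \<^bold>\<cdot> i)"
proof (rule is_realI)
  show "of_type w (shift x c \<^bold>\<cdot> i) Real" using shift_typed[OF seq_typed[OF x order_refl] c] i by simp
  fix w' m n assume w': "w \<le> w'" and t: "of_type w' (shift x c \<^bold>\<cdot> i) Real" "of_type w' m Nat" "of_type w' n Nat"
  note x' = seq_typed[OF x w'] and c' = of_type_mono[OF c w'] and i' = of_type_mono[OF i w']
  show "w' \<Turnstile> qle (shift x c \<^bold>\<cdot> i \<^bold>\<cdot> m) (qadd (shift x c \<^bold>\<cdot> i \<^bold>\<cdot> n) (qadd (unit_frac m) (unit_frac n)))"
    by (rule lin3[OF shift_val[OF x' c' i' t(2)] shift_val[OF x' c' i' t(3)]
          reg[OF seqD[OF x order_refl i] w' t(2,3)]])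
      (use t in \<open>auto simp: hom_def qminus_def\<close>)
qed

lemma is_real_seq_shift:
  assumes x: "w \<Turnstile> is_real_seq x" and c: "of_type w c Rat" shows "w \<Turnstile> is_real_seq (shift x c)"
  unfolding is_real_seq_def
proof (rule f_allI)
  show "wf_fm (is_real (wk 1 (shift x c) \<^bold>\<cdot> Var 0)) (Nat # ctx w)"
    using shift_typed[OF seq_typed[OF x order_refl] c] by simp
  fix w' n assume w': "w \<le> w'" and n: "of_type w' n Nat"
  show "w' \<Turnstile> subf (inst n) (is_real (wk 1 (shift x c) \<^bold>\<cdot> Var 0))"
    using is_real_shift[OF forces_mono[OF x w'] of_type_mono[OF c w'] n] by simp
qed

text \<open>For \<open>y \<in> [0, 1]\<close> the point \<open>y + c\<close> need not lie in \<open>(0, x\<^sub>0]\<close>, but \<open>m = min (y + c) x\<^sub>0\<close> does; and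
  since \<open>x\<^sub>n \<le> x\<^sub>0\<close>, the distance of \<open>x\<^sub>n\<close> to \<open>m\<close> is at most the one to \<open>y + c\<close>, which is that of
  \<open>x\<^sub>n - c\<close> to \<open>y\<close>.\<close>

lemma shift_bounded_away:
  assumes x: "w \<Turnstile> is_real_seq x" and dec: "w \<Turnstile> decreasing x" and app: "w \<Turnstile> apparently_convergent x"
    and i: "of_type w i Nat" and low: "w \<Turnstile> qle (qadd (unit_frac i) (e1 i)) (x \<^bold>\<cdot> Zero \<^bold>\<cdot> i)"
    and c: "w \<Turnstile> qle (unit_frac i) c"
    and y: "w \<Turnstile> is_real y" and y0: "w \<Turnstile> rle rzero y"
  shows "w \<Turnstile> bounded_away (shift x c) y"
proof -
  have tc: "of_type w c Rat" using forces_wf[OF c] by simp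
  have x0: "w \<Turnstile> is_real (x \<^bold>\<cdot> Zero)" by (rule seqD[OF x order_refl]) simp
  have wf: "wf_fm (bounded_away (shift x c) y) (ctx w)"
    using shift_typed[OF seq_typed[OF x order_refl] tc] is_real_typed[OF y] by simp
  show ?thesis
  proof (rule real_min[OF is_real_plus[OF y tc] x0 wf])
    fix w1 m assume w1: "w \<le> w1" and m: "w1 \<Turnstile> is_real m"
      and spec: "\<And>w'' k. w1 \<le> w'' \<Longrightarrow> of_type w'' k Nat \<Longrightarrow>
        w'' \<Turnstile> min_spec (m \<^bold>\<cdot> k) (plus y c \<^bold>\<cdot> k) (x \<^bold>\<cdot> Zero \<^bold>\<cdot> k)"
    have i1: "of_type w1 i Nat" using i w1 by (rule of_type_mono)
    have x01: "w1 \<Turnstile> is_real (x \<^bold>\<cdot> Zero)" using x0 w1 by (rule forces_mono)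
    note c1 = of_type_mono[OF tc w1] and y1 = is_real_typed_mono[OF y w1]
    have pos: "w1 \<Turnstile> rlt rzero m"
    proof (rule rltI[OF is_real_rzero m i1])
      fix k assume k: "of_type w1 k Nat"
      note facts = f_conjI[OF rzero_val[OF k] plus_val[OF y1 c1 k]] spec[OF order_refl k] forces_mono[OF c w1]
        rleD[OF y0 is_real_rzero y w1 k] reg[OF x0 w1 i1 k] forces_mono[OF low w1] uf_pos[OF k] uf_pos[OF i1]
      show "w1 \<Turnstile> qle (qadd (rzero \<^bold>\<cdot> k) (unit_frac i)) (qadd (m \<^bold>\<cdot> k) (e4 k))"
        by (rule lin8[OF facts]) (use is_real_typed[OF m] i1 k in \<open>auto simp: hom_def\<close>)
    qed
    have le: "w1 \<Turnstile> rle m (x \<^bold>\<cdot> Zero)"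
    proof (rule rleI[OF m x01])
      fix w2 k assume w2: "w1 \<le> w2" and t: "of_type w2 m Real" "of_type w2 (x \<^bold>\<cdot> Zero) Real" and k: "of_type w2 k Nat"
      show "w2 \<Turnstile> qle (m \<^bold>\<cdot> k) (qadd (x \<^bold>\<cdot> Zero \<^bold>\<cdot> k) (e4 k))"
        by (rule lin2[OF spec[OF w2 k] uf_pos[OF k]]) (use t k in \<open>auto simp: hom_def\<close>)
    qed
    from apparently_convergentD[OF app w1 m pos le] wf_fm_mono[OF wf w1]
    show "w1 \<Turnstile> bounded_away (shift x c) y"
    proof (rule bounded_awayE)
      fix w2 d N assume w2: "w1 \<le> w2" and d: "w2 \<Turnstile> is_real d" "w2 \<Turnstile> rlt rzero d" and N: "of_type w2 N Nat"
        and ev: "\<And>w'' n. w2 \<le> w'' \<Longrightarrow> of_type w'' n Nat \<Longrightarrow> w'' \<Turnstile> nle N n \<Longrightarrow> w'' \<Turnstile> rle d (rabs (rminus (x \<^bold>\<cdot> n) m))"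
      have le2: "w \<le> w2" using w1 w2 by (rule order_trans)
      show "w2 \<Turnstile> bounded_away (shift x c) y"
      proof (rule bounded_awayI[OF _ _ d N])
        show "of_type w2 (shift x c) (Nat \<^bold>\<Rightarrow> Real)" by (rule shift_typed[OF seq_typed[OF x le2] of_type_mono[OF tc le2]])
        show "of_type w2 y Real" by (rule is_real_typed_mono[OF y le2])
        fix w3 n assume w3: "w2 \<le> w3" and n: "of_type w3 n Nat" "w3 \<Turnstile> nle N n"
        have le3: "w \<le> w3" "w1 \<le> w3" using le2 w2 w3 by (auto intro: order_trans)
        note x3 = forces_mono[OF x le3(1)] and c3 = of_type_mono[OF tc le3(1)]
        have xn: "w3 \<Turnstile> is_real (x \<^bold>\<cdot> n)" by (rule seqD[OF x3 order_refl n(1)])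
        have mono: "w3 \<Turnstile> rle (x \<^bold>\<cdot> n) (x \<^bold>\<cdot> Zero)"
          by (rule decreasing_le[OF x3 forces_mono[OF dec le3(1)] nle_Zero[OF n(1)]])
        show "w3 \<Turnstile> rle d (rabs (rminus (shift x c \<^bold>\<cdot> n) y))"
        proof (rule dist_geI[OF forces_mono[OF d(1) w3] is_real_shift[OF x3 c3 n(1)] forces_mono[OF y le3(1)]])
          fix w4 k assume w4: "w3 \<le> w4" and k: "of_type w4 k Nat"
          have le4: "w1 \<le> w4" "w \<le> w4" using le3 w4 by (auto intro: order_trans)
          note n4 = of_type_mono[OF n(1) w4] and c4 = of_type_mono[OF c3 w4]
          have t: "of_type w4 d Real" "of_type w4 y Real" "of_type w4 m Real" "of_type w4 (x \<^bold>\<cdot> n) Real"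
            "of_type w4 (shift x c \<^bold>\<cdot> n) Real"
            using d(1) y m xn is_real_shift[OF x3 c3 n(1)] w3 w4 le4
            by (auto intro: is_real_typed_mono order_trans)
          have abs: "w4 \<Turnstile> abs_spec (qminus (x \<^bold>\<cdot> n \<^bold>\<cdot> k) (m \<^bold>\<cdot> k)) \<^bold>\<and> abs_spec (qminus (shift x c \<^bold>\<cdot> n \<^bold>\<cdot> k) (y \<^bold>\<cdot> k))"
            using t k by (intro f_conjI abs_spec) simp_all
          note facts = dist_geD[OF ev[OF w3 n] forces_mono[OF d(1) w3] xn forces_mono[OF m le3(2)] w4 k] spec[OF le4(1) k]
            plus_val[OF t(2) c4 k] shift_val[OF seq_typed[OF x le4(2)] c4 n4 k]
            rleD[OF mono xn forces_mono[OF x0 le3(1)] w4 k] abs uf_pos[OF k]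
          show "w4 \<Turnstile> qle (d \<^bold>\<cdot> k) (qadd (qabs (qminus (shift x c \<^bold>\<cdot> n \<^bold>\<cdot> k) (y \<^bold>\<cdot> k))) (qadd (e3 k) (e2 k)))"
            by (rule lin7[OF facts]) (use t k in \<open>auto simp: hom_def qminus_def\<close>)
        qed
      qed
    qed
  qed
qed

lemma qone_uf: "qone = unit_frac Zero"
  by (simp add: qone_def unit_frac_def)

lemma qnat_nonneg: assumes "of_type w n Nat" shows "w \<Turnstile> qle qzero (qnat n)"
proof -
  have n: "qrep w [n] (qnat n) (PX 0) PZ PZ" using assms by (intro qrep_qnat) (auto intro: f_refl[of _ _ Nat])
  show ?thesis unfolding qle_iff_nle[OF qrep_qzero n] by (rule nle_poly[where r = "PX 0"]) (use assms in auto)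
qed

lemma is_real_rone: "w \<Turnstile> is_real rone"
  by (rule is_real_real_of) simp

lemma uf_half4:
  assumes "of_type w p Nat" shows "w \<Turnstile> Qeq (e4 (hf (hf (hf (hf p))))) (unit_frac p)"
proof (rule f_conjI)
  have h: "of_type w (hf p) Nat" "of_type w (hf (hf p)) Nat" "of_type w (hf (hf (hf p))) Nat" using assms by auto
  note facts = uf_half[OF assms] uf_half[OF h(1)] uf_half[OF h(2)] uf_half[OF h(3)]
  show "w \<Turnstile> qle (e4 (hf (hf (hf (hf p))))) (unit_frac p)"
    by (rule lin4[OF facts]) (use assms in \<open>auto simp: hom_def\<close>)
  show "w \<Turnstile> qle (unit_frac p) (e4 (hf (hf (hf (hf p)))))"
    by (rule lin4[OF facts]) (use assms in \<open>auto simp: hom_def\<close>)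
qed

lemma min_in_unit_interval:
  assumes z: "w \<Turnstile> is_real z" and y: "w \<Turnstile> is_real y"
    and spec: "\<And>w' k. w \<le> w' \<Longrightarrow> of_type w' k Nat \<Longrightarrow> w' \<Turnstile> min_spec (y \<^bold>\<cdot> k) (rabs z \<^bold>\<cdot> k) (rone \<^bold>\<cdot> k)"
  shows "w \<Turnstile> in_unit_interval y"
  unfolding in_unit_interval_def
proof (rule f_conjI)
  show "w \<Turnstile> rle rzero y"
  proof (rule rleI[OF is_real_rzero y])
    fix w' k assume w': "w \<le> w'" and t: "of_type w' rzero Real" "of_type w' y Real" and k: "of_type w' k Nat"
    note z' = is_real_typed_mono[OF z w']
    have one: "w' \<Turnstile> Qeq (rone \<^bold>\<cdot> k) qone" using k by (intro real_of_val) simp_all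
    have one_pos: "w' \<Turnstile> qle qzero qone" unfolding qone_uf by (rule uf_pos) simp
    have abs: "w' \<Turnstile> abs_spec (z \<^bold>\<cdot> k)" using z' k by (intro abs_spec) simp
    show "w' \<Turnstile> qle (rzero \<^bold>\<cdot> k) (qadd (y \<^bold>\<cdot> k) (e4 k))"
      by (rule lin7[OF spec[OF w' k] rzero_val[OF k] rabs_val[OF z' k] one one_pos abs uf_pos[OF k]])
        (use t k in \<open>auto simp: hom_def\<close>)
  qed
  show "w \<Turnstile> rle y rone"
  proof (rule rleI[OF y is_real_rone])
    fix w' k assume w': "w \<le> w'" and t: "of_type w' y Real" "of_type w' rone Real" and k: "of_type w' k Nat"
    show "w' \<Turnstile> qle (y \<^bold>\<cdot> k) (qadd (rone \<^bold>\<cdot> k) (e4 k))"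
      by (rule lin2[OF spec[OF w' k] uf_pos[OF k]]) (use t k in \<open>auto simp: hom_def\<close>)
  qed
qed

text \<open>For \<open>0 \<le> z \<le> 1\<close> the number \<open>y = min \<bar>z\<bar> 1\<close> would equal \<open>z\<close>, so a positive distance between
  \<open>z \<le> 1\<close> and \<open>y\<close> leaves only \<open>z < 0\<close>.  The approximation is taken at a sixteenth of the accuracy
  \<open>1/(p + 1)\<close> that bounds the distance from below; there the distance outweighs the sum of all errors.\<close>

lemma negative_of_apart:
  assumes z: "w \<Turnstile> is_real z" and y: "w \<Turnstile> is_real y" and d: "w \<Turnstile> is_real d" and p: "of_type w p Nat"
    and spec: "\<And>w' k. w \<le> w' \<Longrightarrow> of_type w' k Nat \<Longrightarrow> w' \<Turnstile> min_spec (y \<^bold>\<cdot> k) (rabs z \<^bold>\<cdot> k) (rone \<^bold>\<cdot> k)"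
    and dpos: "\<And>k. of_type w k Nat \<Longrightarrow> w \<Turnstile> qle (qadd (rzero \<^bold>\<cdot> k) (unit_frac p)) (qadd (d \<^bold>\<cdot> k) (e1 k))"
    and apart: "w \<Turnstile> rle d (rabs (rminus z y))"
    and le1: "\<And>k. of_type w k Nat \<Longrightarrow> w \<Turnstile> qle (z \<^bold>\<cdot> k) (qadd qone (e2 k))"
  shows "w \<Turnstile> qle (qadd (z \<^bold>\<cdot> hf (hf (hf (hf p)))) (e1 (hf (hf (hf (hf p)))))) qzero"
proof -
  define k where "k = hf (hf (hf (hf p)))"
  have k: "of_type w k Nat" using p by (simp add: k_def)
  have half: "w \<Turnstile> Qeq (e4 k) (unit_frac p)" unfolding k_def by (rule uf_half4[OF p])
  note t = is_real_typed[OF z] is_real_typed[OF y] is_real_typed[OF d]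
  have tz: "of_type w (z \<^bold>\<cdot> k) Rat" "of_type w qzero Rat" using t k by auto
  have far: "w \<Turnstile> qle (unit_frac p) (qadd (qabs (qminus (z \<^bold>\<cdot> k) (y \<^bold>\<cdot> k))) (qadd (e3 k) (e1 k)))"
    by (rule lin3[OF dpos[OF k] dist_geD[OF apart d z y order_refl k] rzero_val[OF k]])
      (use t k p in \<open>auto simp: hom_def\<close>)
  have one: "w \<Turnstile> Qeq (rone \<^bold>\<cdot> k) qone" using k by (intro real_of_val) simp_all
  have abs: "w \<Turnstile> abs_spec (z \<^bold>\<cdot> k) \<^bold>\<and> abs_spec (qminus (z \<^bold>\<cdot> k) (y \<^bold>\<cdot> k))"
    using t k by (intro f_conjI abs_spec) simp_all
  note facts = f_conjI[OF far half] le1[OF k] spec[OF order_refl k] f_conjI[OF rabs_val[OF t(1) k] one] abs uf_pos[OF k]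
  show ?thesis unfolding k_def[symmetric]
  proof (rule f_orE[OF qle_total[OF tz]])
    fix w' assume w': "w \<le> w'" and le: "w' \<Turnstile> qle (z \<^bold>\<cdot> k) qzero"
    show "w' \<Turnstile> qle (qadd (z \<^bold>\<cdot> k) (e1 k)) qzero"
      by (rule lin7[OF facts[THEN forces_mono, OF w'] le])
        (use of_type_mono[OF tz(1) w'] of_type_mono[OF k w'] in \<open>auto simp: hom_def qminus_def\<close>)
  next
    fix w' assume w': "w \<le> w'" and ge: "w' \<Turnstile> qle qzero (z \<^bold>\<cdot> k)"
    have "w' \<Turnstile> qle (unit_frac p) qzero"
      by (rule lin7[OF facts[THEN forces_mono, OF w'] ge])
        (use of_type_mono[OF p w'] in \<open>auto simp: hom_def qminus_def\<close>)
    then have "w' \<Turnstile> Bot" by (rule uf_not_le_zero)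
    then show "w' \<Turnstile> qle (qadd (z \<^bold>\<cdot> k) (e1 k)) qzero"
      by (rule f_botE) (use of_type_mono[OF tz(1) w'] of_type_mono[OF k w'] in simp)
  qed
qed

text \<open>Suppose some \<open>x\<^sub>n\<close> is at most \<open>c + 1\<close>.  The sequence \<open>z\<^sub>l = x\<^sub>l - c\<close> is eventually bounded away from
  each point of \<open>[0, 1]\<close>, hence uniformly from \<open>[0, 1]\<close>.  For large \<open>l\<close> one has \<open>z\<^sub>l \<le> 1\<close>, and \<open>z\<^sub>l\<close> lies at a
  positive distance from the point \<open>min \<bar>z\<^sub>l\<bar> 1\<close> of the interval.  This makes \<open>z\<^sub>l\<close> negative, so that
  \<open>x\<^sub>l \<le> c\<close>.\<close>

lemma anti_specker_step:
  assumes as: "w \<Turnstile> AS_unit"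
    and x: "w \<Turnstile> is_real_seq x" and dec: "w \<Turnstile> decreasing x" and app: "w \<Turnstile> apparently_convergent x"
    and i: "of_type w i Nat" and low: "w \<Turnstile> qle (qadd (unit_frac i) (e1 i)) (x \<^bold>\<cdot> Zero \<^bold>\<cdot> i)"
    and c: "w \<Turnstile> qle (unit_frac i) c"
    and n: "of_type w n Nat" and le: "w \<Turnstile> rle (x \<^bold>\<cdot> n) (real_of (qadd c qone))"
    and no: "\<And>w' n. w \<le> w' \<Longrightarrow> of_type w' n Nat \<Longrightarrow> w' \<Turnstile> rle (x \<^bold>\<cdot> n) (real_of c) \<Longrightarrow> w' \<Turnstile> Bot"
  shows "w \<Turnstile> Bot"
proof -
  have tc: "of_type w c Rat" using forces_wf[OF c] by simp
  let ?z = "shift x c"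
  have tz: "of_type w ?z (Nat \<^bold>\<Rightarrow> Real)" by (rule shift_typed[OF seq_typed[OF x order_refl] tc])
  have "w \<Turnstile> is_real_seq ?z \<^bold>\<longrightarrow> All Real (is_real (Var 0) \<^bold>\<longrightarrow> in_unit_interval (Var 0) \<^bold>\<longrightarrow>
      bounded_away (ren Suc ?z) (Var 0)) \<^bold>\<longrightarrow> unif_bounded_away_unit ?z"
    using f_allE[OF as[unfolded AS_unit_def AllR_def] order_refl tz] by simp
  moreover have "w \<Turnstile> All Real (is_real (Var 0) \<^bold>\<longrightarrow> in_unit_interval (Var 0) \<^bold>\<longrightarrow> bounded_away (ren Suc ?z) (Var 0))"
  proof (rule f_allI)
    fix w1 y assume w1: "w \<le> w1" and ty: "of_type w1 y Real"
    have "w1 \<Turnstile> is_real y \<^bold>\<longrightarrow> in_unit_interval y \<^bold>\<longrightarrow> bounded_away ?z y"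
    proof (rule f_impI)
      fix w2 assume w2: "w1 \<le> w2" and y: "w2 \<Turnstile> is_real y"
      show "w2 \<Turnstile> in_unit_interval y \<^bold>\<longrightarrow> bounded_away ?z y"
      proof (rule f_impI)
        fix w3 assume w3: "w2 \<le> w3" and y1: "w3 \<Turnstile> in_unit_interval y"
        have le3: "w \<le> w3" using w1 w2 w3 order_trans by blast
        note up = forces_mono[OF _ le3]
        show "w3 \<Turnstile> bounded_away ?z y"
          by (rule shift_bounded_away[OF up[OF x] up[OF dec] up[OF app] of_type_mono[OF i le3] up[OF low] up[OF c]
                forces_mono[OF y w3]])
            (use y1 in \<open>simp add: in_unit_interval_def f_conj_iff\<close>)
      qed (use is_real_typed[OF y] in simp)
    qed (use ty in simp)
    then show "w1 \<Turnstile> subf (inst y) (is_real (Var 0) \<^bold>\<longrightarrow> in_unit_interval (Var 0) \<^bold>\<longrightarrow> bounded_away (ren Suc ?z) (Var 0))"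
      by simp
  qed (use tz in simp)
  ultimately have "w \<Turnstile> unif_bounded_away_unit ?z"
    using f_impE[OF f_impE[OF _ order_refl is_real_seq_shift[OF x tc]] order_refl] by blast
  then show "w \<Turnstile> Bot"
  proof (rule unif_bounded_awayE)
    fix w1 d N assume w1: "w \<le> w1" and d: "w1 \<Turnstile> is_real d" "w1 \<Turnstile> rlt rzero d" and N: "of_type w1 N Nat"
      and far: "\<And>w'' n y. w1 \<le> w'' \<Longrightarrow> of_type w'' n Nat \<Longrightarrow> w'' \<Turnstile> nle N n \<Longrightarrow> w'' \<Turnstile> is_real y \<Longrightarrow>
        w'' \<Turnstile> in_unit_interval y \<Longrightarrow> w'' \<Turnstile> rle d (rabs (rminus (?z \<^bold>\<cdot> n) y))"
    from d(2) is_real_rzero d(1) show "w1 \<Turnstile> Bot"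
    proof (rule rltD)
      fix w2 p assume w2: "w1 \<le> w2" and p: "of_type w2 p Nat"
        and dpos: "\<And>w'' k. w2 \<le> w'' \<Longrightarrow> of_type w'' k Nat \<Longrightarrow>
          w'' \<Turnstile> qle (qadd (rzero \<^bold>\<cdot> k) (unit_frac p)) (qadd (d \<^bold>\<cdot> k) (e1 k))"
      have le2: "w \<le> w2" using w1 w2 by (rule order_trans)
      define l where "l = add N n"
      note n2 = of_type_mono[OF n le2] and N2 = of_type_mono[OF N w2] and c2 = of_type_mono[OF tc le2]
      note x2 = forces_mono[OF x le2]
      have l: "of_type w2 l Nat" using n2 N2 by (simp add: l_def)
      have Nl: "w2 \<Turnstile> nle N l" unfolding l_def by (rule nle_add_right[OF N2 n2])
      have nl: "w2 \<Turnstile> nle n l" unfolding l_def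
        by (rule nle_cong[OF nle_add_right[OF n2 N2] f_refl[OF n2] add_comm[OF n2 N2]])
      have z: "w2 \<Turnstile> is_real (?z \<^bold>\<cdot> l)" by (rule is_real_shift[OF x2 c2 l])
      have xl: "w2 \<Turnstile> is_real (x \<^bold>\<cdot> l)" by (rule seqD[OF x2 order_refl l])
      have xn: "w2 \<Turnstile> is_real (x \<^bold>\<cdot> n)" by (rule seqD[OF x2 order_refl n2])
      have one: "w2 \<Turnstile> is_real (real_of (qadd c qone))" using c2 by (intro is_real_real_of) simp
      have upper: "w2 \<Turnstile> rle (x \<^bold>\<cdot> l) (real_of (qadd c qone))"
        by (rule rle_trans[OF decreasing_le[OF x2 forces_mono[OF dec le2] nl] forces_mono[OF le le2] xl xn one])
      show "w2 \<Turnstile> Bot"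
      proof (rule real_min[OF is_real_rabs[OF z] is_real_rone])
        fix w3 y assume w3: "w2 \<le> w3" and y: "w3 \<Turnstile> is_real y"
          and spec: "\<And>w'' k. w3 \<le> w'' \<Longrightarrow> of_type w'' k Nat \<Longrightarrow> w'' \<Turnstile> min_spec (y \<^bold>\<cdot> k) (rabs (?z \<^bold>\<cdot> l) \<^bold>\<cdot> k) (rone \<^bold>\<cdot> k)"
        have le3: "w \<le> w3" "w1 \<le> w3" using le2 w2 w3 by (auto intro: order_trans)
        note up = forces_mono[OF _ w3] and l3 = of_type_mono[OF l w3] and c3 = of_type_mono[OF c2 w3]
        have tx: "of_type w3 x (Nat \<^bold>\<Rightarrow> Real)" "of_type w3 (x \<^bold>\<cdot> l) Real" "of_type w3 (?z \<^bold>\<cdot> l) Real"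
          using seq_typed[OF x le3(1)] is_real_typed_mono[OF xl w3] is_real_typed_mono[OF z w3] .
        have p3: "of_type w3 p Nat" using p w3 by (rule of_type_mono)
        define k where "k = hf (hf (hf (hf p)))"
        have k: "of_type w3 k Nat" using p3 by (simp add: k_def)
        have apart: "w3 \<Turnstile> rle d (rabs (rminus (?z \<^bold>\<cdot> l) y))"
          by (rule far[OF le3(2) l3 up[OF Nl] y min_in_unit_interval[OF up[OF z] y spec]])
        have z1: "w3 \<Turnstile> qle (?z \<^bold>\<cdot> l \<^bold>\<cdot> k) (qadd qone (e2 k))" if k: "of_type w3 k Nat" for k
        proof -
          have val: "w3 \<Turnstile> Qeq (real_of (qadd c qone) \<^bold>\<cdot> k) (qadd c qone)" using c3 k by (intro real_of_val) simp_all
          show ?thesis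
            by (rule lin3[OF shift_val[OF tx(1) c3 l3 k] rleD[OF upper xl one w3 k] val])
              (use tx k in \<open>auto simp: hom_def qminus_def\<close>)
        qed
        have neg: "w3 \<Turnstile> qle (qadd (?z \<^bold>\<cdot> l \<^bold>\<cdot> k) (e1 k)) qzero" unfolding k_def
          by (rule negative_of_apart[OF up[OF z] y forces_mono[OF d(1) le3(2)] p3 spec dpos[OF w3] apart z1])
        have "w3 \<Turnstile> rle (x \<^bold>\<cdot> l) (real_of c)"
        proof (rule rleI[OF up[OF xl] is_real_real_of[OF c3]])
          fix w4 j assume w4: "w3 \<le> w4" and t: "of_type w4 (x \<^bold>\<cdot> l) Real" "of_type w4 (real_of c) Real"
            and j: "of_type w4 j Nat"
          note k4 = of_type_mono[OF k w4] and c4 = of_type_mono[OF c3 w4]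
          have val: "w4 \<Turnstile> Qeq (?z \<^bold>\<cdot> l \<^bold>\<cdot> k) (qminus (x \<^bold>\<cdot> l \<^bold>\<cdot> k) c)"
            by (rule shift_val[OF of_type_mono[OF tx(1) w4] c4 of_type_mono[OF l3 w4] k4])
          show "w4 \<Turnstile> qle (x \<^bold>\<cdot> l \<^bold>\<cdot> j) (qadd (real_of c \<^bold>\<cdot> j) (e4 j))"
            by (rule lin6[OF forces_mono[OF neg w4] val reg[OF xl order_trans[OF w3 w4] j k4] real_of_val[OF c4 j]
                  uf_pos[OF j] uf_pos[OF k4]])
              (use t j c4 in \<open>auto simp: hom_def qminus_def\<close>)
        qed
        then show "w3 \<Turnstile> Bot" by (rule no[OF le3(1) l3])
      qed simp
    qed simp
  qed simp
qed

text \<open>With \<open>u = 1/(i + 1)\<close>, assume \<open>x\<^sub>n \<ge> 3 u\<close> at the level of the \<open>i\<close>-th approximations, so that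
  \<open>x\<^sub>n \<ge> 2 u\<close>.  By induction on \<open>j\<close> no \<open>x\<^sub>n\<close> is at most \<open>u + j\<close>: for \<open>j = 0\<close> because \<open>2 u \<le> u\<close> is absurd, and in the
  step by the preceding lemma with \<open>c = u + j\<close>.  But \<open>x\<^sub>0\<close> is at most some \<open>u + j\<close>.  Working upwards
  one unit interval at a time replaces a rescaling of \<open>[u, x\<^sub>0]\<close> to \<open>[0, 1]\<close>.\<close>

lemma not_bounded_below:
  assumes as: "w \<Turnstile> AS_unit"
    and x: "w \<Turnstile> is_real_seq x" and dec: "w \<Turnstile> decreasing x" and app: "w \<Turnstile> apparently_convergent x"
    and i: "of_type w i Nat"
    and low: "\<And>w' n. w \<le> w' \<Longrightarrow> of_type w' n Nat \<Longrightarrow> w' \<Turnstile> qle (qadd (unit_frac i) (e1 i)) (x \<^bold>\<cdot> n \<^bold>\<cdot> i)"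
  shows "w \<Turnstile> Bot"
proof -
  let ?c = "\<lambda>j. qadd (unit_frac i) (qnat j)"
  let ?E = "Ex Nat (rle (wk 2 x \<^bold>\<cdot> Var 0) (real_of (qadd (unit_frac (wk 2 i)) (qnat (Var 1)))))"
  let ?F = "\<lambda>j. Ex Nat (rle (ren Suc x \<^bold>\<cdot> Var 0) (real_of (qadd (unit_frac (ren Suc i)) (qnat (ren Suc j)))))"
  have E: "subf (inst j) (?E \<^bold>\<longrightarrow> Bot) = (?F j \<^bold>\<longrightarrow> Bot)" for j by simp
  have FI: "w' \<Turnstile> ?F j" if "w \<le> w'" "of_type w' j Nat" "of_type w' n Nat" "w' \<Turnstile> rle (x \<^bold>\<cdot> n) (real_of (?c j))" for w' j n
    using that seq_typed[OF x that(1)] of_type_mono[OF i that(1)] by (intro f_exI[where t = n]) simp_all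
  have wfF: "wf_fm (?F j) (ctx w')" if "w \<le> w'" "of_type w' j Nat" for w' j
    using that seq_typed[OF x that(1)] of_type_mono[OF i that(1)] by simp
  have step: "w2 \<Turnstile> Bot"
    if w1: "w \<le> w1" and j: "of_type w1 j Nat" and IH: "w1 \<Turnstile> ?F j \<^bold>\<longrightarrow> Bot" and w2: "w1 \<le> w2" and n: "of_type w2 n Nat"
      and le: "w2 \<Turnstile> rle (x \<^bold>\<cdot> n) (real_of (?c (Succ j)))" for w1 w2 j n
  proof -
    have le2: "w \<le> w2" using w1 w2 by (rule order_trans)
    note up = forces_mono[OF _ le2] and i2 = of_type_mono[OF i le2] and j2 = of_type_mono[OF j w2]
    have t: "of_type w2 (?c j) Rat" "of_type w2 (?c (Succ j)) Rat" "of_type w2 (qadd (?c j) qone) Rat"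
      using i2 j2 by auto
    have c: "w2 \<Turnstile> qle (unit_frac i) (?c j)"
      by (rule lin1[OF qnat_nonneg[OF j2]]) (use i2 j2 in \<open>auto simp: hom_def\<close>)
    have "w2 \<Turnstile> rle (real_of (?c (Succ j))) (real_of (qadd (?c j) qone))"
    proof (rule rleI[OF is_real_real_of[OF t(2)] is_real_real_of[OF t(3)]])
      fix w3 k assume w3: "w2 \<le> w3" and k: "of_type w3 k Nat"
      note t3 = t[THEN of_type_mono, OF w3] and j3 = of_type_mono[OF j2 w3]
      show "w3 \<Turnstile> qle (real_of (?c (Succ j)) \<^bold>\<cdot> k) (qadd (real_of (qadd (?c j) qone) \<^bold>\<cdot> k) (e4 k))"
        by (rule lin4[OF real_of_val[OF t3(2) k] real_of_val[OF t3(3) k] qnat_Succ[OF j3] uf_pos[OF k]])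
          (use t3 k in \<open>auto simp: hom_def\<close>)
    qed
    from rle_trans[OF le this seqD[OF x le2 n] is_real_real_of[OF t(2)] is_real_real_of[OF t(3)]]
    have le': "w2 \<Turnstile> rle (x \<^bold>\<cdot> n) (real_of (qadd (?c j) qone))" .
    have low0: "w2 \<Turnstile> qle (qadd (unit_frac i) (e1 i)) (x \<^bold>\<cdot> Zero \<^bold>\<cdot> i)" by (rule low[OF le2]) simp
    show "w2 \<Turnstile> Bot"
    proof (rule anti_specker_step[OF up[OF as] up[OF x] up[OF dec] up[OF app] i2 low0 c n le'])
      fix w3 n assume w3: "w2 \<le> w3" and "of_type w3 n Nat" "w3 \<Turnstile> rle (x \<^bold>\<cdot> n) (real_of (?c j))"
      then have "w3 \<Turnstile> ?F j" using order_trans[OF le2 w3] of_type_mono[OF j2 w3] by (intro FI)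
      then show "w3 \<Turnstile> Bot" by (rule f_impE[OF IH order_trans[OF w2 w3]])
    qed
  qed
  have base: "w1 \<Turnstile> Bot"
    if w1: "w \<le> w1" and n: "of_type w1 n Nat" and le: "w1 \<Turnstile> rle (x \<^bold>\<cdot> n) (real_of (?c Zero))" for w1 n
  proof -
    note i1 = of_type_mono[OF i w1]
    define k where "k = hf (hf (hf (hf i)))"
    have k: "of_type w1 k Nat" using i1 by (simp add: k_def)
    have half: "w1 \<Turnstile> Qeq (e4 k) (unit_frac i)" unfolding k_def by (rule uf_half4[OF i1])
    have t: "of_type w1 (?c Zero) Rat" using i1 by simp
    have xn: "w1 \<Turnstile> is_real (x \<^bold>\<cdot> n)" by (rule seqD[OF x w1 n])
    have "w1 \<Turnstile> qle (unit_frac i) qzero"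
      by (rule lin5[OF low[OF w1 n] rleD[OF le xn is_real_real_of[OF t] order_refl k] reg[OF xn order_refl i1 k]
            real_of_val[OF t k] half])
        (use i1 in \<open>auto simp: hom_def qnat_Zero\<close>)
    then show ?thesis by (rule uf_not_le_zero)
  qed
  have claim: "w1 \<Turnstile> ?F j \<^bold>\<longrightarrow> Bot" if w1: "w \<le> w1" and j: "of_type w1 j Nat" for w1 j
  proof -
    have "w1 \<Turnstile> subf (inst j) (?E \<^bold>\<longrightarrow> Bot)"
    proof (rule f_nat_induct[OF _ _ _ w1 j])
      show "wf_fm (?E \<^bold>\<longrightarrow> Bot) (Nat # ctx w)" using seq_typed[OF x order_refl] i by simp
      show "w \<Turnstile> subf (inst Zero) (?E \<^bold>\<longrightarrow> Bot)" unfolding E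
      proof (rule f_impI)
        show "wf_fm (?F Zero) (ctx w)" by (rule wfF) simp_all
        fix w2 assume w2: "w \<le> w2" and "w2 \<Turnstile> ?F Zero"
        from this(2) show "w2 \<Turnstile> Bot"
        proof (rule f_exE)
          fix w3 n assume "w2 \<le> w3" "of_type w3 n Nat" "w3 \<Turnstile> subf (inst n) (rle (ren Suc x \<^bold>\<cdot> Var 0)
            (real_of (qadd (unit_frac (ren Suc i)) (qnat (ren Suc Zero)))))"
          then show "w3 \<Turnstile> Bot" using order_trans[OF w2] by (intro base[of w3 n]) simp_all
        qed simp
      qed
    next
      fix w2 j assume w2: "w \<le> w2" and j: "of_type w2 j Nat" and IH: "w2 \<Turnstile> subf (inst j) (?E \<^bold>\<longrightarrow> Bot)"
      show "w2 \<Turnstile> subf (inst (Succ j)) (?E \<^bold>\<longrightarrow> Bot)" unfolding E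
      proof (rule f_impI)
        show "wf_fm (?F (Succ j)) (ctx w2)" by (rule wfF[OF w2]) (use j in simp)
        fix w3 assume w3: "w2 \<le> w3" and "w3 \<Turnstile> ?F (Succ j)"
        from this(2) show "w3 \<Turnstile> Bot"
        proof (rule f_exE)
          fix w4 n assume w4: "w3 \<le> w4" and n: "of_type w4 n Nat" and "w4 \<Turnstile> subf (inst n) (rle (ren Suc x \<^bold>\<cdot> Var 0)
            (real_of (qadd (unit_frac (ren Suc i)) (qnat (ren Suc (Succ j))))))"
          then have "w4 \<Turnstile> rle (x \<^bold>\<cdot> n) (real_of (?c (Succ j)))" by simp
          then show "w4 \<Turnstile> Bot" by (rule step[OF w2 j IH[unfolded E] order_trans[OF w3 w4] n])
        qed simp
      qed
    qed
    then show ?thesis unfolding E .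
  qed
  \<comment> \<open>the first term lies below some \<open>u + j\<close>\<close>
  let ?q = "x \<^bold>\<cdot> Zero \<^bold>\<cdot> Zero" let ?j = "Succ (qpos ?q)"
  have x0: "w \<Turnstile> is_real (x \<^bold>\<cdot> Zero)" by (rule seqD[OF x order_refl]) simp
  have q: "of_type w ?q Rat" using is_real_typed[OF x0] by simp
  have j: "of_type w ?j Nat" using q by simp
  have t: "of_type w (?c ?j) Rat" using i q by simp
  have "w \<Turnstile> rle (x \<^bold>\<cdot> Zero) (real_of (?c ?j))"
  proof (rule rleI[OF x0 is_real_real_of[OF t]])
    fix w' k assume w': "w \<le> w'" and tx: "of_type w' (x \<^bold>\<cdot> Zero) Real" and k: "of_type w' k Nat"
    note i' = of_type_mono[OF i w'] and q' = of_type_mono[OF q w']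
    have z: "of_type w' Zero Nat" and p: "of_type w' (qpos ?q) Nat" using q' by simp_all
    show "w' \<Turnstile> qle (x \<^bold>\<cdot> Zero \<^bold>\<cdot> k) (qadd (real_of (?c ?j) \<^bold>\<cdot> k) (e4 k))"
      by (rule lin6[OF reg[OF x0 w' k z] qle_qnat[OF q'] qnat_Succ[OF p] real_of_val[OF of_type_mono[OF t w'] k]
            uf_pos[OF k] uf_pos[OF i']])
        (use tx i' q' k in \<open>auto simp: hom_def qone_uf\<close>)
  qed
  then have "w \<Turnstile> ?F ?j" using j by (intro FI[where n = Zero]) simp_all
  then show ?thesis by (rule f_impE[OF claim[OF order_refl j] order_refl])
qed

text \<open>The terms cannot all be at least \<open>3/4\<close> of the required accuracy, so that by Markov's principle one
  of them is, up to the error of its approximation, at most that; all later terms then lie within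
  the accuracy.\<close>

lemma apparently_convergent_converges:
  assumes mp: "w \<Turnstile> MP" and as: "w \<Turnstile> AS_unit"
    and x: "w \<Turnstile> is_real_seq x" and dec: "w \<Turnstile> decreasing x" and nonneg: "w \<Turnstile> nonneg_seq x"
    and app: "w \<Turnstile> apparently_convergent x"
  shows "w \<Turnstile> converges x rzero"
  unfolding converges_def
proof (rule f_allI)
  let ?B = "\<lambda>x k. Ex Nat (All Nat (nle (Var 1) (Var 0) \<^bold>\<longrightarrow>
    rle (rabs (rminus (wk 2 x \<^bold>\<cdot> Var 0) (wk 2 rzero))) (real_of (unit_frac (wk 2 k)))))"
  show "wf_fm (Ex Nat (All Nat (nle (Var 1) (Var 0) \<^bold>\<longrightarrow>
    rle (rabs (rminus (wk 3 x \<^bold>\<cdot> Var 0) (wk 3 rzero))) (real_of (unit_frac (Var 2)))))) (Nat # ctx w)"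
    using seq_typed[OF x order_refl] by simp
  fix w1 k assume w1: "w \<le> w1" and k: "of_type w1 k Nat"
  \<comment> \<open>\<open>u\<close> is a quarter of the required accuracy\<close>
  let ?i = "hf (hf k)" let ?c = "qadd (unit_frac ?i) (e1 ?i)"
  define s where "s = Lam Nat (ren Suc x \<^bold>\<cdot> Var 0 \<^bold>\<cdot> ren Suc ?i)"
  have i: "of_type w1 ?i Nat" and hk: "of_type w1 (hf k) Nat" using k by auto
  note x1 = forces_mono[OF x w1] and tx1 = seq_typed[OF x w1]
  have ts: "of_type w1 s Real" unfolding s_def using tx1 i by (simp del: ren.simps)
  have s_val: "w2 \<Turnstile> Qeq (s \<^bold>\<cdot> n) (x \<^bold>\<cdot> n \<^bold>\<cdot> ?i)" if w2: "w1 \<le> w2" and n: "of_type w2 n Nat" for w2 n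
    using f_eq_qle[OF f_beta[of "ren Suc x \<^bold>\<cdot> Var 0 \<^bold>\<cdot> ren Suc ?i" Nat w2 Rat n]] n
      of_type_mono[OF tx1 w2] of_type_mono[OF i w2] of_type_mono[OF ts w2]
    by (simp add: s_def del: ren.simps)
  have "w1 \<Turnstile> ?B x k"
  proof (rule markov_search[OF forces_mono[OF mp w1] ts])
    show "of_type w1 ?c Rat" using i by simp
    show "wf_fm (?B x k) (ctx w1)" using tx1 k by simp
    fix w2 assume w2: "w1 \<le> w2"
      and low: "\<And>w'' n. w2 \<le> w'' \<Longrightarrow> of_type w'' n Nat \<Longrightarrow> w'' \<Turnstile> qle ?c (s \<^bold>\<cdot> n)"
    have le2: "w \<le> w2" using w1 w2 by (rule order_trans)
    note up = forces_mono[OF _ le2]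
    show "w2 \<Turnstile> Bot"
    proof (rule not_bounded_below[OF up[OF as] up[OF x] up[OF dec] up[OF app] of_type_mono[OF i w2]])
      fix w3 n assume w3: "w2 \<le> w3" and n: "of_type w3 n Nat"
      have le3: "w1 \<le> w3" using w2 w3 by (rule order_trans)
      show "w3 \<Turnstile> qle ?c (x \<^bold>\<cdot> n \<^bold>\<cdot> ?i)"
        by (rule lin2[OF low[OF w3 n] s_val[OF le3 n]])
          (use of_type_mono[OF tx1 le3] of_type_mono[OF k le3] n in \<open>auto simp: hom_def\<close>)
    qed
  next
    fix w2 n assume w2: "w1 \<le> w2" and n: "of_type w2 n Nat" and small: "w2 \<Turnstile> qle (s \<^bold>\<cdot> n) ?c"
    have le2: "w \<le> w2" using w1 w2 by (rule order_trans)
    show "w2 \<Turnstile> ?B x k"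
    proof (rule eventuallyI[OF _ n])
      show "wf_fm (rle (rabs (rminus (wk 2 x \<^bold>\<cdot> Var 0) (wk 2 rzero))) (real_of (unit_frac (wk 2 k)))) (Nat # Nat # ctx w2)"
        using of_type_mono[OF tx1 w2] of_type_mono[OF k w2] by simp
      fix w3 m assume w3: "w2 \<le> w3" and m: "of_type w3 m Nat" and nm: "w3 \<Turnstile> nle n m"
      have le3: "w \<le> w3" "w1 \<le> w3" using le2 w2 w3 by (auto intro: order_trans)
      note x3 = forces_mono[OF x le3(1)] and n3 = of_type_mono[OF n w3] and k3 = of_type_mono[OF k le3(2)]
      have xm: "w3 \<Turnstile> is_real (x \<^bold>\<cdot> m)" and xn: "w3 \<Turnstile> is_real (x \<^bold>\<cdot> n)"
        by (rule seqD[OF x3 order_refl m], rule seqD[OF x3 order_refl n3])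
      have mono: "w3 \<Turnstile> rle (x \<^bold>\<cdot> m) (x \<^bold>\<cdot> n)" by (rule decreasing_le[OF x3 forces_mono[OF dec le3(1)] nm])
      have d: "w3 \<Turnstile> is_real (real_of (unit_frac k))" using k3 by (intro is_real_real_of) simp
      have "w3 \<Turnstile> rle (rabs (rminus (x \<^bold>\<cdot> m) rzero)) (real_of (unit_frac k))"
      proof (rule dist_leI[OF d xm is_real_rzero])
        fix w4 j assume w4: "w3 \<le> w4" and j: "of_type w4 j Nat"
        have le4: "w \<le> w4" "w1 \<le> w4" "w2 \<le> w4" using le3 w3 w4 by (auto intro: order_trans)
        note k4 = of_type_mono[OF k le4(2)] and n4 = of_type_mono[OF n3 w4] and i4 = of_type_mono[OF i le4(2)]
        have hk4: "of_type w4 (hf k) Nat" and uk4: "of_type w4 (unit_frac k) Rat" using k4 by simp_all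
        have t: "of_type w4 (x \<^bold>\<cdot> m) Real" "of_type w4 (x \<^bold>\<cdot> n) Real"
          using is_real_typed_mono[OF xm w4] is_real_typed_mono[OF xn w4] .
        have xk: "w4 \<Turnstile> qle (x \<^bold>\<cdot> n \<^bold>\<cdot> j) (qadd (unit_frac k) (unit_frac j))"
          by (rule lin5[OF forces_mono[OF small le4(3)] s_val[OF le4(2) n4] reg[OF xn w4 j i4]
                uf_half[OF k4] uf_half[OF hk4]])
            (use t j k4 in \<open>auto simp: hom_def\<close>)
        have abs: "w4 \<Turnstile> abs_spec (qminus (x \<^bold>\<cdot> m \<^bold>\<cdot> j) (rzero \<^bold>\<cdot> j))" using t j by (intro abs_spec) simp
        show "w4 \<Turnstile> qle (qabs (qminus (x \<^bold>\<cdot> m \<^bold>\<cdot> j) (rzero \<^bold>\<cdot> j)))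
            (qadd (real_of (unit_frac k) \<^bold>\<cdot> j) (qadd (e3 j) (e2 j)))"
          by (rule lin8[OF xk abs rleD[OF mono xm xn w4 j] rleD[OF nonnegD[OF nonneg le3(1) m] is_real_rzero xm w4 j]
                rzero_val[OF j] real_of_val[OF uk4 j] uf_pos[OF j] uf_pos[OF k4]])
            (use t j uk4 in \<open>auto simp: hom_def qminus_def\<close>)
      qed
      then show "w3 \<Turnstile> subf (case_nat m (case_nat n Var))
          (rle (rabs (rminus (wk 2 x \<^bold>\<cdot> Var 0) (wk 2 rzero))) (real_of (unit_frac (wk 2 k))))" by simp
    qed
  qed
  then show "w1 \<Turnstile> subf (inst k) (Ex Nat (All Nat (nle (Var 1) (Var 0) \<^bold>\<longrightarrow>
    rle (rabs (rminus (wk 3 x \<^bold>\<cdot> Var 0) (wk 3 rzero))) (real_of (unit_frac (Var 2))))))" by simp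
qed

theorem corollary8:
  shows "{MP, AS_unit} \<turnstile>\<^bsub>[]\<^esub>
    All (Nat \<^bold>\<Rightarrow> Real)
      (is_real_seq (Var 0) \<^bold>\<and> decreasing (Var 0) \<^bold>\<and> nonneg_seq (Var 0) \<^bold>\<longrightarrow>
        (converges (Var 0) rzero \<^bold>\<longleftrightarrow> apparently_convergent (Var 0)))"
proof -
  define w where "w = mk_world {MP, AS_unit} []"
  have wf: "wf_fm A []" if "A \<in> {MP, AS_unit}" for A
    using that by (auto simp: MP_def AS_unit_def AllR_def)
  have w: "hyps w = {MP, AS_unit}" "ctx w = []" unfolding w_def using mk_world[OF wf] by blast+
  have mp: "w \<Turnstile> MP" and as: "w \<Turnstile> AS_unit" by (simp_all add: forces_assm w)
  have "w \<Turnstile> All (Nat \<^bold>\<Rightarrow> Real)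
      (is_real_seq (Var 0) \<^bold>\<and> decreasing (Var 0) \<^bold>\<and> nonneg_seq (Var 0) \<^bold>\<longrightarrow>
        (converges (Var 0) rzero \<^bold>\<longleftrightarrow> apparently_convergent (Var 0)))"
  proof (rule f_allI)
    fix w1 x assume w1: "w \<le> w1" and tx: "of_type w1 x (Nat \<^bold>\<Rightarrow> Real)"
    have "w1 \<Turnstile> is_real_seq x \<^bold>\<and> decreasing x \<^bold>\<and> nonneg_seq x \<^bold>\<longrightarrow>
        (converges x rzero \<^bold>\<longleftrightarrow> apparently_convergent x)"
    proof (rule f_impI)
      fix w2 assume w2: "w1 \<le> w2" and "w2 \<Turnstile> is_real_seq x \<^bold>\<and> decreasing x \<^bold>\<and> nonneg_seq x"
      then have x: "w2 \<Turnstile> is_real_seq x" "w2 \<Turnstile> decreasing x" "w2 \<Turnstile> nonneg_seq x" by (simp_all add: f_conj_iff)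
      have tx2: "of_type w2 x (Nat \<^bold>\<Rightarrow> Real)" using tx w2 by (rule of_type_mono)
      show "w2 \<Turnstile> converges x rzero \<^bold>\<longleftrightarrow> apparently_convergent x"
      proof (rule f_conjI)
        show "w2 \<Turnstile> converges x rzero \<^bold>\<longrightarrow> apparently_convergent x"
        proof (rule f_impI)
          fix w3 assume w3: "w2 \<le> w3" and conv: "w3 \<Turnstile> converges x rzero"
          show "w3 \<Turnstile> apparently_convergent x"
            by (rule converges_apparently_convergent[OF forces_mono[OF x(1) w3] conv])
        qed (use tx2 in simp)
        show "w2 \<Turnstile> apparently_convergent x \<^bold>\<longrightarrow> converges x rzero"
        proof (rule f_impI)
          fix w3 assume w3: "w2 \<le> w3" and app: "w3 \<Turnstile> apparently_convergent x"
          have le: "w \<le> w3" using w1 w2 w3 order_trans by blast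
          show "w3 \<Turnstile> converges x rzero"
            by (rule apparently_convergent_converges[OF forces_mono[OF mp le] forces_mono[OF as le]
                  x[THEN forces_mono, OF w3] app])
        qed (use tx2 in simp)
      qed
    qed (use tx in simp)
    then show "w1 \<Turnstile> subf (inst x) (is_real_seq (Var 0) \<^bold>\<and> decreasing (Var 0) \<^bold>\<and> nonneg_seq (Var 0) \<^bold>\<longrightarrow>
        (converges (Var 0) rzero \<^bold>\<longleftrightarrow> apparently_convergent (Var 0)))" by simp
  qed simp
  then show ?thesis by (simp add: forces_def w)
qed

end
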